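(* Let $\mathcal M$ be a complete $C^1$ Finsler manifold, $F\in C^1(\mathcal M)$ real valued, and $\Psi=(\beta,\gamma):\mathcal M\to\mathbb R^N\times\mathbb R$ continuous. Fix $\gamma_*>0$, put $z_*=(0,\gamma_* )$, and define $\mathcal A_*:=\Psi^{-1}(\{0\}\times[\gamma_*,\infty))$ and $\mathcal Z_*:=\Psi^{-1}(z_* )$. Let $K$ be the closure of a bounded open subset of $\mathbb R^{N+1}$ which is homeomorphic to a ball, let $\Pi:K\to\mathcal M$ be continuous, and suppose \[ z_*\notin(\Psi\circ\Pi)(\partial K),\qquad\deg(\Psi\circ\Pi,\operatorname{int}K,z_* )\ne0 . \] Set \[ a:=\inf_{\mathcal A_*}F,\quad b:=\max_{\partial K}F\circ\Pi,\quad d:=\inf_{\mathcal Z_*}F,\quad e:=\max_KF\circ\Pi . \] Assume that $F$ satisfies the Palais--Smale condition at every level in $(S_0,\kappa)$, where $S_0<\kappa$. (i) If $S_0<a\le b<\min\{d,\kappa\}$, then $F$ has a critical point $v_1$ with $a\le F(v_1)\le b$. (ii) If, in addition, $b<d\le e<\kappa$, then $F$ has a second critical point $v_2$ with $d\le F(v_2)\le e$. In particular, $F(v_1)<F(v_2)$.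
   Context: $N$ is a positive integer and $\deg$ is the Brouwer degree. $F$ satisfies the Palais--Smale condition at level $c$ if every sequence $\{u_k\}\subset\mathcal M$ with $F(u_k)\to c$ and $\|dF(u_k)\|_{T^*_{u_k}\mathcal M}\to0$ has a strongly convergent subsequence. *)

theory Defs
  imports "HOL-Analysis.Analysis" "HOL-Homology.Homology"
begin

section \<open>C1 Banach manifolds\<close>

definition C1_on :: "('a::real_normed_vector \<Rightarrow> 'b::real_normed_vector) \<Rightarrow> 'a set \<Rightarrow> bool" where
  "C1_on f S \<longleftrightarrow> (\<exists>f'. (\<forall>x\<in>S. (f has_derivative blinfun_apply (f' x)) (at x)) \<and>
                     continuous_on S f')"

text \<open>The manifold is the type \<open>'m\<close>, modelled on the Banach space \<open>'e\<close>.
  A chart is its domain together with the coordinate map; the values of the latter outside the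
  domain are irrelevant.\<close>

type_synonym ('m, 'e) chart = "'m set \<times> ('m \<Rightarrow> 'e)"

definition chart_inv :: "('m, 'e) chart \<Rightarrow> 'e \<Rightarrow> 'm" where
  "chart_inv c = inv_into (fst c) (snd c)"

definition C1_atlas ::
  "('m::topological_space, 'e::banach) chart set \<Rightarrow> bool" where
  "C1_atlas A \<longleftrightarrow>
     (\<Union>c\<in>A. fst c) = UNIV \<and>
     (\<forall>c\<in>A. open (fst c) \<and> open (snd c ` fst c) \<and>
            homeomorphism (fst c) (snd c ` fst c) (snd c) (chart_inv c)) \<and>
     (\<forall>c\<in>A. \<forall>c'\<in>A. C1_on (snd c' \<circ> chart_inv c) (snd c ` (fst c \<inter> fst c')))"

definition chart_at :: "('m, 'e) chart set \<Rightarrow> 'm \<Rightarrow> ('m, 'e) chart" where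
  "chart_at A x = (SOME c. c \<in> A \<and> x \<in> fst c)"

section \<open>Finsler structures\<close>

text \<open>A tangent vector at \<open>x\<close> is a class of pairs \<open>(c, v)\<close>, \<open>c\<close> a chart at \<open>x\<close> and \<open>v :: 'e\<close>,
  where \<open>(c, v)\<close> and \<open>(c', D(c' \<circ> c\<inverse>) v)\<close> are identified. A function on the tangent bundle is
  given by its expression \<open>nrm c x v\<close> in the charts of the atlas, subject to the transition rule
  (second conjunct). The first conjunct says that each \<open>nrm c x\<close> is a norm inducing the topology of
  the tangent space, the third one is Palais' local comparison condition.\<close>

definition finsler_structure ::
  "('m::topological_space, 'e::banach) chart set \<Rightarrow>
   (('m, 'e) chart \<Rightarrow> 'm \<Rightarrow> 'e \<Rightarrow> real) \<Rightarrow> bool" where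
  "finsler_structure A nrm \<longleftrightarrow>
     (\<forall>c\<in>A. \<forall>x\<in>fst c.
        (\<forall>v w. nrm c x (v + w) \<le> nrm c x v + nrm c x w) \<and>
        (\<forall>r v. nrm c x (r *\<^sub>R v) = \<bar>r\<bar> * nrm c x v) \<and>
        (\<exists>m>0. \<exists>M>0. \<forall>v. m * norm v \<le> nrm c x v \<and> nrm c x v \<le> M * norm v)) \<and>
     (\<forall>c\<in>A. \<forall>c'\<in>A. \<forall>x\<in>fst c \<inter> fst c'. \<forall>v.
        nrm c' x (frechet_derivative (snd c' \<circ> chart_inv c) (at (snd c x)) v) = nrm c x v) \<and>
     (\<forall>c\<in>A. \<forall>x0\<in>fst c. \<forall>k>1. \<exists>V. open V \<and> x0 \<in> V \<and> V \<subseteq> fst c \<and>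
        (\<forall>x\<in>V. \<forall>v. nrm c x v \<le> k * nrm c x0 v \<and> nrm c x0 v \<le> k * nrm c x v))"

definition C1_path :: "('m::topological_space, 'e::banach) chart set \<Rightarrow> (real \<Rightarrow> 'm) \<Rightarrow> bool" where
  "C1_path A \<sigma> \<longleftrightarrow> continuous_on {0..1} \<sigma> \<and>
     (\<forall>c\<in>A. \<exists>D. continuous_on {t\<in>{0..1}. \<sigma> t \<in> fst c} D \<and>
        (\<forall>t\<in>{0..1}. \<sigma> t \<in> fst c \<longrightarrow>
           ((snd c \<circ> \<sigma>) has_vector_derivative D t) (at t within {0..1})))"

text \<open>By the transition rule, the speed of a path and the norm of a differential below do not
  depend on the chart chosen at the point.\<close>

definition finsler_speed ::
  "('m, 'e::banach) chart set \<Rightarrow> (('m, 'e) chart \<Rightarrow> 'm \<Rightarrow> 'e \<Rightarrow> real) \<Rightarrow>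
   (real \<Rightarrow> 'm) \<Rightarrow> real \<Rightarrow> real" where
  "finsler_speed A nrm \<sigma> t =
     (let c = chart_at A (\<sigma> t)
      in nrm c (\<sigma> t) (vector_derivative (snd c \<circ> \<sigma>) (at t within {0..1})))"

definition finsler_length ::
  "('m, 'e::banach) chart set \<Rightarrow> (('m, 'e) chart \<Rightarrow> 'm \<Rightarrow> 'e \<Rightarrow> real) \<Rightarrow> (real \<Rightarrow> 'm) \<Rightarrow> real" where
  "finsler_length A nrm \<sigma> = integral {0..1} (finsler_speed A nrm \<sigma>)"

text \<open>The distance between points of different components is infinite, so that completeness means
  completeness of every component.\<close>

definition finsler_dist ::
  "('m::topological_space, 'e::banach) chart set \<Rightarrow> (('m, 'e) chart \<Rightarrow> 'm \<Rightarrow> 'e \<Rightarrow> real) \<Rightarrow>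
   'm \<Rightarrow> 'm \<Rightarrow> ereal" where
  "finsler_dist A nrm x y =
     (INF \<sigma>\<in>{\<sigma>. C1_path A \<sigma> \<and> \<sigma> 0 = x \<and> \<sigma> 1 = y}. ereal (finsler_length A nrm \<sigma>))"

definition finsler_complete ::
  "('m::topological_space, 'e::banach) chart set \<Rightarrow> (('m, 'e) chart \<Rightarrow> 'm \<Rightarrow> 'e \<Rightarrow> real) \<Rightarrow> bool" where
  "finsler_complete A nrm \<longleftrightarrow>
     (\<forall>u :: nat \<Rightarrow> 'm.
        (\<forall>\<epsilon>>0. \<exists>k0. \<forall>k\<ge>k0. \<forall>l\<ge>k0. finsler_dist A nrm (u k) (u l) < ereal \<epsilon>) \<longrightarrow>
        (\<exists>x. (\<lambda>k. finsler_dist A nrm (u k) x) \<longlonglongrightarrow> 0))"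

text \<open>Following Palais, a Finsler manifold is regular as a topological space (class
  \<open>t3_space\<close>); this makes \<open>finsler_dist\<close> a metric inducing the manifold topology on components.\<close>

definition complete_C1_finsler_manifold ::
  "('m::t3_space, 'e::banach) chart set \<Rightarrow> (('m, 'e) chart \<Rightarrow> 'm \<Rightarrow> 'e \<Rightarrow> real) \<Rightarrow> bool" where
  "complete_C1_finsler_manifold A nrm \<longleftrightarrow>
     C1_atlas A \<and> finsler_structure A nrm \<and> finsler_complete A nrm"

section \<open>C1 functionals\<close>

definition C1_functional ::
  "('m::topological_space, 'e::banach) chart set \<Rightarrow> ('m \<Rightarrow> real) \<Rightarrow> bool" where
  "C1_functional A F \<longleftrightarrow> (\<forall>c\<in>A. C1_on (F \<circ> chart_inv c) (snd c ` fst c))"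

definition chart_differential ::
  "('m, 'e::banach) chart \<Rightarrow> ('m \<Rightarrow> real) \<Rightarrow> 'm \<Rightarrow> 'e \<Rightarrow> real" where
  "chart_differential c F x = frechet_derivative (F \<circ> chart_inv c) (at (snd c x))"

definition critical_point :: "('m, 'e::banach) chart set \<Rightarrow> ('m \<Rightarrow> real) \<Rightarrow> 'm \<Rightarrow> bool" where
  "critical_point A F x \<longleftrightarrow> (\<forall>v. chart_differential (chart_at A x) F x v = 0)"

definition differential_norm ::
  "('m, 'e::banach) chart set \<Rightarrow> (('m, 'e) chart \<Rightarrow> 'm \<Rightarrow> 'e \<Rightarrow> real) \<Rightarrow>
   ('m \<Rightarrow> real) \<Rightarrow> 'm \<Rightarrow> real" where
  "differential_norm A nrm F x =
     (let c = chart_at A x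
      in SUP v\<in>{v. nrm c x v \<le> 1}. \<bar>chart_differential c F x v\<bar>)"

definition palais_smale ::
  "('m::topological_space, 'e::banach) chart set \<Rightarrow> (('m, 'e) chart \<Rightarrow> 'm \<Rightarrow> 'e \<Rightarrow> real) \<Rightarrow>
   ('m \<Rightarrow> real) \<Rightarrow> real \<Rightarrow> bool" where
  "palais_smale A nrm F l \<longleftrightarrow>
     (\<forall>u :: nat \<Rightarrow> 'm.
        (\<lambda>k. F (u k)) \<longlonglongrightarrow> l \<and> (\<lambda>k. differential_norm A nrm F (u k)) \<longlonglongrightarrow> 0 \<longrightarrow>
        (\<exists>x r. strict_mono r \<and> (u \<circ> r) \<longlonglongrightarrow> x))"

section \<open>Brouwer degree\<close>

text \<open>Homological definition of the degree \<open>deg(f, \<Omega>, y)\<close> (Dold, Lectures on Algebraic Topology,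
  IV.5 and VIII.4), for \<open>f\<close> continuous on the closure of the bounded open set \<open>\<Omega>\<close> and \<open>y\<close> outside
  the image of the boundary, so that \<open>C = \<Omega> \<inter> f\<inverse>(y)\<close> is compact.
  With \<open>n\<close> the dimension of the space \<open>E\<close>, let \<open>u\<close> range over the infinite cyclic group
  \<open>H\<^sub>n(E, E - B)\<close>, \<open>B\<close> a large ball. Its image in \<open>H\<^sub>n(E, E - C)\<close> is, by excision, the image
  of a unique \<open>w\<close> in \<open>H\<^sub>n(\<Omega>, \<Omega> - C)\<close>. The degree is the integer \<open>d\<close> such that the image of \<open>w\<close>
  under \<open>f\<close> in \<open>H\<^sub>n(E, E - {y})\<close> is \<open>d\<close> times the image of \<open>u\<close> there. It is
  independent of the choice of \<open>u\<close>, in particular of an orientation, and is \<open>1\<close> for the identity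
  when \<open>y \<in> \<Omega>\<close>.\<close>

definition brouwer_degree :: "('a::euclidean_space \<Rightarrow> 'a) \<Rightarrow> 'a set \<Rightarrow> 'a \<Rightarrow> int" where
  "brouwer_degree f \<Omega> y =
     (let n = int DIM('a); C = {x \<in> \<Omega>. f x = y} in
      THE d. \<forall>R u w.
        \<Omega> \<subseteq> ball 0 R \<and> y \<in> ball 0 R \<and>
        u \<in> carrier (relative_homology_group n euclidean (- ball 0 R)) \<and>
        w \<in> carrier (relative_homology_group n (top_of_set \<Omega>) (\<Omega> - C)) \<and>
        hom_induced n (top_of_set \<Omega>) (\<Omega> - C) euclidean (- C) id w =
          hom_induced n euclidean (- ball 0 R) euclidean (- C) id u \<longrightarrow>
        hom_induced n (top_of_set \<Omega>) (\<Omega> - C) euclidean (- {y}) f w =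
          hom_induced n euclidean (- ball 0 R) euclidean (- {y}) id u
            [^]\<^bsub>relative_homology_group n euclidean (- {y})\<^esub> d)"

end

theory Submission
  imports Defs
begin

text \<open>
  Both critical points come from a minimax over continuous maps \<open>g\<close> of a compact set \<open>Q\<close> into the
  manifold, of the value \<open>max F \<circ> g\<close>. For the first one \<open>Q\<close> is the boundary of \<open>K\<close> and \<open>g\<close> ranges
  over the maps with \<open>F \<circ> g \<le> b\<close> for which \<open>\<Psi> \<circ> g\<close> is homotopic to \<open>\<Psi> \<circ> \<Pi>\<close> off \<open>z\<^sub>*\<close>; such a map
  meets \<open>\<A>\<^sub>*\<close>, since otherwise \<open>\<Psi> \<circ> g\<close> would avoid a ray from \<open>z\<^sub>*\<close>, hence be null homotopic off
  \<open>z\<^sub>*\<close>, and the degree would vanish. As \<open>b < d\<close>, deformations that decrease \<open>F\<close> stay in this class.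
  For the second one \<open>Q = K\<close> and \<open>g\<close> agrees with \<open>\<Pi>\<close> on the boundary; then \<open>g\<close> meets \<open>\<Z>\<^sub>*\<close>.

  On a manifold of class \<open>C\<^sup>1\<close> there is no pseudo-gradient flow. Instead, Ekeland's principle in the
  complete space of maps yields an almost minimal \<open>g\<close> that cannot be improved at a rate \<open>\<epsilon>\<close>, while
  straight segments in finitely many charts, composed with weights given by a partition of unity
  on \<open>Q\<close>, would improve it if \<open>\<parallel>dF\<parallel> > 2\<epsilon>\<close> wherever \<open>F \<circ> g\<close> is maximal. This gives a Palais--Smale
  sequence at the minimax level.
\<close>

section \<open>Brouwer degree\<close>

text \<open>One balance fixes the constants. A deformation moves every point by at most
  \<open>t\<close> in the Finsler distance and lowers the maximum by at least half of the slope
  times \<open>t\<close>; a slope above \<open>2 * \<epsilon>\<close> therefore gives the rate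
  \<open>\<epsilon>\<close> that an Ekeland point forbids. Chart segments at different points cannot
  be added on a manifold, so they are run one after another: displacement and decrease of
  \<open>F\<close> add up, provided that each local motion is defined on a ball of twice the radius
  on which it is switched on. Measuring time by distance, and having a complete space of maps,
  requires that the Finsler distance be a metric for the given topology. Both classes have to be
  closed under uniform limits and under these motions. In the first one nothing is held fixed on the
  frontier: the bound \<open>b < d\<close> alone keeps \<open>\<Psi> \<circ> g\<close> off
  \<open>zs\<close>, also in the limit. In the second one the frontier lies in the set
  \<open>F \<le> b\<close>, where the motions are made to rest. That the degree vanishes for a map
  whose boundary values extend without the value \<open>z\<close> is proved directly from the
  homological definition, by a homotopy of pairs.\<close>

lemma iso_surjE:
  assumes "f \<in> iso G H" "y \<in> carrier H"
  obtains x where "x \<in> carrier G" "f x = y"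
proof -
  have "f ` carrier G = carrier H" using assms(1) by (simp add: iso_iff)
  with assms(2) have "y \<in> f ` carrier G" by simp
  then show ?thesis using that by auto
qed

text \<open>This is what makes the integer in the definition of the degree unique.\<close>

lemma sphere_class_infinite_order:
  fixes y :: "'a::euclidean_space"
  assumes y: "y \<in> ball 0 R"
  obtains u where
    "u \<in> carrier (relative_homology_group (int DIM('a)) euclidean (- ball (0::'a) R))"
    "\<And>k::int. hom_induced (int DIM('a)) euclidean (- ball 0 R) euclidean (- {y}) id u
        [^]\<^bsub>relative_homology_group (int DIM('a)) euclidean (- {y})\<^esub> k
      = \<one>\<^bsub>relative_homology_group (int DIM('a)) euclidean (- {y})\<^esub> \<Longrightarrow> k = 0"
proof -
  define n where "n = DIM('a)"
  have n: "n > 0" "int n - 1 = int (n - 1)" by (auto simp: n_def of_nat_diff Suc_leI)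
  have R: "R > 0" using y le_less_trans[OF norm_ge_zero] by auto
  let ?S = "nsphere (n - 1)"
  obtain f g where fg: "homeomorphic_maps ?S (top_of_set (sphere 0 1 \<inter> span (Basis::'a set))) f g"
    using homeomorphic_maps_nsphere_euclidean_sphere[OF independent_Basis orthogonal_Basis refl _ norm_Basis]
    by (metis n(1) n_def neq0_conv)
  then have fg: "homeomorphic_maps ?S (top_of_set (sphere (0::'a) 1)) f g" by simp
  \<comment> \<open>\<open>h\<close> carries the unit sphere onto the sphere of radius
    \<open>R\<close>, which lies in the complement of the open ball and is a retract of the space
    without \<open>y\<close>. So \<open>h\<close> has a left inverse on that space and is injective
    in homology.\<close>
  define h where "h = (\<lambda>x. R *\<^sub>R f x)"
  have "frontier (cball (0::'a) R) retract_of (- {y})"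
    by (rule frontier_retract_of_punctured_universe) (use y R in \<open>auto simp: interior_cball\<close>)
  then obtain r where r: "retraction (- {y}) (sphere 0 R) r"
    using R unfolding retract_of_def by auto
  let ?B = "- ball (0::'a) R" and ?Y = "- {y}"
  have hS: "h x \<in> sphere 0 R" if "x \<in> topspace ?S" for x
  proof -
    have "f \<in> topspace ?S \<rightarrow> sphere 0 1"
      using fg by (simp add: homeomorphic_maps_def continuous_map_in_subtopology)
    then have "norm (f x) = 1" using that by auto
    then show ?thesis using R by (simp add: h_def)
  qed
  have yB: "?B \<subseteq> ?Y" "sphere 0 R \<subseteq> ?B" using y by auto
  have hc: "continuous_map ?S euclidean h"
    using fg continuous_map_compose[of ?S euclidean f euclidean "\<lambda>x. R *\<^sub>R x"]
    by (simp add: homeomorphic_maps_def continuous_map_in_subtopology h_def o_def continuous_intros)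
  have hB: "continuous_map ?S (top_of_set ?B) h" and hY: "continuous_map ?S (top_of_set ?Y) h"
    using hc hS yB by (auto simp: continuous_map_in_subtopology)
  have sec: "section_map ?S (top_of_set ?Y) h"
  proof -
    have c1: "continuous_map (top_of_set ?Y) (top_of_set (sphere 0 1)) (\<lambda>x. r x /\<^sub>R R)"
      using r R by (auto simp: retraction_def Pi_iff intro!: continuous_intros)
    have "continuous_map (top_of_set ?Y) ?S (g \<circ> (\<lambda>x. r x /\<^sub>R R))"
      by (rule continuous_map_compose[OF c1]) (use fg in \<open>auto simp: homeomorphic_maps_def\<close>)
    moreover have "(g \<circ> (\<lambda>x. r x /\<^sub>R R)) (h x) = x" if "x \<in> topspace ?S" for x
      using hS[OF that] r R fg that by (auto simp: h_def retraction_def homeomorphic_maps_def)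
    ultimately show ?thesis
      using hY unfolding section_map_def retraction_maps_def by blast
  qed
  \<comment> \<open>Reduced homology is infinite cyclic also for \<open>n = 1\<close>, where the
    sphere consists of two points.\<close>
  let ?G = "reduced_homology_group (int (n-1)) ?S"
  obtain a where a: "a \<in> carrier ?G" "\<And>k::int. a [^]\<^bsub>?G\<^esub> k = \<one>\<^bsub>?G\<^esub> \<Longrightarrow> k = 0"
  proof -
    obtain a where a: "a \<in> carrier ?G" and aeq: "subgroup_generated ?G {a} = ?G"
      using cyclic_reduced_homology_group_nsphere [of "int (n-1)" "n-1"] by (auto simp: cyclic_group_def)
    interpret group ?G by simp
    have "infinite (carrier ?G)"
      using iso_finite[OF reduced_homology_group_nsphere(1)[of "n - 1"]] by simp
    then have "ord a = 0"
      using infinite_cyclic_subgroup_order[OF a] aeq by simp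
    then have "k = 0" if "a [^]\<^bsub>?G\<^esub> k = \<one>\<^bsub>?G\<^esub>" for k :: int
      using int_pow_eq_id[OF a, of k] that by simp
    then show ?thesis by (rule that[OF a])
  qed
  have aH: "a \<in> carrier (homology_group (int (n-1)) ?S)"
    using a(1) by (meson carrier_reduced_homology_group_subset subsetD)
  have an: "k = 0" if "a [^]\<^bsub>homology_group (int (n-1)) ?S\<^esub> k = \<one>\<^bsub>homology_group (int (n-1)) ?S\<^esub>" for k :: int
  proof -
    have "a [^]\<^bsub>?G\<^esub> k = a [^]\<^bsub>homology_group (int (n-1)) ?S\<^esub> k"
      using group.int_pow_subgroup_generated[OF group_relative_homology_group] a(1)
      by (simp add: reduced_homology_group_def)
    then show ?thesis using a(2)[of k] that by (simp add: one_reduced_homology_group)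
  qed
  define a' where "a' = hom_induced (int (n-1)) ?S {} (top_of_set ?B) {} h a"
  have a': "a' \<in> carrier (reduced_homology_group (int n - 1) (top_of_set ?B))"
    unfolding a'_def n(2) using hom_induced_reduced[OF a(1)] by blast
  \<comment> \<open>The whole space is contractible, so the boundary map is an isomorphism and lifts
    \<open>a'\<close> to a relative class \<open>u\<close>. Naturality of the boundary later turns a
    relation for the image of \<open>u\<close> into one for \<open>a\<close>.\<close>
  have "hom_boundary (int n) euclidean ?B
      \<in> iso (relative_homology_group (int n) euclidean ?B) (reduced_homology_group (int n - 1) (top_of_set ?B))"
  proof (rule iso_relative_homology_of_contractible)
    show "contractible_space (euclidean :: 'a topology)"
      using contractible_UNIV contractible_space_top_of_set by (metis subtopology_UNIV)
    have "(\<exists>x::'a. norm x = R)" using R by (metis less_imp_le vector_choose_size)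
    then show "topspace euclidean \<inter> ?B \<noteq> {}" by auto
  qed
  then obtain u where u: "u \<in> carrier (relative_homology_group (int n) euclidean ?B)"
      "hom_boundary (int n) euclidean ?B u = a'"
    using a' by (rule iso_surjE)
  show thesis
  proof (rule that[of u])
    show "u \<in> carrier (relative_homology_group (int DIM('a)) euclidean (- ball (0::'a) R))"
      using u(1) by (simp add: n_def)
    fix k :: int
    let ?HY = "relative_homology_group (int n) euclidean ?Y"
    let ?KY = "homology_group (int n - 1) (top_of_set ?Y)"
    let ?v = "hom_induced (int n) euclidean ?B euclidean ?Y id u"
    assume "hom_induced (int DIM('a)) euclidean (- ball 0 R) euclidean (- {y}) id u
        [^]\<^bsub>relative_homology_group (int DIM('a)) euclidean (- {y})\<^esub> k
      = \<one>\<^bsub>relative_homology_group (int DIM('a)) euclidean (- {y})\<^esub>"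
    then have k: "?v [^]\<^bsub>?HY\<^esub> k = \<one>\<^bsub>?HY\<^esub>" by (simp add: n_def)
    let ?bd = "hom_boundary (int n) euclidean ?Y"
    have gh: "group_hom ?HY ?KY ?bd"
      using hom_boundary_hom by (intro group_hom.intro) (auto simp: group_hom_axioms_def)
    have gi: "group_hom (homology_group (int n - 1) ?S) ?KY (hom_induced (int n - 1) ?S {} (top_of_set ?Y) {} h)"
      by (intro group_hom.intro) (auto simp: group_hom_axioms_def hom_induced_empty_hom)
    have "?bd ?v = hom_induced (int n - 1) (top_of_set ?B) {} (top_of_set ?Y) {} id a'"
    proof -
      have "id \<in> ?B \<rightarrow> ?Y" using yB(1) by auto
      from fun_cong[OF naturality_hom_induced[OF continuous_map_id this, of "int n"], where x = u]
      show ?thesis using u(2) by simp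
    qed
    also have "\<dots> = hom_induced (int n - 1) ?S {} (top_of_set ?Y) {} (id \<circ> h) a"
      unfolding a'_def n(2)
      by (rule hom_induced_compose') (use hB yB in auto)
    finally have bv: "?bd ?v = hom_induced (int n - 1) ?S {} (top_of_set ?Y) {} h a" by simp
    have "?bd ?v [^]\<^bsub>?KY\<^esub> k = \<one>\<^bsub>?KY\<^esub>"
      using group_hom.hom_int_pow[OF gh, of ?v k] k group_hom.hom_one[OF gh]
      by (simp add: hom_induced_carrier)
    then have "hom_induced (int n - 1) ?S {} (top_of_set ?Y) {} h (a [^]\<^bsub>homology_group (int n - 1) ?S\<^esub> k)
      = hom_induced (int n - 1) ?S {} (top_of_set ?Y) {} h \<one>\<^bsub>homology_group (int n - 1) ?S\<^esub>"
      using group_hom.hom_int_pow[OF gi, of a k] group_hom.hom_one[OF gi] aH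
      by (simp add: bv n(2))
    from inj_on_hom_induced_section_map[OF sec] this
    have "a [^]\<^bsub>homology_group (int n - 1) ?S\<^esub> k = \<one>\<^bsub>homology_group (int n - 1) ?S\<^esub>"
    proof (rule inj_onD)
      show "a [^]\<^bsub>homology_group (int n - 1) ?S\<^esub> k \<in> carrier (homology_group (int n - 1) ?S)"
        by (intro group.int_pow_closed group_relative_homology_group aH[folded n(2)])
      show "\<one>\<^bsub>homology_group (int n - 1) ?S\<^esub> \<in> carrier (homology_group (int n - 1) ?S)"
        by (intro monoid.one_closed group.is_monoid group_relative_homology_group)
    qed
    then show "k = 0" by (intro an) (simp only: n(2))
  qed
qed

text \<open>The excised set is \<open>- \<Omega>\<close>, which is closed and contained in the open
  set \<open>- C\<close>.\<close>

lemma excision_iso: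
  fixes \<Omega> :: "'a::euclidean_space set"
  assumes "open \<Omega>" "closed C" "C \<subseteq> \<Omega>"
  shows "hom_induced p (top_of_set \<Omega>) (\<Omega> - C) euclidean (- C) id
    \<in> iso (relative_homology_group p (top_of_set \<Omega>) (\<Omega> - C))
          (relative_homology_group p euclidean (- C))"
proof -
  have "closure (- \<Omega>) = - \<Omega>" using assms(1) by (simp add: closed_Compl)
  then have "hom_induced p (subtopology euclidean (UNIV - - \<Omega>)) (- C - - \<Omega>) (subtopology euclidean UNIV) (- C) id
    \<in> iso (relative_homology_group p (subtopology euclidean (UNIV - - \<Omega>)) (- C - - \<Omega>))
          (relative_homology_group p (subtopology euclidean UNIV) (- C))"
    by (intro homology_excision_axiom) (use assms in \<open>auto simp: interior_open open_Compl\<close>)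
  moreover have "UNIV - - \<Omega> = \<Omega>" "- C - - \<Omega> = \<Omega> - C" by auto
  ultimately show ?thesis by simp
qed

text \<open>The straight-line homotopy from \<open>f\<close> to \<open>g\<close> is constant on the
  frontier, so the points sent to \<open>z\<close> at some time form a compact subset of
  \<open>\<Omega>\<close>. The class \<open>w\<close> lifts to the pair in which this larger set is
  removed; there \<open>f\<close> and \<open>g\<close> are homotopic as maps of pairs, and
  \<open>g\<close> factors through the complement of \<open>z\<close> modulo itself, whose homology
  is trivial.\<close>

lemma brouwer_degree_eq_0_if_extension:
  fixes f g :: "'a::euclidean_space \<Rightarrow> 'a"
  assumes \<Omega>: "open \<Omega>" "bounded \<Omega>"
    and f: "continuous_on (closure \<Omega>) f" and g: "continuous_on (closure \<Omega>) g"
    and fg: "\<And>x. x \<in> frontier \<Omega> \<Longrightarrow> f x = g x"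
    and gz: "z \<notin> g ` closure \<Omega>"
  shows "brouwer_degree f \<Omega> z = 0"
proof -
  define n where "n = int DIM('a)"
  define H where "H = (\<lambda>t x. (1 - t) *\<^sub>R f x + t *\<^sub>R g x)" for t :: real
  define C where "C = {x \<in> \<Omega>. f x = z}"
  \<comment> \<open>Removing the points that reach \<open>z\<close> at any time, not only those of
    \<open>C\<close> (time 0), makes the homotopy one of maps of pairs.\<close>
  define C' where "C' = {x \<in> \<Omega>. \<exists>t\<in>{0..1}. H t x = z}"
  have Hcont: "continuous_on ({0..1} \<times> closure \<Omega>) (\<lambda>(t, x). H t x)"
    unfolding H_def case_prod_unfold
    by (intro continuous_intros continuous_on_compose2[OF f] continuous_on_compose2[OF g]) auto
  have Hfr: "H t x = g x" if "x \<in> frontier \<Omega>" for t x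
    using fg[OF that] by (simp add: H_def algebra_simps flip: scaleR_add_left)
  have clo: "x \<in> \<Omega> \<or> x \<in> frontier \<Omega>" if "x \<in> closure \<Omega>" for x
    using that \<Omega>(1) by (auto simp: frontier_def interior_open)
  have ccl: "compact (closure \<Omega>)" using \<Omega>(2) by (simp add: compact_closure)
  have CC': "C \<subseteq> C'" by (force simp: C_def C'_def H_def)
  have "compact (({0..1} \<times> closure \<Omega>) \<inter> (\<lambda>(t, x). H t x) -` {z})"
    using compact_Int_closed[OF compact_Times[OF compact_Icc[of 0 1] ccl] continuous_closed_preimage[OF Hcont _ closed_singleton[of z]]]
    by (simp add: closed_Times)
  then have "compact (snd ` (({0..1} \<times> closure \<Omega>) \<inter> (\<lambda>(t, x). H t x) -` {z}))"
    by (intro compact_continuous_image continuous_intros)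
  moreover have "snd ` (({0..1} \<times> closure \<Omega>) \<inter> (\<lambda>(t, x). H t x) -` {z}) = C'"
  proof -
    have "x \<in> \<Omega>" if "x \<in> closure \<Omega>" "H t x = z" for t x
      using clo[OF that(1)] Hfr[of x t] gz that by auto
    moreover have "\<Omega> \<subseteq> closure \<Omega>" by (rule closure_subset)
    ultimately show ?thesis
      unfolding C'_def by force
  qed
  ultimately have C': "closed C'" by (simp add: compact_imp_closed)
  have "closed (closure \<Omega> \<inter> f -` {z})"
    by (intro continuous_closed_preimage[OF f]) auto
  moreover have "closure \<Omega> \<inter> f -` {z} = C"
  proof -
    have "x \<in> \<Omega>" if "x \<in> closure \<Omega>" "f x = z" for x
      using clo[OF that(1)] fg[of x] gz that by auto
    moreover have "\<Omega> \<subseteq> closure \<Omega>" by (rule closure_subset)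
    ultimately show ?thesis
      unfolding C_def by auto
  qed
  ultimately have C: "closed C" by simp
  have sub: "C \<subseteq> \<Omega>" "C' \<subseteq> \<Omega>" by (auto simp: C_def C'_def)
  let ?O = "top_of_set \<Omega>"
  let ?HC = "relative_homology_group n ?O (\<Omega> - C)" and ?HC' = "relative_homology_group n ?O (\<Omega> - C')"
  let ?iC = "hom_induced n ?O (\<Omega> - C) euclidean (- C) id"
  let ?iC' = "hom_induced n ?O (\<Omega> - C') euclidean (- C') id"
  have exC: "?iC \<in> iso ?HC (relative_homology_group n euclidean (- C))"
    by (rule excision_iso[OF \<Omega>(1) C sub(1)])
  have exC': "?iC' \<in> iso ?HC' (relative_homology_group n euclidean (- C'))"
    by (rule excision_iso[OF \<Omega>(1) C' sub(2)])
  let ?Hz = "relative_homology_group n euclidean (- {z})"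
  have cf: "continuous_on \<Omega> f" and cg: "continuous_on \<Omega> g"
    using f g closure_subset continuous_on_subset by blast+
  have gnz: "g x \<noteq> z" if "x \<in> \<Omega>" for x using gz that closure_subset by blast
  have trivial: "hom_induced n ?O (\<Omega> - C) euclidean (- {z}) f w = \<one>\<^bsub>?Hz\<^esub>"
    if R: "\<Omega> \<subseteq> ball 0 R"
      and u: "u \<in> carrier (relative_homology_group n euclidean (- ball 0 R))"
      and w: "w \<in> carrier ?HC"
      and wu: "?iC w = hom_induced n euclidean (- ball 0 R) euclidean (- C) id u" for R u w
  proof -
    have "hom_induced n euclidean (- ball 0 R) euclidean (- C') id u \<in> carrier (relative_homology_group n euclidean (- C'))"
      by (rule hom_induced_carrier)
    then obtain w' where w': "w' \<in> carrier ?HC'"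
        "?iC' w' = hom_induced n euclidean (- ball 0 R) euclidean (- C') id u"
      by (rule iso_surjE[OF exC'])
    \<comment> \<open>Excision for \<open>C\<close> is injective, so it suffices to compare in the
      whole space: the class \<open>w'\<close> belonging to \<open>C'\<close> maps to
      \<open>w\<close>.\<close>
    let ?j = "hom_induced n ?O (\<Omega> - C') ?O (\<Omega> - C) id"
    have "?iC (?j w') = hom_induced n ?O (\<Omega> - C') euclidean (- C) (id \<circ> id) w'"
      by (rule hom_induced_compose') (use CC' in auto)
    also have "\<dots> = hom_induced n euclidean (- C') euclidean (- C) id (?iC' w')"
      by (rule hom_induced_compose'[symmetric]) (use CC' in auto)
    also have "\<dots> = hom_induced n euclidean (- ball 0 R) euclidean (- C) (id \<circ> id) u"
      unfolding w'(2) by (rule hom_induced_compose') (use CC' sub R in auto)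
    finally have "?iC (?j w') = ?iC w" using wu by simp
    then have jw: "?j w' = w"
    proof -
      have "inj_on ?iC (carrier ?HC)" using exC by (simp only: iso_iff)
      from inj_onD[OF this \<open>?iC (?j w') = ?iC w\<close> hom_induced_carrier w] show ?thesis .
    qed
    have "hom_induced n ?O (\<Omega> - C) euclidean (- {z}) f w
        = hom_induced n ?O (\<Omega> - C') euclidean (- {z}) (f \<circ> id) w'"
      unfolding jw[symmetric] by (rule hom_induced_compose') (use CC' cf in \<open>auto simp: C_def\<close>)
    also have "\<dots> = hom_induced n ?O (\<Omega> - C') euclidean (- {z}) g w'"
    proof -
      have "homotopic_with (\<lambda>h. h \<in> (\<Omega> - C') \<rightarrow> - {z}) ?O euclidean f g"
        unfolding homotopic_with_def
      proof (intro exI conjI ballI allI)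
        have "continuous_on ({0..1} \<times> \<Omega>) (\<lambda>(t, x). H t x)"
          by (rule continuous_on_subset[OF Hcont]) (use closure_subset in auto)
        then show "continuous_map (prod_topology (top_of_set {0..1}) ?O) euclidean (\<lambda>(t, x). H t x)"
          by (simp add: prod_topology_subtopology_eu)
      qed (auto simp: H_def C'_def)
      from homology_homotopy_axiom[OF this, of n] show ?thesis by simp
    qed
    \<comment> \<open>From here on \<open>g\<close> is read as a map into the complement of
      \<open>z\<close>, taken relative to itself.\<close>
    also have "\<dots> = hom_induced n ?O (\<Omega> - C') euclidean (- {z}) (id \<circ> g) w'" by simp
    also have "\<dots> = hom_induced n (top_of_set (- {z})) (- {z}) euclidean (- {z}) id
         (hom_induced n ?O (\<Omega> - C') (top_of_set (- {z})) (- {z}) g w')"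
      by (rule hom_induced_compose'[symmetric]) (use gnz cg in \<open>auto simp: image_subset_iff\<close>)
    also have "hom_induced n ?O (\<Omega> - C') (top_of_set (- {z})) (- {z}) g w'
       = \<one>\<^bsub>relative_homology_group n (top_of_set (- {z})) (- {z})\<^esub>"
      using trivial_relative_homology_group_topspace[of n "top_of_set (- {z})"]
        hom_induced_carrier[of n ?O "\<Omega> - C'" "top_of_set (- {z})" "- {z}" g w']
      by (simp add: trivial_group_def)
    also have "hom_induced n (top_of_set (- {z})) (- {z}) euclidean (- {z}) id
        \<one>\<^bsub>relative_homology_group n (top_of_set (- {z})) (- {z})\<^esub> = \<one>\<^bsub>?Hz\<^esub>"
      by (rule hom_one[OF hom_induced_hom]) auto
    finally show ?thesis .
  qed
  have gz: "group ?Hz" by simp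
  obtain R where R: "\<Omega> \<subseteq> ball 0 R" "z \<in> ball 0 R"
  proof -
    have "bounded (insert z \<Omega>)" using \<Omega>(2) by simp
    then obtain R where "insert z \<Omega> \<subseteq> ball 0 R" by (meson bounded_subset_ballD)
    then show ?thesis using that by auto
  qed
  from sphere_class_infinite_order[OF R(2)]
  obtain u where u: "u \<in> carrier (relative_homology_group n euclidean (- ball 0 R))"
    "\<And>k::int. hom_induced n euclidean (- ball 0 R) euclidean (- {z}) id u [^]\<^bsub>?Hz\<^esub> k = \<one>\<^bsub>?Hz\<^esub> \<Longrightarrow> k = 0"
    unfolding n_def by metis
  have "hom_induced n euclidean (- ball 0 R) euclidean (- C) id u \<in> carrier (relative_homology_group n euclidean (- C))"
    by (rule hom_induced_carrier)
  then obtain w where w: "w \<in> carrier ?HC" "?iC w = hom_induced n euclidean (- ball 0 R) euclidean (- C) id u"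
    by (rule iso_surjE[OF exC])
  show ?thesis
    unfolding brouwer_degree_def Let_def
    unfolding n_def[symmetric] C_def[symmetric]
  \<comment> \<open>Zero qualifies because both sides are then trivial. Uniqueness needs an actual
    triple \<open>R\<close>, \<open>u\<close>, \<open>w\<close> in which the image of
    \<open>u\<close> has infinite order.\<close>
  proof (rule the_equality)
    show "\<forall>R u w. \<Omega> \<subseteq> ball 0 R \<and> z \<in> ball 0 R \<and>
        u \<in> carrier (relative_homology_group n euclidean (- ball 0 R)) \<and> w \<in> carrier ?HC \<and>
        ?iC w = hom_induced n euclidean (- ball 0 R) euclidean (- C) id u \<longrightarrow>
        hom_induced n ?O (\<Omega> - C) euclidean (- {z}) f w =
        hom_induced n euclidean (- ball 0 R) euclidean (- {z}) id u [^]\<^bsub>?Hz\<^esub> (0::int)"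
    proof (intro allI impI, elim conjE)
      fix R u w
      assume "\<Omega> \<subseteq> ball 0 R" "u \<in> carrier (relative_homology_group n euclidean (- ball 0 R))" "w \<in> carrier ?HC"
        "?iC w = hom_induced n euclidean (- ball 0 R) euclidean (- C) id u"
      from trivial[OF this] show "hom_induced n ?O (\<Omega> - C) euclidean (- {z}) f w =
        hom_induced n euclidean (- ball 0 R) euclidean (- {z}) id u [^]\<^bsub>?Hz\<^esub> (0::int)"
        by (simp add: int_pow_def)
    qed
    fix d :: int
    assume "\<forall>R u w. \<Omega> \<subseteq> ball 0 R \<and> z \<in> ball 0 R \<and>
        u \<in> carrier (relative_homology_group n euclidean (- ball 0 R)) \<and> w \<in> carrier ?HC \<and>
        ?iC w = hom_induced n euclidean (- ball 0 R) euclidean (- C) id u \<longrightarrow>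
        hom_induced n ?O (\<Omega> - C) euclidean (- {z}) f w =
        hom_induced n euclidean (- ball 0 R) euclidean (- {z}) id u [^]\<^bsub>?Hz\<^esub> d"
    then have "hom_induced n ?O (\<Omega> - C) euclidean (- {z}) f w =
        hom_induced n euclidean (- ball 0 R) euclidean (- {z}) id u [^]\<^bsub>?Hz\<^esub> d"
      using R u(1) w by blast
    then show "d = 0" using u(2) trivial[OF R(1) u(1) w] by simp
  qed
qed

section \<open>The Finsler metric\<close>

text \<open>The squared positive part is of class C1; it supplies reparametrizations that come to
  rest at time 1/2. The remainder of the linear approximation is at most the squared
  increment.\<close>

lemma has_real_derivative_max_0_power2:
  "((\<lambda>u::real. (max 0 u)\<^sup>2) has_real_derivative 2 * max 0 x) (at x within S)"
  unfolding has_field_derivative_def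
proof (rule has_derivativeI_sandwich[where e = 1 and H = "\<lambda>y. \<bar>y - x\<bar>"])
  fix y assume "y \<noteq> x"
  have "\<bar>(max 0 y)\<^sup>2 - (max 0 x)\<^sup>2 - 2 * max 0 x * (y - x)\<bar> \<le> (y - x)\<^sup>2"
  proof -
    consider "x \<ge> 0" "y \<ge> 0" | "x \<ge> 0" "y < 0" | "x < 0" "y \<ge> 0" | "x < 0" "y < 0" by linarith
    then show ?thesis
    proof cases
      case 1
      then have "(max 0 y)\<^sup>2 - (max 0 x)\<^sup>2 - 2 * max 0 x * (y - x) = (y - x)\<^sup>2"
        by (simp add: power2_eq_square algebra_simps)
      then show ?thesis by simp
    next
      case 2
      then have "0 \<le> x * - y" by (intro mult_nonneg_nonneg) auto
      moreover have "(max 0 y)\<^sup>2 - (max 0 x)\<^sup>2 - 2 * max 0 x * (y - x) = x * x - 2 * (x * y)"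
        using 2 by (simp add: power2_eq_square algebra_simps)
      moreover have "(y - x)\<^sup>2 = y * y - 2 * (x * y) + x * x"
        by (simp add: power2_eq_square algebra_simps)
      moreover have "0 \<le> x * x" "0 \<le> y * y" by simp_all
      ultimately show ?thesis by linarith
    next
      case 3
      then have "0 \<le> - x * y" "0 \<le> x * x" by (intro mult_nonneg_nonneg) auto
      then show ?thesis using 3 by (simp add: power2_eq_square algebra_simps)
    qed simp
  qed
  then have "\<bar>(max 0 y)\<^sup>2 - (max 0 x)\<^sup>2 - 2 * max 0 x * (y - x)\<bar> / \<bar>y - x\<bar> \<le> (y - x)\<^sup>2 / \<bar>y - x\<bar>"
    by (rule divide_right_mono) simp
  also have "(y - x)\<^sup>2 / \<bar>y - x\<bar> = \<bar>y - x\<bar> * \<bar>y - x\<bar> / \<bar>y - x\<bar>"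
    by (simp only: power2_eq_square abs_mult_self_eq)
  also have "\<dots> = \<bar>y - x\<bar>" by (rule nonzero_mult_div_cancel_right) (use \<open>y \<noteq> x\<close> in simp)
  finally show "norm ((max 0 y)\<^sup>2 - (max 0 x)\<^sup>2 - 2 * max 0 x * (y - x)) / norm (y - x) \<le> \<bar>y - x\<bar>"
    by simp
qed (auto intro!: tendsto_eq_intros bounded_linear_mult_right)

locale finsler_manifold =
  fixes A :: "('m::t3_space, 'e::banach) chart set"
    and nrm :: "('m, 'e) chart \<Rightarrow> 'm \<Rightarrow> 'e \<Rightarrow> real"
  assumes atlas: "C1_atlas A" and finsler: "finsler_structure A nrm"
begin

section \<open>Charts and the norms on the tangent spaces\<close>

lemma chart_at: "chart_at A x \<in> A" "x \<in> fst (chart_at A x)"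
proof -
  have "x \<in> (\<Union>c\<in>A. fst c)" using atlas by (simp add: C1_atlas_def)
  then have "\<exists>c. c \<in> A \<and> x \<in> fst c" by blast
  from someI_ex[OF this] show "chart_at A x \<in> A" "x \<in> fst (chart_at A x)"
    by (simp_all add: chart_at_def)
qed

context
  fixes c assumes c: "c \<in> A"
begin

lemma chart_homeo: "homeomorphism (fst c) (snd c ` fst c) (snd c) (chart_inv c)"
  using atlas c by (simp add: C1_atlas_def)

lemma open_chart_dom: "open (fst c)" and open_chart_img: "open (snd c ` fst c)"
  using atlas c by (simp_all add: C1_atlas_def)

lemma chart_inv_chart [simp]: "x \<in> fst c \<Longrightarrow> chart_inv c (snd c x) = x"
  using chart_homeo by (simp add: homeomorphism_def)

lemma chart_chart_inv [simp]: "y \<in> snd c ` fst c \<Longrightarrow> snd c (chart_inv c y) = y"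
  using chart_homeo by (auto simp: homeomorphism_def)

lemma chart_inv_in_dom [simp]: "y \<in> snd c ` fst c \<Longrightarrow> chart_inv c y \<in> fst c"
  by auto

lemma continuous_on_chart: "continuous_on (fst c) (snd c)"
  and continuous_on_chart_inv: "continuous_on (snd c ` fst c) (chart_inv c)"
  using chart_homeo by (simp_all add: homeomorphism_def)

lemma open_chart_inv_image:
  assumes "open W" "W \<subseteq> snd c ` fst c"
  shows "open (chart_inv c ` W)"
proof -
  have "chart_inv c ` W = fst c \<inter> snd c -` W"
  proof
    show "chart_inv c ` W \<subseteq> fst c \<inter> snd c -` W" using assms(2) by force
    show "fst c \<inter> snd c -` W \<subseteq> chart_inv c ` W" by (force intro: image_eqI)
  qed
  then show ?thesis
    using continuous_open_preimage[OF continuous_on_chart open_chart_dom assms(1)] by simp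
qed

lemma
  assumes x: "x \<in> fst c"
  shows nrm_triangle: "nrm c x (v + w) \<le> nrm c x v + nrm c x w"
    and nrm_scaleR: "nrm c x (r *\<^sub>R v) = \<bar>r\<bar> * nrm c x v"
    and nrm_equiv: "\<exists>m>0. \<exists>M>0. \<forall>v. m * norm v \<le> nrm c x v \<and> nrm c x v \<le> M * norm v"
  using finsler c x unfolding finsler_structure_def by blast+

lemma nrm_zero [simp]: "x \<in> fst c \<Longrightarrow> nrm c x 0 = 0"
  using nrm_scaleR[of x 0 0] by simp

lemma nrm_nonneg [simp]: "x \<in> fst c \<Longrightarrow> 0 \<le> nrm c x v"
  using nrm_equiv[of x] by (meson dual_order.trans mult_nonneg_nonneg less_imp_le norm_ge_zero)

lemma nrm_local:
  assumes "x0 \<in> fst c" "k > 1"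
  obtains V where "open V" "x0 \<in> V" "V \<subseteq> fst c"
    "\<And>x v. x \<in> V \<Longrightarrow> nrm c x v \<le> k * nrm c x0 v"
    "\<And>x v. x \<in> V \<Longrightarrow> nrm c x0 v \<le> k * nrm c x v"
  using finsler c assms unfolding finsler_structure_def by meson

lemma nrm_transition:
  assumes "c' \<in> A" "x \<in> fst c" "x \<in> fst c'"
  shows "nrm c' x (frechet_derivative (snd c' \<circ> chart_inv c) (at (snd c x)) v) = nrm c x v"
  using finsler c assms unfolding finsler_structure_def by blast

lemma continuous_nrm_point:
  assumes x: "x \<in> fst c"
  shows "continuous_on UNIV (nrm c x)"
proof -
  obtain M where M: "M > 0" "\<And>v. nrm c x v \<le> M * norm v" using nrm_equiv[OF x] by blast
  have "dist (nrm c x v) (nrm c x w) \<le> M * dist v w" for v w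
    using nrm_triangle[OF x, of "v - w" w] nrm_triangle[OF x, of "w - v" v] M(2)[of "v - w"] M(2)[of "w - v"]
    by (simp add: dist_real_def dist_norm norm_minus_commute)
  then have "M-lipschitz_on UNIV (nrm c x)" using M(1) by (auto intro: lipschitz_onI)
  then show ?thesis by (rule lipschitz_on_continuous_on)
qed

text \<open>Joint continuity in point and vector: by Palais' condition, norms near \<open>x\<close>
  differ from the norm at \<open>x\<close> by a factor \<open>k\<close> as close to 1 as desired, so
  strict upper and lower bounds at \<open>x\<close> carry over to nearby points.\<close>

lemma tendsto_nrm:
  assumes x: "x \<in> fst c" and g: "(g \<longlongrightarrow> x) F" and D: "(D \<longlongrightarrow> v) F"
  shows "((\<lambda>t. nrm c (g t) (D t)) \<longlongrightarrow> nrm c x v) F"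
proof (rule order_tendstoI)
  have N: "((\<lambda>t. nrm c x (D t)) \<longlongrightarrow> nrm c x v) F"
    using continuous_nrm_point[OF x] D
    by (metis continuous_on_eq_continuous_at isCont_tendsto_compose open_UNIV UNIV_I)
  have k: "\<exists>k>1. P (k * r)" if "\<forall>\<^sub>F y in nhds r. P y" for r :: real and P
  proof -
    have "((\<lambda>k. k * r) \<longlongrightarrow> 1 * r) (at_right 1)" by (intro tendsto_intros)
    then have "\<forall>\<^sub>F k in at_right 1. P (k * r)" using that by (simp add: filterlim_iff)
    moreover have "\<forall>\<^sub>F k in at_right (1::real). k > 1" by (simp add: eventually_at_right_less)
    ultimately have "\<forall>\<^sub>F k in at_right 1. k > 1 \<and> P (k * r)" by eventually_elim simp
    then show ?thesis using eventually_happens' trivial_limit_at_right_real by blast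
  qed
  fix a assume a: "nrm c x v < a"
  have "\<exists>k>1. k * nrm c x v < a"
    by (rule k) (use a in \<open>simp add: eventually_nhds_in_open[of "{..<a}", simplified]\<close>)
  then obtain k where k1: "k > 1" "k * nrm c x v < a" by blast
  obtain V where V: "open V" "x \<in> V" "\<And>y v. y \<in> V \<Longrightarrow> nrm c y v \<le> k * nrm c x v"
    using nrm_local[OF x k1(1)] by metis
  have "((\<lambda>t. k * nrm c x (D t)) \<longlongrightarrow> k * nrm c x v) F" by (intro tendsto_intros N)
  then have "\<forall>\<^sub>F t in F. k * nrm c x (D t) < a" using k1(2) by (rule order_tendstoD)
  moreover have "\<forall>\<^sub>F t in F. g t \<in> V" using topological_tendstoD[OF g V(1,2)] .
  ultimately show "\<forall>\<^sub>F t in F. nrm c (g t) (D t) < a"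
    by eventually_elim (meson V(3) le_less_trans)
next
  have N: "((\<lambda>t. nrm c x (D t)) \<longlongrightarrow> nrm c x v) F"
    using continuous_nrm_point[OF x] D
    by (metis continuous_on_eq_continuous_at isCont_tendsto_compose open_UNIV UNIV_I)
  fix a assume a: "a < nrm c x v"
  obtain k where k1: "k > 1" "k * a < nrm c x v"
  proof (cases "a \<le> 0")
    case True
    then have "2 * a < nrm c x v" using a by linarith
    then show ?thesis by (intro that[of 2]) auto
  next
    case False
    then have "1 < nrm c x v / a" using a by (simp add: field_simps)
    then obtain k where "1 < k" "k < nrm c x v / a" using dense by blast
    then show ?thesis using False by (intro that[of k]) (auto simp: field_simps)
  qed
  obtain V where V: "open V" "x \<in> V" "\<And>y v. y \<in> V \<Longrightarrow> nrm c x v \<le> k * nrm c y v"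
    using nrm_local[OF x k1(1)] by metis
  have "\<forall>\<^sub>F t in F. k * a < nrm c x (D t)" using N k1(2) by (rule order_tendstoD)
  moreover have "\<forall>\<^sub>F t in F. g t \<in> V" using topological_tendstoD[OF g V(1,2)] .
  ultimately show "\<forall>\<^sub>F t in F. a < nrm c (g t) (D t)"
  proof eventually_elim
    case (elim t)
    then have "k * a < k * nrm c (g t) (D t)" using V(3)[of "g t" "D t"] by linarith
    then show ?case using k1 by simp
  qed
qed

end

section \<open>Changes of chart, speed and length of paths\<close>

lemma transition_C1:
  assumes "c \<in> A" "c' \<in> A"
  obtains T' where
    "\<And>x. x \<in> fst c \<Longrightarrow> x \<in> fst c' \<Longrightarrow>
       (snd c' \<circ> chart_inv c has_derivative blinfun_apply (T' (snd c x))) (at (snd c x))"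
    "continuous_on (snd c ` (fst c \<inter> fst c')) T'"
    "\<And>x. x \<in> fst c \<Longrightarrow> x \<in> fst c' \<Longrightarrow>
       frechet_derivative (snd c' \<circ> chart_inv c) (at (snd c x)) = blinfun_apply (T' (snd c x))"
proof -
  have "C1_on (snd c' \<circ> chart_inv c) (snd c ` (fst c \<inter> fst c'))"
    using atlas assms by (simp add: C1_atlas_def)
  then obtain T' where T': "\<And>y. y \<in> snd c ` (fst c \<inter> fst c') \<Longrightarrow>
      (snd c' \<circ> chart_inv c has_derivative blinfun_apply (T' y)) (at y)"
    "continuous_on (snd c ` (fst c \<inter> fst c')) T'"
    unfolding C1_on_def by blast
  show thesis
    by (rule that[of T']) (use T' frechet_derivative_at[OF T'(1)] in auto)
qed

lemma vector_derivative_change_chart: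
  fixes \<sigma> :: "real \<Rightarrow> 'm"
  assumes c: "c \<in> A" "c' \<in> A" and t: "t \<in> S" "\<sigma> t \<in> fst c" "\<sigma> t \<in> fst c'"
    and \<sigma>: "(\<sigma> \<longlongrightarrow> \<sigma> t) (at t within S)"
    and v: "(snd c \<circ> \<sigma> has_vector_derivative v) (at t within S)"
  shows "(snd c' \<circ> \<sigma> has_vector_derivative
     frechet_derivative (snd c' \<circ> chart_inv c) (at (snd c (\<sigma> t))) v) (at t within S)"
proof -
  obtain T' where T': "(snd c' \<circ> chart_inv c has_derivative blinfun_apply (T' (snd c (\<sigma> t)))) (at (snd c (\<sigma> t)))"
    "frechet_derivative (snd c' \<circ> chart_inv c) (at (snd c (\<sigma> t))) = blinfun_apply (T' (snd c (\<sigma> t)))"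
    using transition_C1[OF c] t by metis
  have "((snd c' \<circ> chart_inv c) \<circ> (snd c \<circ> \<sigma>) has_vector_derivative blinfun_apply (T' (snd c (\<sigma> t))) v) (at t within S)"
    by (rule vector_derivative_diff_chain_within[OF v has_derivative_at_withinI])
      (use T' in \<open>simp add: o_def\<close>)
  moreover have "\<forall>\<^sub>F s in at t within S. \<sigma> s \<in> fst c"
    by (rule topological_tendstoD[OF \<sigma> open_chart_dom[OF c(1)] t(2)])
  then have "\<forall>\<^sub>F s in at t within S. ((snd c' \<circ> chart_inv c) \<circ> (snd c \<circ> \<sigma>)) s = (snd c' \<circ> \<sigma>) s"
    by eventually_elim (use c in simp)
  ultimately show ?thesis
    unfolding has_vector_derivative_def T'(2)
    by (rule has_derivative_transform_eventually) (use c t in simp_all)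
qed

lemma C1_path_tendsto:
  assumes "C1_path A \<sigma>" "t \<in> {0..1}"
  shows "(\<sigma> \<longlongrightarrow> \<sigma> t) (at t within {0..1})"
  using assms by (simp add: C1_path_def continuous_on_def)

lemma C1_path_has_vd:
  assumes "C1_path A \<sigma>" "t \<in> {0..1}" "c \<in> A" "\<sigma> t \<in> fst c"
  shows "(snd c \<circ> \<sigma> has_vector_derivative vector_derivative (snd c \<circ> \<sigma>) (at t within {0..1})) (at t within {0..1})"
proof -
  obtain D where "(snd c \<circ> \<sigma> has_vector_derivative D t) (at t within {0..1})"
    using assms unfolding C1_path_def by blast
  then show ?thesis
    using vector_derivative_within_cbox[of 0 1 t "snd c \<circ> \<sigma>"] assms(2) by simp
qed

text \<open>The speed is defined by the chart that \<open>chart_at\<close> happens to select at each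
  point. The transition rule for the norms cancels the derivative of the change of chart, so any
  chart may be used to compute it.\<close>

lemma finsler_speed_chart:
  assumes \<sigma>: "C1_path A \<sigma>" and t: "t \<in> {0..1}" and c: "c \<in> A" "\<sigma> t \<in> fst c"
    and v: "(snd c \<circ> \<sigma> has_vector_derivative v) (at t within {0..1})"
  shows "finsler_speed A nrm \<sigma> t = nrm c (\<sigma> t) v"
proof -
  let ?c = "chart_at A (\<sigma> t)"
  have "(snd ?c \<circ> \<sigma> has_vector_derivative
     frechet_derivative (snd ?c \<circ> chart_inv c) (at (snd c (\<sigma> t))) v) (at t within {0..1})"
    by (rule vector_derivative_change_chart[OF c(1) chart_at(1) t c(2) chart_at(2) C1_path_tendsto[OF \<sigma> t] v])
  then have "vector_derivative (snd ?c \<circ> \<sigma>) (at t within {0..1}) =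
     frechet_derivative (snd ?c \<circ> chart_inv c) (at (snd c (\<sigma> t))) v"
    using vector_derivative_within_cbox[of 0 1 t "snd ?c \<circ> \<sigma>"] t by simp
  then show ?thesis
    unfolding finsler_speed_def Let_def
    using nrm_transition[OF c(1) chart_at(1) c(2) chart_at(2)] by simp
qed

text \<open>The selected chart may jump along the path. Near \<open>t\<close> the speed is therefore
  computed in the single chart at \<open>\<sigma> t\<close>, where \<open>tendsto_nrm\<close>
  applies.\<close>

lemma continuous_on_finsler_speed:
  assumes \<sigma>: "C1_path A \<sigma>"
  shows "continuous_on {0..1} (finsler_speed A nrm \<sigma>)"
  unfolding continuous_on_def
proof
  fix t :: real assume t: "t \<in> {0..1}"
  let ?c = "chart_at A (\<sigma> t)"
  obtain D where D: "continuous_on {t\<in>{0..1}. \<sigma> t \<in> fst ?c} D"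
     "\<And>t. t \<in> {0..1} \<Longrightarrow> \<sigma> t \<in> fst ?c \<Longrightarrow> (snd ?c \<circ> \<sigma> has_vector_derivative D t) (at t within {0..1})"
    using \<sigma> chart_at(1)[of "\<sigma> t"] unfolding C1_path_def by blast
  have ev: "\<forall>\<^sub>F s in at t within {0..1}. \<sigma> s \<in> fst ?c"
    by (rule topological_tendstoD[OF C1_path_tendsto[OF \<sigma> t] open_chart_dom[OF chart_at(1)] chart_at(2)])
  have in01: "\<forall>\<^sub>F s in at t within {0..1}. s \<in> {0..1}"
    by (simp add: eventually_at_filter)
  have "(D \<longlongrightarrow> D t) (at t within {t\<in>{0..1}. \<sigma> t \<in> fst ?c})"
    using D(1) t chart_at(2) by (simp add: continuous_on_def)
  moreover have "at t within {t\<in>{0..1}. \<sigma> t \<in> fst ?c} = at t within {0..1}"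
    using ev unfolding filter_eq_iff eventually_at_filter by (auto elim: eventually_elim2)
  ultimately have "(D \<longlongrightarrow> D t) (at t within {0..1})" by simp
  from tendsto_nrm[OF chart_at C1_path_tendsto[OF \<sigma> t] this]
  have "((\<lambda>s. nrm ?c (\<sigma> s) (D s)) \<longlongrightarrow> nrm ?c (\<sigma> t) (D t)) (at t within {0..1})" .
  moreover have "\<forall>\<^sub>F s in at t within {0..1}. nrm ?c (\<sigma> s) (D s) = finsler_speed A nrm \<sigma> s"
    using ev in01
    by eventually_elim (use finsler_speed_chart[OF \<sigma> _ chart_at(1) _ D(2)] in simp)
  moreover have "nrm ?c (\<sigma> t) (D t) = finsler_speed A nrm \<sigma> t"
    using finsler_speed_chart[OF \<sigma> t chart_at D(2)[OF t chart_at(2)]] by simp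
  ultimately show "(finsler_speed A nrm \<sigma> \<longlongrightarrow> finsler_speed A nrm \<sigma> t) (at t within {0..1})"
    using Lim_transform_eventually by metis
qed

lemma finsler_speed_nonneg: "0 \<le> finsler_speed A nrm \<sigma> t"
  unfolding finsler_speed_def Let_def by (simp add: chart_at)

lemma finsler_speed_integrable:
  assumes "C1_path A \<sigma>" "0 \<le> a" "b \<le> 1"
  shows "finsler_speed A nrm \<sigma> integrable_on {a..b}"
  using continuous_on_subset[OF continuous_on_finsler_speed[OF assms(1)], of "{a..b}"] assms(2,3)
  by (intro integrable_continuous_real) auto

lemma finsler_length_nonneg: "0 \<le> finsler_length A nrm \<sigma>"
\<comment> \<open>For an arbitrary map the speed need not be integrable; the integral then has the
  default value 0.\<close>
proof (cases "finsler_speed A nrm \<sigma> integrable_on {0..1}")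
  case True
  then show ?thesis unfolding finsler_length_def
    by (intro integral_nonneg finsler_speed_nonneg)
qed (simp add: finsler_length_def not_integrable_integral)

lemma finsler_dist_le_length:
  assumes "C1_path A \<sigma>" "\<sigma> 0 = x" "\<sigma> 1 = y" "finsler_length A nrm \<sigma> \<le> L"
  shows "finsler_dist A nrm x y \<le> ereal L"
  unfolding finsler_dist_def
  by (rule INF_lower2[of \<sigma>]) (use assms in auto)

lemma finsler_distE:
  assumes "finsler_dist A nrm x y < ereal r"
  obtains \<sigma> where "C1_path A \<sigma>" "\<sigma> 0 = x" "\<sigma> 1 = y" "finsler_length A nrm \<sigma> < r"
  using assms unfolding finsler_dist_def INF_less_iff by auto

lemma finsler_dist_nonneg: "0 \<le> finsler_dist A nrm x y"
  unfolding finsler_dist_def by (rule INF_greatest) (simp add: finsler_length_nonneg)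

text \<open>A straight segment in a chart is a path with constant coordinate velocity
  \<open>w\<close>, so a bound on the norm of \<open>w\<close> along it bounds its length. Explicit
  upper bounds for the distance are obtained in this way.\<close>

lemma chart_segment_dist:
  assumes c: "c \<in> A"
    and seg: "\<And>s. s \<in> {0..1} \<Longrightarrow> p + s *\<^sub>R w \<in> snd c ` fst c"
    and L: "\<And>s. s \<in> {0..1} \<Longrightarrow> nrm c (chart_inv c (p + s *\<^sub>R w)) w \<le> L"
  shows "finsler_dist A nrm (chart_inv c p) (chart_inv c (p + w)) \<le> ereal L"
proof -
  define \<sigma> where "\<sigma> = (\<lambda>s::real. chart_inv c (p + s *\<^sub>R w))"
  have \<sigma>c: "\<sigma> s \<in> fst c" "snd c (\<sigma> s) = p + s *\<^sub>R w" if "s \<in> {0..1}" for s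
    using seg[OF that] c unfolding \<sigma>_def by simp_all
  have cont: "continuous_on {0..1} \<sigma>"
    unfolding \<sigma>_def
    by (intro continuous_on_compose2[OF continuous_on_chart_inv[OF c]] continuous_intros) (use seg in blast)
  have vd: "(snd c \<circ> \<sigma> has_vector_derivative w) (at s within {0..1})" if "s \<in> {0..1}" for s
  proof (rule has_vector_derivative_transform[OF that])
    show "((\<lambda>s. p + s *\<^sub>R w) has_vector_derivative w) (at s within {0..1})"
      by (auto intro!: derivative_eq_intros)
  qed (use \<sigma>c in simp)
  have \<sigma>: "C1_path A \<sigma>"
    unfolding C1_path_def
  proof (intro conjI cont ballI)
    fix c' assume c': "c' \<in> A"
    obtain T' where T': "continuous_on (snd c ` (fst c \<inter> fst c')) T'"
       "\<And>x. x \<in> fst c \<Longrightarrow> x \<in> fst c' \<Longrightarrow>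
       frechet_derivative (snd c' \<circ> chart_inv c) (at (snd c x)) = blinfun_apply (T' (snd c x))"
      using transition_C1[OF c c'] by metis
    let ?S = "{t \<in> {0..1}. \<sigma> t \<in> fst c'}"
    show "\<exists>D. continuous_on ?S D \<and> (\<forall>t\<in>{0..1}. \<sigma> t \<in> fst c' \<longrightarrow>
           (snd c' \<circ> \<sigma> has_vector_derivative D t) (at t within {0..1}))"
    proof (intro exI conjI ballI impI)
      show "continuous_on ?S (\<lambda>t. blinfun_apply (T' (snd c (\<sigma> t))) w)"
        by (intro continuous_intros continuous_on_compose2[OF T'(1)]
              continuous_on_compose2[OF continuous_on_chart[OF c]] continuous_on_subset[OF cont])
          (use \<sigma>c(1) in auto)
      fix t :: real assume t: "t \<in> {0..1}" "\<sigma> t \<in> fst c'"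
      have "(\<sigma> \<longlongrightarrow> \<sigma> t) (at t within {0..1})" using cont t by (simp add: continuous_on_def)
      from vector_derivative_change_chart[OF c c' t(1) \<sigma>c(1)[OF t(1)] t(2) this vd[OF t(1)]]
      show "(snd c' \<circ> \<sigma> has_vector_derivative blinfun_apply (T' (snd c (\<sigma> t))) w) (at t within {0..1})"
        using T'(2)[OF \<sigma>c(1)[OF t(1)] t(2)] by simp
    qed
  qed
  have "finsler_length A nrm \<sigma> \<le> integral {0..1} (\<lambda>s::real. L)"
    unfolding finsler_length_def
  proof (rule integral_le[OF finsler_speed_integrable[OF \<sigma>]])
    fix s :: real assume s: "s \<in> {0..1}"
    show "finsler_speed A nrm \<sigma> s \<le> L"
      using finsler_speed_chart[OF \<sigma> s c \<sigma>c(1)[OF s] vd[OF s]] L[OF s] by (simp add: \<sigma>_def)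
  qed auto
  then show ?thesis
    by (intro finsler_dist_le_length[OF \<sigma>]) (auto simp: \<sigma>_def)
qed

section \<open>Reparametrization and concatenation, symmetry and triangle inequality\<close>

lemma C1_path_reparam:
  assumes \<sigma>: "C1_path A \<sigma>"
    and \<phi>: "\<And>t. t \<in> {0..1} \<Longrightarrow> (\<phi> has_real_derivative \<phi>' t) (at t within {0..1})"
    and \<phi>01: "\<And>t. t \<in> {0..1} \<Longrightarrow> \<phi> t \<in> {0..1}"
    and \<phi>'c: "continuous_on {0..1} \<phi>'"
  shows "C1_path A (\<sigma> \<circ> \<phi>)"
    and "t \<in> {0..1} \<Longrightarrow> finsler_speed A nrm (\<sigma> \<circ> \<phi>) t = \<bar>\<phi>' t\<bar> * finsler_speed A nrm \<sigma> (\<phi> t)"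
proof -
  have cphi: "continuous_on {0..1} \<phi>" using \<phi> by (rule DERIV_continuous_on)
  have vd: "(snd c \<circ> (\<sigma> \<circ> \<phi>) has_vector_derivative \<phi>' t *\<^sub>R v) (at t within {0..1})"
    if t: "t \<in> {0..1}" and v: "(snd c \<circ> \<sigma> has_vector_derivative v) (at (\<phi> t) within {0..1})" for c t v
  proof -
    have "((snd c \<circ> \<sigma>) \<circ> \<phi> has_vector_derivative \<phi>' t *\<^sub>R v) (at t within {0..1})"
    proof (rule vector_diff_chain_within)
      show "(\<phi> has_vector_derivative \<phi>' t) (at t within {0..1})"
        using \<phi>[OF t] by (simp add: has_real_derivative_iff_has_vector_derivative)
      show "(snd c \<circ> \<sigma> has_vector_derivative v) (at (\<phi> t) within \<phi> ` {0..1})"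
        by (rule has_vector_derivative_within_subset[OF v]) (use \<phi>01 in blast)
    qed
    then show ?thesis by (simp add: o_assoc)
  qed
  show C1: "C1_path A (\<sigma> \<circ> \<phi>)"
    unfolding C1_path_def
  proof (intro conjI ballI)
    show "continuous_on {0..1} (\<sigma> \<circ> \<phi>)"
      using \<sigma> \<phi>01 by (intro continuous_on_compose cphi) (auto simp: C1_path_def intro: continuous_on_subset)
    fix c assume "c \<in> A"
    then obtain D where D: "continuous_on {t \<in> {0..1}. \<sigma> t \<in> fst c} D"
      "\<And>t. t \<in> {0..1} \<Longrightarrow> \<sigma> t \<in> fst c \<Longrightarrow> (snd c \<circ> \<sigma> has_vector_derivative D t) (at t within {0..1})"
      using \<sigma> unfolding C1_path_def by blast
    show "\<exists>D. continuous_on {t \<in> {0..1}. (\<sigma> \<circ> \<phi>) t \<in> fst c} D \<and> (\<forall>t\<in>{0..1}. (\<sigma> \<circ> \<phi>) t \<in> fst c \<longrightarrow>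
         (snd c \<circ> (\<sigma> \<circ> \<phi>) has_vector_derivative D t) (at t within {0..1}))"
    proof (intro exI conjI ballI impI)
      show "continuous_on {t \<in> {0..1}. (\<sigma> \<circ> \<phi>) t \<in> fst c} (\<lambda>t. \<phi>' t *\<^sub>R D (\<phi> t))"
      proof (rule continuous_on_scaleR)
        show "continuous_on {t \<in> {0..1}. (\<sigma> \<circ> \<phi>) t \<in> fst c} \<phi>'"
          by (rule continuous_on_subset[OF \<phi>'c]) auto
        show "continuous_on {t \<in> {0..1}. (\<sigma> \<circ> \<phi>) t \<in> fst c} (\<lambda>t. D (\<phi> t))"
        proof (rule continuous_on_compose2[OF D(1)])
          show "continuous_on {t \<in> {0..1}. (\<sigma> \<circ> \<phi>) t \<in> fst c} \<phi>"
            by (rule continuous_on_subset[OF cphi]) blast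
          show "\<phi> ` {t \<in> {0..1}. (\<sigma> \<circ> \<phi>) t \<in> fst c} \<subseteq> {t \<in> {0..1}. \<sigma> t \<in> fst c}"
            unfolding o_def using \<phi>01 by blast
        qed
      qed
    next
      fix t :: real assume "t \<in> {0..1}" "(\<sigma> \<circ> \<phi>) t \<in> fst c"
      then show "(snd c \<circ> (\<sigma> \<circ> \<phi>) has_vector_derivative \<phi>' t *\<^sub>R D (\<phi> t)) (at t within {0..1})"
        using \<phi>01 by (intro vd D(2)) auto
    qed
  qed
  assume t: "t \<in> {0..1}"
  let ?c = "chart_at A (\<sigma> (\<phi> t))"
  let ?v = "vector_derivative (snd ?c \<circ> \<sigma>) (at (\<phi> t) within {0..1})"
  have v: "(snd ?c \<circ> \<sigma> has_vector_derivative ?v) (at (\<phi> t) within {0..1})"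
    by (rule C1_path_has_vd[OF \<sigma> \<phi>01[OF t] chart_at])
  show "finsler_speed A nrm (\<sigma> \<circ> \<phi>) t = \<bar>\<phi>' t\<bar> * finsler_speed A nrm \<sigma> (\<phi> t)"
    using finsler_speed_chart[OF C1 t chart_at(1) _ vd[OF t v]] finsler_speed_chart[OF \<sigma> \<phi>01[OF t] chart_at v]
    by (simp add: chart_at nrm_scaleR)
qed

lemma finsler_dist_sym: "finsler_dist A nrm x y = finsler_dist A nrm y x"
proof -
  have "finsler_dist A nrm y x \<le> finsler_dist A nrm x y" for x y
    unfolding finsler_dist_def[of A nrm x y]
  proof (rule INF_greatest)
    fix \<sigma> assume "\<sigma> \<in> {\<sigma>. C1_path A \<sigma> \<and> \<sigma> 0 = x \<and> \<sigma> 1 = y}"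
    then have \<sigma>: "C1_path A \<sigma>" "\<sigma> 0 = x" "\<sigma> 1 = y" by auto
    have d: "((\<lambda>t. 1 - t) has_real_derivative - 1) (at t within {0..1})" for t :: real
      by (auto intro!: derivative_eq_intros)
    have C1: "C1_path A (\<sigma> \<circ> (\<lambda>t. 1 - t))"
      and sp: "finsler_speed A nrm (\<sigma> \<circ> (\<lambda>t. 1 - t)) t = finsler_speed A nrm \<sigma> (1 - t)" if "t \<in> {0..1}" for t
      using C1_path_reparam[OF \<sigma>(1) d] that by auto
    \<comment> \<open>For a decreasing substitution the formula is a difference of two integrals;
      the first one is over \<open>{1..0}\<close>, which is empty, and the second one is the
      length.\<close>
    have sub: "((\<lambda>t. (- 1) *\<^sub>R finsler_speed A nrm \<sigma> (1 - t)) has_integral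
          (integral {1 - 0..1 - 1} (finsler_speed A nrm \<sigma>) - integral {1 - 1..1 - 0} (finsler_speed A nrm \<sigma>))) {0..1}"
      by (rule has_integral_substitution_general[where s = "{}" and c = 0 and d = 1])
        (use d continuous_on_finsler_speed[OF \<sigma>(1)] in \<open>auto intro!: continuous_intros\<close>)
    have "((\<lambda>t. finsler_speed A nrm \<sigma> (1 - t)) has_integral finsler_length A nrm \<sigma>) {0..1}"
      using has_integral_neg[OF sub] by (simp add: finsler_length_def)
    then have "finsler_length A nrm (\<sigma> \<circ> (\<lambda>t. 1 - t)) = finsler_length A nrm \<sigma>"
      unfolding finsler_length_def[of A nrm "\<sigma> \<circ> _"]
      by (intro integral_unique) (rule has_integral_eq[rotated], use sp in auto)
    then show "finsler_dist A nrm y x \<le> ereal (finsler_length A nrm \<sigma>)"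
      by (intro finsler_dist_le_length[OF C1[of 0]]) (use \<sigma> in auto)
  qed
  show ?thesis by (rule antisym; fact)
qed

lemma finsler_length_reparam:
  assumes \<sigma>: "C1_path A \<sigma>"
    and \<phi>: "\<And>t. t \<in> {0..1} \<Longrightarrow> (\<phi> has_real_derivative \<phi>' t) (at t within {0..1})"
    and \<phi>01: "\<And>t. t \<in> {0..1} \<Longrightarrow> \<phi> t \<in> {0..1}"
    and \<phi>'c: "continuous_on {0..1} \<phi>'" and \<phi>': "\<And>t. t \<in> {0..1} \<Longrightarrow> 0 \<le> \<phi>' t"
    and ends: "\<phi> 0 = 0" "\<phi> 1 = 1"
  shows "finsler_length A nrm (\<sigma> \<circ> \<phi>) = finsler_length A nrm \<sigma>"
proof -
  have "((\<lambda>t. \<phi>' t *\<^sub>R finsler_speed A nrm \<sigma> (\<phi> t)) has_integral integral {\<phi> 0..\<phi> 1} (finsler_speed A nrm \<sigma>)) {0..1}"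
    by (rule has_integral_substitution[where c = 0 and d = 1])
      (use ends \<phi> \<phi>01 continuous_on_finsler_speed[OF \<sigma>] in auto)
  then have "(finsler_speed A nrm (\<sigma> \<circ> \<phi>) has_integral integral {\<phi> 0..\<phi> 1} (finsler_speed A nrm \<sigma>)) {0..1}"
    by (rule has_integral_eq[rotated])
      (use C1_path_reparam(2)[OF \<sigma> \<phi> \<phi>01 \<phi>'c] \<phi>' in auto)
  then show ?thesis by (simp add: finsler_length_def ends integral_unique)
qed

text \<open>The endpoints of the rest interval are included: a derivative within
  \<open>{0..1}\<close> restricts to one within \<open>{a..b}\<close>, which is unique there. So two
  resting paths have matching derivatives at their junction.\<close>

lemma C1_path_constant_on_vd_0:
  assumes "a < b" "{a..b} \<subseteq> {0..1}" "t \<in> {a..b}"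
    and P: "\<And>t. t \<in> {a..b} \<Longrightarrow> P t = y"
    and v: "(snd c \<circ> P has_vector_derivative v) (at t within {0..1})"
  shows "v = 0"
proof -
  have "(snd c \<circ> P has_vector_derivative v) (at t within {a..b})"
    by (rule has_vector_derivative_within_subset[OF v assms(2)])
  moreover have "(snd c \<circ> P has_vector_derivative 0) (at t within {a..b})"
    by (rule has_vector_derivative_transform[OF assms(3), where f = "\<lambda>_. snd c y"]) (auto simp: P)
  ultimately show ?thesis
    using vector_derivative_within_cbox[of a b t "snd c \<circ> P"] assms(1,3) by auto
qed

text \<open>Both paths are defined on the whole unit interval, \<open>P\<close> resting in the
  second half and \<open>Q\<close> in the first. Hence the derivatives agree at 1/2, both being
  zero, and the speed of \<open>R\<close> is the pointwise sum of the two speeds, so that the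
  lengths add without a change of variables.\<close>

lemma C1_path_join:
  assumes P: "C1_path A P" and Q: "C1_path A Q"
    and Py: "\<And>t. t \<in> {1/2..1} \<Longrightarrow> P t = y" and Qy: "\<And>t. t \<in> {0..1/2} \<Longrightarrow> Q t = y"
  defines "R \<equiv> \<lambda>t. if t \<in> {0..1/2} then P t else Q t"
  shows "C1_path A R" "finsler_length A nrm R = finsler_length A nrm P + finsler_length A nrm Q"
proof -
  have vd: "(snd c \<circ> R has_vector_derivative (if t \<in> {0..1/2} then DP t else DQ t)) (at t within {0..1})"
    if t: "t \<in> {0..1}"
      and DP: "t \<le> 1/2 \<Longrightarrow> (snd c \<circ> P has_vector_derivative DP t) (at t within {0..1})"
      and DQ: "1/2 \<le> t \<Longrightarrow> (snd c \<circ> Q has_vector_derivative DQ t) (at t within {0..1})" for c t DP DQ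
  proof -
    have u: "{0..1} = {0..1/2} \<union> {1/2<..1::real}" by auto
    have cl: "closure {0..1/2::real} = {0..1/2}" "closure {1/2<..1::real} = {1/2..1}" by auto
    have "((\<lambda>t. if t \<in> {0..1/2} then (snd c \<circ> P) t else (snd c \<circ> Q) t) has_vector_derivative
        (if t \<in> {0..1/2} then DP t else DQ t)) (at t within {0..1})"
    proof (rule has_vector_derivative_If_within_closures[OF _ u], unfold cl)
      show "t \<in> {0..1 / 2} \<union> {1 / 2<..1}" using t by auto
      assume "t \<in> {0..1 / 2} \<union> {0..1 / 2} \<inter> {1 / 2..1}"
      then show "(snd c \<circ> P has_vector_derivative DP t) (at t within {0..1/2} \<union> {0..1/2} \<inter> {1/2..1})"
        by (intro has_vector_derivative_within_subset[OF DP]) auto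
    next
      assume "t \<in> {1 / 2<..1} \<union> {0..1 / 2} \<inter> {1 / 2..1}"
      then show "(snd c \<circ> Q has_vector_derivative DQ t) (at t within {1/2<..1} \<union> {0..1/2} \<inter> {1/2..1})"
        by (intro has_vector_derivative_within_subset[OF DQ]) auto
    next
      assume t2: "t \<in> {0..1 / 2}" "t \<in> {1 / 2..1}"
      then show "(snd c \<circ> P) t = (snd c \<circ> Q) t" by (simp add: Py Qy)
      have "DP t = 0" "DQ t = 0"
        using C1_path_constant_on_vd_0[OF _ _ t2(2) Py DP] C1_path_constant_on_vd_0[OF _ _ t2(1) Qy DQ] t2 by auto
      then show "DP t = DQ t" by simp
    qed
    moreover have "snd c \<circ> R = (\<lambda>t. if t \<in> {0..1/2} then (snd c \<circ> P) t else (snd c \<circ> Q) t)"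
      by (auto simp: R_def fun_eq_iff)
    ultimately show ?thesis by (simp only:)
  qed
  have cP: "continuous_on {0..1} P" and cQ: "continuous_on {0..1} Q"
    using P Q by (simp_all add: C1_path_def)
  have Req: "R t = (if t \<le> 1/2 then P t else Q t)" if "t \<in> {0..1}" for t
    using that by (simp add: R_def)
  show R: "C1_path A R"
    unfolding C1_path_def
  proof (intro conjI ballI)
    have "continuous_on {0..1} (\<lambda>t. if t \<le> 1/2 then P t else Q t)"
      by (rule continuous_on_cases_le)
        (auto intro: continuous_on_subset[OF cP] continuous_on_subset[OF cQ] continuous_on_id simp: Py Qy)
    then show "continuous_on {0..1} R" by (rule continuous_on_eq) (simp add: Req)
    fix c assume "c \<in> A"
    then obtain DP DQ where DP: "continuous_on {t \<in> {0..1}. P t \<in> fst c} DP"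
        "\<And>t. t \<in> {0..1} \<Longrightarrow> P t \<in> fst c \<Longrightarrow> (snd c \<circ> P has_vector_derivative DP t) (at t within {0..1})"
      and DQ: "continuous_on {t \<in> {0..1}. Q t \<in> fst c} DQ"
        "\<And>t. t \<in> {0..1} \<Longrightarrow> Q t \<in> fst c \<Longrightarrow> (snd c \<circ> Q has_vector_derivative DQ t) (at t within {0..1})"
      using P Q unfolding C1_path_def by meson
    let ?S = "{t \<in> {0..1}. R t \<in> fst c}"
    have S: "P t \<in> fst c" if "t \<in> ?S" "t \<le> 1/2" for t using that Req by auto
    have S': "Q t \<in> fst c" if "t \<in> ?S" "1/2 \<le> t" for t
      using that Req[of t] Py[of t] Qy[of t] by (auto split: if_splits)
    have D0: "DP t = DQ t" if "t \<in> ?S" "t = 1/2" for t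
    proof -
      have t: "t \<in> {0..1}" "t \<in> {1/2..1}" "t \<in> {0..1/2}" using that by auto
      have "P t \<in> fst c" by (rule S[OF that(1)]) (use that(2) in simp)
      moreover have "Q t \<in> fst c" by (rule S'[OF that(1)]) (use that(2) in simp)
      ultimately have "DP t = 0" "DQ t = 0"
        using C1_path_constant_on_vd_0[OF _ _ t(2) Py DP(2)[OF t(1)]]
          C1_path_constant_on_vd_0[OF _ _ t(3) Qy DQ(2)[OF t(1)]] by auto
      then show ?thesis by simp
    qed
    have "continuous_on ?S (\<lambda>t. if t \<le> 1/2 then DP t else DQ t)"
    proof (rule continuous_on_cases_le)
      show "continuous_on {t \<in> ?S. t \<le> 1/2} DP" by (rule continuous_on_subset[OF DP(1)]) (use S in auto)
      show "continuous_on {t \<in> ?S. 1/2 \<le> t} DQ" by (rule continuous_on_subset[OF DQ(1)]) (use S' in auto)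
      show "continuous_on ?S (\<lambda>t. t)" by (rule continuous_on_id)
      show "DP t = DQ t" if "t \<in> ?S" "t = 1/2" for t by (rule D0[OF that])
    qed
    then have "continuous_on ?S (\<lambda>t. if t \<in> {0..1/2} then DP t else DQ t)"
      by (rule continuous_on_eq) simp
    moreover have "(snd c \<circ> R has_vector_derivative (if t \<in> {0..1/2} then DP t else DQ t)) (at t within {0..1})"
      if "t \<in> {0..1}" "R t \<in> fst c" for t
      using that S[of t] S'[of t] DP(2)[of t] DQ(2)[of t] by (intro vd) auto
    ultimately show "\<exists>D. continuous_on ?S D \<and>
       (\<forall>t\<in>{0..1}. R t \<in> fst c \<longrightarrow> (snd c \<circ> R has_vector_derivative D t) (at t within {0..1}))"
      by blast
  qed
  have sp: "finsler_speed A nrm R t = finsler_speed A nrm P t + finsler_speed A nrm Q t" if t: "t \<in> {0..1}" for t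
  proof -
    let ?cP = "chart_at A (P t)" and ?cQ = "chart_at A (Q t)"
    let ?vP = "\<lambda>c t. vector_derivative (snd c \<circ> P) (at t within {0..1})"
    let ?vQ = "\<lambda>c t. vector_derivative (snd c \<circ> Q) (at t within {0..1})"
    have vP: "(snd ?cP \<circ> P has_vector_derivative ?vP ?cP t) (at t within {0..1})"
      and vQ: "(snd ?cQ \<circ> Q has_vector_derivative ?vQ ?cQ t) (at t within {0..1})"
      using C1_path_has_vd[OF P t chart_at] C1_path_has_vd[OF Q t chart_at] .
    have sP: "finsler_speed A nrm P t = nrm ?cP (P t) (?vP ?cP t)"
      and sQ: "finsler_speed A nrm Q t = nrm ?cQ (Q t) (?vQ ?cQ t)"
      using finsler_speed_chart[OF P t chart_at vP] finsler_speed_chart[OF Q t chart_at vQ] by auto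
    consider "t < 1/2" | "t = 1/2" | "t > 1/2" by linarith
    then show ?thesis
    proof cases
      case 1
      then have RP: "R t = P t" using Req[OF t] by simp
      have "(snd ?cP \<circ> R has_vector_derivative ?vP ?cP t) (at t within {0..1})"
        using vd[of t ?cP "?vP ?cP" "\<lambda>_. 0"] t vP 1 by simp
      then have "finsler_speed A nrm R t = nrm ?cP (P t) (?vP ?cP t)"
        using finsler_speed_chart[OF R t, of ?cP] by (simp add: RP chart_at)
      moreover have "?vQ ?cQ t = 0"
        using C1_path_constant_on_vd_0[where a = 0 and b = "1/2", OF _ _ _ Qy vQ] t 1 by simp
      ultimately show ?thesis using sP sQ by (simp add: chart_at)
    next
      case 2
      then have RP: "R t = P t" "P t = Q t" using Req[OF t] Py[of t] Qy[of t] by auto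
      have t2: "t \<in> {0..1/2}" using 2 t by simp
      have vQ': "(snd ?cP \<circ> Q has_vector_derivative ?vQ ?cQ t) (at t within {0..1})"
        using vQ by (simp only: RP(2))
      have "(snd ?cP \<circ> R has_vector_derivative (if t \<in> {0..1/2} then ?vP ?cP t else ?vQ ?cQ t)) (at t within {0..1})"
        by (rule vd[OF t]; rule vP vQ')
      then have "(snd ?cP \<circ> R has_vector_derivative ?vP ?cP t) (at t within {0..1})"
        unfolding if_P[OF t2] .
      then have "finsler_speed A nrm R t = nrm ?cP (P t) (?vP ?cP t)"
        using finsler_speed_chart[OF R t, of ?cP] by (simp add: RP(1) chart_at)
      moreover have "?vQ ?cQ t = 0"
        by (rule C1_path_constant_on_vd_0[where a = 0 and b = "1/2" and t = t, OF _ _ t2 Qy vQ]) auto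
      ultimately show ?thesis using sP sQ by (simp add: chart_at)
    next
      case 3
      then have RQ: "R t = Q t" using Req[OF t] by simp
      have "(snd ?cQ \<circ> R has_vector_derivative ?vQ ?cQ t) (at t within {0..1})"
        using vd[of t ?cQ "\<lambda>_. 0" "?vQ ?cQ"] t vQ 3 by simp
      then have "finsler_speed A nrm R t = nrm ?cQ (Q t) (?vQ ?cQ t)"
        using finsler_speed_chart[OF R t, of ?cQ] by (simp add: RQ chart_at)
      moreover have "?vP ?cP t = 0"
        using C1_path_constant_on_vd_0[where a = "1/2" and b = 1, OF _ _ _ Py vP] t 3 by simp
      ultimately show ?thesis using sP sQ by (simp add: chart_at)
    qed
  qed
  show "finsler_length A nrm R = finsler_length A nrm P + finsler_length A nrm Q"
    unfolding finsler_length_def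
    using Henstock_Kurzweil_Integration.integral_cong[of "{0..1}" "finsler_speed A nrm R", OF sp]
      Henstock_Kurzweil_Integration.integral_add[OF finsler_speed_integrable[OF P] finsler_speed_integrable[OF Q], of 0 1]
    by simp
qed

lemma finsler_dist_triangle:
  "finsler_dist A nrm x z \<le> finsler_dist A nrm x y + finsler_dist A nrm y z"
proof (rule ereal_le_epsilon)
    fix e :: ereal assume e: "0 < e"
    show "finsler_dist A nrm x z \<le> finsler_dist A nrm x y + finsler_dist A nrm y z + e"
    proof (cases "finsler_dist A nrm x y = \<infinity> \<or> finsler_dist A nrm y z = \<infinity> \<or> e = \<infinity>")
      case True
      then show ?thesis using finsler_dist_nonneg[of x y] finsler_dist_nonneg[of y z] e by auto
    next
      case False
      then obtain p q r where pqr: "finsler_dist A nrm x y = ereal p" "finsler_dist A nrm y z = ereal q" "e = ereal r"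
        using finsler_dist_nonneg[of x y] finsler_dist_nonneg[of y z] e
        by (cases "finsler_dist A nrm x y"; cases "finsler_dist A nrm y z"; cases e) auto
      have r: "r > 0" using e pqr by simp
      obtain \<sigma> where \<sigma>: "C1_path A \<sigma>" "\<sigma> 0 = x" "\<sigma> 1 = y" "finsler_length A nrm \<sigma> < p + r / 2"
        by (rule finsler_distE[of x y "p + r / 2"]) (use pqr r in auto)
      obtain \<rho> where \<rho>: "C1_path A \<rho>" "\<rho> 0 = y" "\<rho> 1 = z" "finsler_length A nrm \<rho> < q + r / 2"
        by (rule finsler_distE[of y z "q + r / 2"]) (use pqr r in auto)
      \<comment> \<open>Both paths are made to rest at the junction, so that their concatenation is of class \<open>C\<^sup>1\<close>.\<close>
      define \<phi> where "\<phi> = (\<lambda>t::real. 1 - (max 0 (1 - 2 * t))\<^sup>2)"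
      define \<phi>' where "\<phi>' = (\<lambda>t::real. 4 * max 0 (1 - 2 * t))"
      define \<psi> where "\<psi> = (\<lambda>t::real. (max 0 (2 * t - 1))\<^sup>2)"
      define \<psi>' where "\<psi>' = (\<lambda>t::real. 4 * max 0 (2 * t - 1))"
      have d1: "(\<phi> has_real_derivative \<phi>' t) (at t within {0..1})"
        and d2: "(\<psi> has_real_derivative \<psi>' t) (at t within {0..1})" for t
      proof -
        have "((\<lambda>t. 1 - 2 * t) has_real_derivative - 2) (at t within {0..1})"
          and "((\<lambda>t. 2 * t - 1) has_real_derivative 2) (at t within {0..1})"
          by (auto intro!: derivative_eq_intros)
        note g = this[THEN DERIV_chain2[OF has_real_derivative_max_0_power2]]
        show "(\<phi> has_real_derivative \<phi>' t) (at t within {0..1})"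
          using DERIV_diff[OF DERIV_const g(1), of 1] by (simp add: \<phi>_def \<phi>'_def mult.commute)
        show "(\<psi> has_real_derivative \<psi>' t) (at t within {0..1})"
          using g(2) by (simp add: \<psi>_def \<psi>'_def mult.commute)
      qed
      have r1: "\<phi> t \<in> {0..1}" and r2: "\<psi> t \<in> {0..1}" if "t \<in> {0..1}" for t
        using that by (auto simp: \<phi>_def \<psi>_def power_le_one_iff abs_le_iff)
      have c: "continuous_on {0..1} \<phi>'" "continuous_on {0..1} \<psi>'"
        unfolding \<phi>'_def \<psi>'_def by (intro continuous_intros)+
      have pos: "0 \<le> \<phi>' t" "0 \<le> \<psi>' t" for t by (simp_all add: \<phi>'_def \<psi>'_def)
      let ?P = "\<sigma> \<circ> \<phi>" and ?Q = "\<rho> \<circ> \<psi>"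
      have P: "C1_path A ?P" and Q: "C1_path A ?Q"
        using C1_path_reparam(1)[OF \<sigma>(1) d1 r1 c(1)] C1_path_reparam(1)[OF \<rho>(1) d2 r2 c(2)] by auto
      have Py: "?P t = y" if "t \<in> {1/2..1}" for t using that \<sigma> by (simp add: \<phi>_def)
      have Qy: "?Q t = y" if "t \<in> {0..1/2}" for t using that \<rho> by (simp add: \<psi>_def)
      have join: "C1_path A (\<lambda>t. if t \<in> {0..1/2} then ?P t else ?Q t)"
        "finsler_length A nrm (\<lambda>t. if t \<in> {0..1/2} then ?P t else ?Q t) =
           finsler_length A nrm ?P + finsler_length A nrm ?Q"
        by (rule C1_path_join[OF P Q Py Qy]; assumption)+
      have "finsler_length A nrm ?P = finsler_length A nrm \<sigma>"
        by (rule finsler_length_reparam[OF \<sigma>(1) d1 r1 c(1) pos(1)]) (auto simp: \<phi>_def)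
      moreover have "finsler_length A nrm ?Q = finsler_length A nrm \<rho>"
        by (rule finsler_length_reparam[OF \<rho>(1) d2 r2 c(2) pos(2)]) (auto simp: \<psi>_def)
      ultimately have len: "finsler_length A nrm (\<lambda>t. if t \<in> {0..1/2} then ?P t else ?Q t) \<le> p + q + r"
        unfolding join(2) using \<sigma>(4) \<rho>(4) by linarith
      have "finsler_dist A nrm x z \<le> ereal (p + q + r)"
        by (rule finsler_dist_le_length[OF join(1) _ _ len]) (use \<sigma> \<rho> in \<open>auto simp: \<phi>_def \<psi>_def\<close>)
      then show ?thesis by (simp add: pqr)
    qed
qed

section \<open>The distance and the topology of the manifold\<close>

lemma open_chart_image:
  assumes c: "c \<in> A" and V: "open V" "V \<subseteq> fst c"
  shows "open (snd c ` V)"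
proof -
  have "snd c ` V = snd c ` fst c \<inter> chart_inv c -` V"
    using V c by force
  then show ?thesis
    using continuous_open_preimage[OF continuous_on_chart_inv[OF c] open_chart_img[OF c] V(1)] by simp
qed

lemma chart_ball:
  assumes c: "c \<in> A" and V: "open V" "V \<subseteq> fst c" "x \<in> V"
  obtains \<delta> where "\<delta> > 0" "ball (snd c x) \<delta> \<subseteq> snd c ` V" "open (chart_inv c ` ball (snd c x) \<delta>)"
    "x \<in> chart_inv c ` ball (snd c x) \<delta>" "chart_inv c ` ball (snd c x) \<delta> \<subseteq> V"
proof -
  obtain \<delta> where \<delta>: "\<delta> > 0" "ball (snd c x) \<delta> \<subseteq> snd c ` V"
    using open_chart_image[OF c V(1,2)] V(3) by (meson image_eqI open_contains_ball)
  have "open (chart_inv c ` ball (snd c x) \<delta>)"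
    by (rule open_chart_inv_image[OF c open_ball]) (use \<delta> V(2) in blast)
  moreover have "x \<in> chart_inv c ` ball (snd c x) \<delta>"
    by (rule image_eqI[of _ _ "snd c x"]) (use c V \<delta> in auto)
  moreover have "chart_inv c y \<in> V" if yb: "y \<in> ball (snd c x) \<delta>" for y
  proof -
    obtain z where "z \<in> V" "y = snd c z" using \<delta>(2) yb by blast
    then show ?thesis using c V(2) by auto
  qed
  ultimately show thesis using that \<delta> by blast
qed

lemma finsler_dist_small_near:
  assumes "r > 0"
  obtains V where "open V" "x \<in> V" "\<And>y. y \<in> V \<Longrightarrow> finsler_dist A nrm x y < ereal r"
proof -
  define c where "c = chart_at A x"
  have c: "c \<in> A" "x \<in> fst c" by (simp_all add: c_def chart_at)
  obtain V where V: "open V" "x \<in> V" "V \<subseteq> fst c" "\<And>y v. y \<in> V \<Longrightarrow> nrm c y v \<le> 2 * nrm c x v"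
    using nrm_local[OF c, of 2] by (metis one_less_numeral_iff semiring_norm(76))
  obtain M where M: "M > 0" "\<And>v. nrm c x v \<le> M * norm v" using nrm_equiv[OF c] by blast
  define p where "p = snd c x"
  obtain \<delta>0 where \<delta>0: "\<delta>0 > 0" "ball p \<delta>0 \<subseteq> snd c ` V"
    using chart_ball[OF c(1) V(1,3,2)] unfolding p_def by metis
  \<comment> \<open>A segment of coordinate length below \<open>\<delta>\<close> has speed at most
    \<open>2 * M * \<delta>\<close>, the 2 coming from the comparison of norms on \<open>V\<close>;
    dividing by \<open>4 * M\<close> keeps this strictly below \<open>r\<close>.\<close>
  define \<delta> where "\<delta> = min \<delta>0 (r / (4 * M))"
  have \<delta>: "\<delta> > 0" "ball p \<delta> \<subseteq> snd c ` V" "2 * M * \<delta> < r"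
  proof -
    show "\<delta> > 0" using \<delta>0 assms M by (simp add: \<delta>_def)
    show "ball p \<delta> \<subseteq> snd c ` V" using \<delta>0 by (auto simp: \<delta>_def)
    have "2 * M * \<delta> \<le> 2 * M * (r / (4 * M))" using M by (intro mult_left_mono) (auto simp: \<delta>_def)
    also have "\<dots> < r" using M assms by simp
    finally show "2 * M * \<delta> < r" .
  qed
  have bV: "ball p \<delta> \<subseteq> snd c ` fst c" using \<delta>(2) V(3) by blast
  show thesis
  proof (rule that)
    show "open (chart_inv c ` ball p \<delta>)" by (rule open_chart_inv_image[OF c(1) open_ball bV])
    show "x \<in> chart_inv c ` ball p \<delta>"
      by (rule image_eqI[of _ _ p]) (use c \<delta> in \<open>auto simp: p_def\<close>)
    fix y assume "y \<in> chart_inv c ` ball p \<delta>"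
    then obtain q where q: "q \<in> ball p \<delta>" "y = chart_inv c q" by blast
    define w where "w = q - p"
    have w: "norm w < \<delta>" "q = p + w" using q(1) by (simp_all add: w_def dist_norm norm_minus_commute)
    have seg: "p + s *\<^sub>R w \<in> ball p \<delta>" if "s \<in> {0..1}" for s
    proof -
      have "s * norm w \<le> 1 * norm w" using that by (intro mult_right_mono) auto
      then show ?thesis using w that by (simp add: dist_norm)
    qed
    have "finsler_dist A nrm (chart_inv c p) (chart_inv c (p + w)) \<le> ereal (2 * M * \<delta>)"
    proof (rule chart_segment_dist[OF c(1)])
      fix s :: real assume s: "s \<in> {0..1}"
      show "p + s *\<^sub>R w \<in> snd c ` fst c" using seg[OF s] bV by blast
      obtain z where z: "z \<in> V" "p + s *\<^sub>R w = snd c z" using seg[OF s] \<delta>(2) by blast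
      have "nrm c z w \<le> 2 * nrm c x w" by (rule V(4)[OF z(1)])
      also have "\<dots> \<le> 2 * (M * norm w)" using M(2) by simp
      also have "\<dots> \<le> 2 * (M * \<delta>)" using w(1) M(1) by simp
      finally show "nrm c (chart_inv c (p + s *\<^sub>R w)) w \<le> 2 * M * \<delta>"
        using z c(1) V(3) by (auto simp: mult.assoc)
    qed
    then have "finsler_dist A nrm x y \<le> ereal (2 * M * \<delta>)"
      using c by (simp add: p_def q(2) w(2))
    also have "\<dots> < ereal r" using \<delta>(3) by simp
    finally show "finsler_dist A nrm x y < ereal r" .
  qed
qed

text \<open>Regularity enters here: without it a short path could leave the domain of the chart without
  its coordinates leaving a small ball.\<close>

lemma finsler_dist_controls_topology:
  assumes V: "open V" "x \<in> V"
  obtains r where "r > 0" "\<And>y. finsler_dist A nrm x y < ereal r \<Longrightarrow> y \<in> V"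
proof -
  define c where "c = chart_at A x"
  have c: "c \<in> A" "x \<in> fst c" by (simp_all add: c_def chart_at)
  obtain V1 where V1: "open V1" "x \<in> V1" "V1 \<subseteq> fst c" "\<And>y v. y \<in> V1 \<Longrightarrow> nrm c x v \<le> 2 * nrm c y v"
    using nrm_local[OF c, of 2] by (metis one_less_numeral_iff semiring_norm(76))
  obtain m where m: "m > 0" "\<And>v. m * norm v \<le> nrm c x v" using nrm_equiv[OF c] by blast
  define W where "W = V \<inter> V1"
  have W: "open W" "x \<in> W" "W \<subseteq> fst c" using V V1 by (auto simp: W_def)
  have "closed (- W)" "x \<notin> - W" using W by auto
  from t3_space[OF this] obtain S T where ST: "open S" "open T" "x \<in> S" "- W \<subseteq> T" "S \<inter> T = {}" by blast
  have "S \<subseteq> - T" "- T \<subseteq> W" using ST by auto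
  then have cS: "closure S \<subseteq> W" using ST(2) by (metis closed_Compl closure_minimal order_trans)
  have SW: "S \<subseteq> fst c" using cS closure_subset W(3) by blast
  obtain \<delta> where \<delta>: "\<delta> > 0" "ball (snd c x) \<delta> \<subseteq> snd c ` S" "open (chart_inv c ` ball (snd c x) \<delta>)"
    "x \<in> chart_inv c ` ball (snd c x) \<delta>" "chart_inv c ` ball (snd c x) \<delta> \<subseteq> S"
    using chart_ball[OF c(1) ST(1) SW ST(3)] by metis
  define G where "G = chart_inv c ` ball (snd c x) \<delta>"
  have G: "open G" "x \<in> G" "closure G \<subseteq> W" "G \<subseteq> V"
  proof -
    show "open G" "x \<in> G" using \<delta>(3,4) by (simp_all add: G_def)
    have "G \<subseteq> S" using \<delta>(5) by (simp add: G_def)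
    then show "closure G \<subseteq> W" using closure_mono[of G S] cS by blast
    then show "G \<subseteq> V" using closure_subset[of G] by (auto simp: W_def)
  qed
  \<comment> \<open>Up to its first exit from \<open>G\<close> a path covers a coordinate distance
    of at least \<open>\<delta>\<close>. On \<open>W\<close> the quantity \<open>m * norm v\<close>
    is at most twice the norm at the moving point, so the length is at least
    \<open>m * \<delta> / 2\<close>.\<close>
  have "y \<in> G" if y: "finsler_dist A nrm x y < ereal (m * \<delta> / 2)" for y
  proof (rule ccontr)
    assume "y \<notin> G"
    obtain \<sigma> where \<sigma>: "C1_path A \<sigma>" "\<sigma> 0 = x" "\<sigma> 1 = y" "finsler_length A nrm \<sigma> < m * \<delta> / 2"
      using finsler_distE[OF y] by metis
    have cont: "continuous_on {0..1} \<sigma>" using \<sigma>(1) by (simp add: C1_path_def)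
    define B where "B = {0..1} \<inter> \<sigma> -` (- G)"
    have "closed B" unfolding B_def
      by (rule continuous_closed_preimage[OF cont]) (use G in auto)
    moreover have "1 \<in> B" using \<sigma> \<open>y \<notin> G\<close> by (simp add: B_def)
    moreover have "bounded B" by (rule bounded_subset[of "{0..1}"]) (auto simp: B_def)
    ultimately obtain t0 where t0: "t0 \<in> B" "\<And>t. t \<in> B \<Longrightarrow> t0 \<le> t"
      using compact_attains_inf[of B] by (metis compact_eq_bounded_closed empty_iff)
    have t01: "t0 \<in> {0..1}" "\<sigma> t0 \<notin> G" using t0(1) by (auto simp: B_def)
    have "t0 \<noteq> 0" using t01 \<sigma>(2) G(2) by auto
    then have t0pos: "0 < t0" using t01 by simp
    have inG: "\<sigma> t \<in> G" if "0 \<le> t" "t < t0" for t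
      using t0(2)[of t] that t01 by (force simp: B_def)
    \<comment> \<open>As the closure of \<open>G\<close> lies in \<open>W\<close>, the exit point is
      still in the chart, and its coordinates are those of a point outside the ball.\<close>
    have "\<sigma> t0 \<in> closure G"
    proof -
      have "continuous_on (closure {0..<t0}) \<sigma>" using t0pos t01 by (intro continuous_on_subset[OF cont]) auto
      moreover have "\<sigma> ` {0..<t0} \<subseteq> closure G" using inG closure_subset[of G] by auto
      ultimately have "\<sigma> ` closure {0..<t0} \<subseteq> closure G"
        by (intro image_closure_subset) auto
      then show ?thesis using t0pos by auto
    qed
    then have inW: "\<sigma> t \<in> W" if "t \<in> {0..t0}" for t
      using that inG[of t] G(3) closure_subset[of G] by (cases "t = t0") auto
    have far: "\<delta> \<le> norm (snd c (\<sigma> t0) - snd c x)"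
    proof (rule ccontr)
      assume "\<not> ?thesis"
      then have "snd c (\<sigma> t0) \<in> ball (snd c x) \<delta>" by (simp add: dist_norm norm_minus_commute)
      then have "chart_inv c (snd c (\<sigma> t0)) \<in> G" unfolding G_def by blast
      then show False using t01 c(1) inW[of t0] W(3) t0pos by auto
    qed
    obtain D where D: "continuous_on {t\<in>{0..1}. \<sigma> t \<in> fst c} D"
      "\<And>t. t \<in> {0..1} \<Longrightarrow> \<sigma> t \<in> fst c \<Longrightarrow> (snd c \<circ> \<sigma> has_vector_derivative D t) (at t within {0..1})"
      using \<sigma>(1) c(1) unfolding C1_path_def by blast
    have sub: "{0..t0} \<subseteq> {t\<in>{0..1}. \<sigma> t \<in> fst c}" using inW W(3) t01 by auto
    have "(D has_integral ((snd c \<circ> \<sigma>) t0 - (snd c \<circ> \<sigma>) 0)) {0..t0}"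
    proof (rule fundamental_theorem_of_calculus)
      fix t assume t: "t \<in> {0..t0}"
      then show "(snd c \<circ> \<sigma> has_vector_derivative D t) (at t within {0..t0})"
        using sub t01 by (intro has_vector_derivative_within_subset[OF D(2)]) auto
    qed (use t0pos in simp)
    then have int: "integral {0..t0} D = snd c (\<sigma> t0) - snd c x"
      using \<sigma>(2) by (simp add: integral_unique)
    have "norm (integral {0..t0} D) \<le> integral {0..t0} (\<lambda>t. 2 / m * finsler_speed A nrm \<sigma> t)"
    proof (rule integral_norm_bound_integral)
      show "D integrable_on {0..t0}"
        by (rule integrable_continuous_real) (rule continuous_on_subset[OF D(1) sub])
      have "(\<lambda>t. 2 / m * finsler_speed A nrm \<sigma> t) integrable_on {0..t0}"
        using finsler_speed_integrable[OF \<sigma>(1), of 0 t0] t01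
        by (intro integrable_on_mult_right) auto
      then show "(\<lambda>t. 2 / m * finsler_speed A nrm \<sigma> t) integrable_on {0..t0}" .
      fix t assume t: "t \<in> {0..t0}"
      have t': "t \<in> {0..1}" "\<sigma> t \<in> fst c" using sub t by auto
      have "m * norm (D t) \<le> nrm c x (D t)" by (rule m(2))
      also have "\<dots> \<le> 2 * nrm c (\<sigma> t) (D t)" using inW[OF t] by (intro V1(4)) (simp add: W_def)
      also have "nrm c (\<sigma> t) (D t) = finsler_speed A nrm \<sigma> t"
        using finsler_speed_chart[OF \<sigma>(1) t'(1) c(1) t'(2) D(2)[OF t']] by simp
      finally show "norm (D t) \<le> 2 / m * finsler_speed A nrm \<sigma> t" using m(1) by (simp add: field_simps)
    qed
    also have "\<dots> = 2 / m * integral {0..t0} (finsler_speed A nrm \<sigma>)" by simp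
    also have "\<dots> \<le> 2 / m * finsler_length A nrm \<sigma>"
      unfolding finsler_length_def using m(1) t01
      by (intro mult_left_mono integral_subset_le finsler_speed_integrable[OF \<sigma>(1)])
        (auto simp: finsler_speed_nonneg)
    also have "\<dots> < 2 / m * (m * \<delta> / 2)" using m(1) \<sigma>(4) by (intro mult_strict_left_mono) auto
    also have "\<dots> = \<delta>" using m(1) by simp
    finally show False using far int by simp
  qed
  then show thesis using that[of "m * \<delta> / 2"] m(1) \<delta>(1) G(4) by auto
qed

text \<open>Truncation at 1 turns the infinite distances between components into real numbers and
  makes suprema over sets of points exist, while convergence and Cauchy sequences remain the
  same.\<close>

definition fdist :: "'m \<Rightarrow> 'm \<Rightarrow> real" where
  "fdist x y = real_of_ereal (min 1 (finsler_dist A nrm x y))"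

lemma ereal_fdist: "ereal (fdist x y) = min 1 (finsler_dist A nrm x y)"
  unfolding fdist_def
  by (intro ereal_real') (use finsler_dist_nonneg[of x y] in \<open>auto simp: min_def one_ereal_def\<close>)

lemma fdist_nonneg [simp]: "0 \<le> fdist x y"
  using finsler_dist_nonneg[of x y] by (simp add: ereal_fdist flip: ereal_less_eq(3) zero_ereal_def)

lemma fdist_le: "finsler_dist A nrm x y \<le> ereal L \<Longrightarrow> fdist x y \<le> L"
  by (simp add: ereal_fdist min.coboundedI2 flip: ereal_less_eq(3))

lemma fdist_le_1: "fdist x y \<le> 1"
  by (simp add: ereal_fdist one_ereal_def flip: ereal_less_eq(3))

lemma fdist_less_iff: "r \<le> 1 \<Longrightarrow> fdist x y < r \<longleftrightarrow> finsler_dist A nrm x y < ereal r"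
proof -
  assume "r \<le> 1"
  then have "\<not> 1 < ereal r" by (simp add: one_ereal_def)
  then show ?thesis
    using ereal_fdist[of x y] min_less_iff_disj[of 1 "finsler_dist A nrm x y" "ereal r"]
    by (metis less_ereal.simps(1))
qed

lemma fdist_sym: "fdist x y = fdist y x"
  unfolding fdist_def by (simp add: finsler_dist_sym[of x y])

lemma fdist_triangle: "fdist x z \<le> fdist x y + fdist y z"
proof -
  have "ereal (fdist x z) \<le> ereal (fdist x y) + ereal (fdist y z)"
    unfolding ereal_fdist
    using finsler_dist_triangle[of x z y] finsler_dist_nonneg[of x y] finsler_dist_nonneg[of y z]
    by (cases "finsler_dist A nrm x y"; cases "finsler_dist A nrm y z"; cases "finsler_dist A nrm x z")
      (auto simp: min_def one_ereal_def)
  then show ?thesis by simp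
qed

lemma fdist_self [simp]: "fdist x x = 0"
proof -
  have "fdist x x < r" if r: "r > 0" "r \<le> 1" for r
    using finsler_dist_small_near[OF r(1), of x] fdist_less_iff[OF r(2)] by metis
  then have "\<not> 0 < fdist x x" by (metis less_irrefl min.cobounded1 min.cobounded2 min_less_iff_conj zero_less_one not_less)
  then show ?thesis using fdist_nonneg[of x x] by linarith
qed

lemma fdist_small_near:
  assumes "r > 0"
  obtains V where "open V" "x \<in> V" "\<And>y. y \<in> V \<Longrightarrow> fdist x y < r"
proof -
  have "min r 1 > 0" using assms by simp
  from finsler_dist_small_near[OF this, of x] obtain V where
    "open V" "x \<in> V" "\<And>y. y \<in> V \<Longrightarrow> finsler_dist A nrm x y < ereal (min r 1)" by metis
  then show thesis using that[of V] fdist_less_iff[of "min r 1"] by auto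
qed

lemma fdist_controls_topology:
  assumes V: "open V" "x \<in> V"
  obtains r where "r > 0" "\<And>y. fdist x y < r \<Longrightarrow> y \<in> V"
proof -
  obtain r where r: "r > 0" "\<And>y. finsler_dist A nrm x y < ereal r \<Longrightarrow> y \<in> V"
    using finsler_dist_controls_topology[OF assms] by metis
  have "y \<in> V" if y: "fdist x y < min r 1" for y
  proof -
    have "finsler_dist A nrm x y < ereal (min r 1)" using y fdist_less_iff[of "min r 1" x y] by simp
    also have "\<dots> \<le> ereal r" by simp
    finally show ?thesis by (rule r(2))
  qed
  then show thesis using that[of "min r 1"] r(1) by auto
qed

lemma tendsto_iff_fdist: "(f \<longlongrightarrow> l) F \<longleftrightarrow> ((\<lambda>t. fdist l (f t)) \<longlongrightarrow> 0) F"
proof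
  assume f: "(f \<longlongrightarrow> l) F"
  show "((\<lambda>t. fdist l (f t)) \<longlongrightarrow> 0) F"
  proof (rule tendstoI)
    fix e :: real assume "e > 0"
    then obtain V where V: "open V" "l \<in> V" "\<And>y. y \<in> V \<Longrightarrow> fdist l y < e"
      using fdist_small_near by metis
    show "\<forall>\<^sub>F t in F. dist (fdist l (f t)) 0 < e"
      using topological_tendstoD[OF f V(1,2)] by eventually_elim (simp add: V(3))
  qed
next
  assume f: "((\<lambda>t. fdist l (f t)) \<longlongrightarrow> 0) F"
  show "(f \<longlongrightarrow> l) F"
  proof (rule topological_tendstoI)
    fix V assume "open V" "l \<in> V"
    then obtain r where r: "r > 0" "\<And>y. fdist l y < r \<Longrightarrow> y \<in> V" using fdist_controls_topology by metis
    show "\<forall>\<^sub>F t in F. f t \<in> V"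
      using order_tendstoD(2)[OF f r(1)] by eventually_elim (rule r(2))
  qed
qed

lemma tendsto_fdist:
  assumes f: "(f \<longlongrightarrow> a) F" and g: "(g \<longlongrightarrow> b) F"
  shows "((\<lambda>t. fdist (f t) (g t)) \<longlongrightarrow> fdist a b) F"
proof -
  have "((\<lambda>t. fdist a (f t) + fdist b (g t)) \<longlongrightarrow> 0 + 0) F"
    using f g by (intro tendsto_add) (simp_all flip: tendsto_iff_fdist)
  then have 0: "((\<lambda>t. fdist a (f t) + fdist b (g t)) \<longlongrightarrow> 0) F" by simp
  have "norm (fdist (f t) (g t) - fdist a b) \<le> fdist a (f t) + fdist b (g t)" for t
    using fdist_triangle[of "f t" "g t" a] fdist_triangle[of a "g t" b] fdist_triangle[of a b "f t"]
      fdist_triangle[of "f t" b "g t"] by (simp add: fdist_sym[of "f t" a] fdist_sym[of "g t" b])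
  then have "((\<lambda>t. fdist (f t) (g t) - fdist a b) \<longlongrightarrow> 0) F"
    by (intro Lim_null_comparison[OF _ 0]) simp
  then show ?thesis by (simp add: LIM_zero_iff)
qed

lemma continuous_on_fdist:
  assumes "continuous_on S f" "continuous_on S g"
  shows "continuous_on S (\<lambda>t. fdist (f t) (g t))"
  using assms by (auto simp: continuous_on_def intro: tendsto_fdist)

lemma fdist_eq_0_imp_eq: "fdist x y \<le> 0 \<Longrightarrow> x = y"
proof (rule ccontr)
  assume *: "fdist x y \<le> 0" "x \<noteq> y"
  have "open (- {y})" "x \<in> - {y}" using * by auto
  then obtain r where "r > 0" "\<And>z. fdist x z < r \<Longrightarrow> z \<in> - {y}" using fdist_controls_topology by metis
  then show False using * by (metis ComplD insertI1 le_less_trans)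
qed

text \<open>\<open>\<Psi>\<close> is only continuous and the manifold may fail to be locally
  compact, so compactness of \<open>Q\<close> has to do the work: points violating the bound
  accumulate at some \<open>x\<close>, where both \<open>\<Psi> (u k _)\<close> and
  \<open>\<Psi> (g _)\<close> tend to \<open>\<Psi> (g x)\<close>, forcing this to be
  \<open>z\<close>. The bound says that the segments from \<open>\<Psi> (u k x)\<close> to
  \<open>\<Psi> (g x)\<close> miss \<open>z\<close>.\<close>

lemma uniform_limit_compose:
  fixes u :: "nat \<Rightarrow> 'q::metric_space \<Rightarrow> 'm" and \<Psi> :: "'m \<Rightarrow> 'b::real_normed_vector"
  assumes Q: "compact Q" and \<Psi>: "continuous_on UNIV \<Psi>" and g: "continuous_on Q g"
    and unif: "\<And>e. e > 0 \<Longrightarrow> \<exists>k0. \<forall>k\<ge>k0. \<forall>x\<in>Q. fdist (u k x) (g x) < e"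
    and z: "\<And>x. x \<in> Q \<Longrightarrow> \<Psi> (g x) \<noteq> z"
  obtains k where "\<And>x. x \<in> Q \<Longrightarrow> norm (\<Psi> (u k x) - \<Psi> (g x)) < norm (\<Psi> (g x) - z)"
proof (rule ccontr)
  assume "\<not> thesis"
  then have "\<forall>k. \<exists>x. x \<in> Q \<and> norm (\<Psi> (g x) - z) \<le> norm (\<Psi> (u k x) - \<Psi> (g x))"
    using that by (meson not_le)
  then obtain q where q: "\<And>k. q k \<in> Q" "\<And>k. norm (\<Psi> (g (q k)) - z) \<le> norm (\<Psi> (u k (q k)) - \<Psi> (g (q k)))"
    by metis
  have "seq_compact Q" using Q by (simp add: compact_eq_seq_compact_metric)
  then have "\<exists>x\<in>Q. \<exists>r. strict_mono r \<and> (q \<circ> r) \<longlonglongrightarrow> x"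
    using q(1) unfolding seq_compact_def by blast
  then obtain x r where x: "x \<in> Q" "strict_mono r" "(q \<circ> r) \<longlonglongrightarrow> x" by blast
  have gq: "(\<lambda>k. g (q (r k))) \<longlonglongrightarrow> g x"
    using continuous_on_tendsto_compose[OF g x(3) x(1)] q(1) by (auto simp: o_def)
  have 0: "(\<lambda>k. fdist (u (r k) (q (r k))) (g (q (r k)))) \<longlonglongrightarrow> 0"
  proof (rule LIMSEQ_I)
    fix e :: real assume "e > 0"
    then obtain k0 where "\<And>k z. k \<ge> k0 \<Longrightarrow> z \<in> Q \<Longrightarrow> fdist (u k z) (g z) < e" using unif by metis
    then have "norm (fdist (u (r k) (q (r k))) (g (q (r k))) - 0) < e" if "k \<ge> k0" for k
      using seq_suble[OF x(2), of k] that q(1) by simp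
    then show "\<exists>k0. \<forall>k\<ge>k0. norm (fdist (u (r k) (q (r k))) (g (q (r k))) - 0) < e" by blast
  qed
  have "(\<lambda>k. fdist (g x) (g (q (r k))) + fdist (u (r k) (q (r k))) (g (q (r k)))) \<longlonglongrightarrow> 0 + 0"
    using gq by (intro tendsto_add 0) (simp add: tendsto_iff_fdist)
  then have s: "(\<lambda>k. fdist (g x) (g (q (r k))) + fdist (u (r k) (q (r k))) (g (q (r k)))) \<longlonglongrightarrow> 0" by simp
  have "(\<lambda>k. fdist (g x) (u (r k) (q (r k)))) \<longlonglongrightarrow> 0"
  proof (rule tendsto_sandwich[OF always_eventually always_eventually tendsto_const s])
    show "\<forall>k. fdist (g x) (u (r k) (q (r k))) \<le> fdist (g x) (g (q (r k))) + fdist (u (r k) (q (r k))) (g (q (r k)))"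
      using fdist_triangle fdist_sym by metis
  qed simp
  then have uq: "(\<lambda>k. u (r k) (q (r k))) \<longlonglongrightarrow> g x" by (simp add: tendsto_iff_fdist)
  have c: "isCont \<Psi> (g x)" using \<Psi> by (simp add: continuous_on_eq_continuous_at)
  have \<Psi>g: "(\<lambda>k. \<Psi> (g (q (r k)))) \<longlonglongrightarrow> \<Psi> (g x)" by (rule isCont_tendsto_compose[OF c gq])
  have \<Psi>u: "(\<lambda>k. \<Psi> (u (r k) (q (r k)))) \<longlonglongrightarrow> \<Psi> (g x)" by (rule isCont_tendsto_compose[OF c uq])
  have "norm (\<Psi> (g x) - z) \<le> norm (\<Psi> (g x) - \<Psi> (g x))"
    by (rule LIMSEQ_le[OF tendsto_norm[OF tendsto_diff[OF \<Psi>g tendsto_const]] tendsto_norm[OF tendsto_diff[OF \<Psi>u \<Psi>g]]])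
      (use q(2) in blast)
  then show False using z[OF x(1)] by simp
qed

end

section \<open>Deformations decreasing the functional\<close>

locale finsler_functional = finsler_manifold A nrm
  for A :: "('m::t3_space, 'e::banach) chart set"
    and nrm :: "('m, 'e) chart \<Rightarrow> 'm \<Rightarrow> 'e \<Rightarrow> real" +
  fixes F :: "'m \<Rightarrow> real"
  assumes functional: "C1_functional A F"
begin

section \<open>The differential of the functional and its norm\<close>

lemma functional_C1:
  assumes "c \<in> A"
  obtains F' where
    "\<And>y. y \<in> snd c ` fst c \<Longrightarrow> (F \<circ> chart_inv c has_derivative blinfun_apply (F' y)) (at y)"
    "continuous_on (snd c ` fst c) F'"
    "\<And>x. x \<in> fst c \<Longrightarrow> chart_differential c F x = blinfun_apply (F' (snd c x))"
proof -
  obtain F' where F': "\<And>y. y \<in> snd c ` fst c \<Longrightarrow> (F \<circ> chart_inv c has_derivative blinfun_apply (F' y)) (at y)"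
    "continuous_on (snd c ` fst c) F'"
    using functional assms unfolding C1_functional_def C1_on_def by blast
  show thesis
  proof (rule that[OF F'])
    show "chart_differential c F x = blinfun_apply (F' (snd c x))" if "x \<in> fst c" for x
      unfolding chart_differential_def using frechet_derivative_at[OF F'(1)] that by simp
  qed
qed

lemma continuous_on_functional: "continuous_on S F"
proof -
  have "(F \<longlongrightarrow> F x) (at x)" for x
  proof -
    let ?c = "chart_at A x"
    obtain F' where F': "\<And>y. y \<in> snd ?c ` fst ?c \<Longrightarrow> (F \<circ> chart_inv ?c has_derivative blinfun_apply (F' y)) (at y)"
      using functional_C1[OF chart_at(1)] by metis
    have "continuous_on (snd ?c ` fst ?c) (F \<circ> chart_inv ?c)"
      by (rule has_derivative_continuous_on) (rule has_derivative_at_withinI[OF F'])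
    then have "continuous_on (fst ?c) ((F \<circ> chart_inv ?c) \<circ> snd ?c)"
      by (rule continuous_on_compose[OF continuous_on_chart[OF chart_at(1)]])
    then have "continuous_on (fst ?c) F"
      by (rule continuous_on_eq) (simp add: chart_at)
    then show ?thesis
      using chart_at(2) open_chart_dom[OF chart_at(1)]
      by (auto simp: continuous_on_eq_continuous_at isCont_def)
  qed
  then show ?thesis by (auto simp: continuous_on_def intro: tendsto_within_subset)
qed

lemma chart_differential_transition:
  assumes c: "c \<in> A" "c' \<in> A" and x: "x \<in> fst c" "x \<in> fst c'"
  shows "chart_differential c' F x (frechet_derivative (snd c' \<circ> chart_inv c) (at (snd c x)) v)
    = chart_differential c F x v"
proof -
  obtain F1 where F1: "\<And>y. y \<in> snd c ` fst c \<Longrightarrow> (F \<circ> chart_inv c has_derivative blinfun_apply (F1 y)) (at y)"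
    "\<And>x. x \<in> fst c \<Longrightarrow> chart_differential c F x = blinfun_apply (F1 (snd c x))"
    using functional_C1[OF c(1)] by metis
  obtain F2 where F2: "\<And>y. y \<in> snd c' ` fst c' \<Longrightarrow> (F \<circ> chart_inv c' has_derivative blinfun_apply (F2 y)) (at y)"
    "\<And>x. x \<in> fst c' \<Longrightarrow> chart_differential c' F x = blinfun_apply (F2 (snd c' x))"
    using functional_C1[OF c(2)] by metis
  obtain T' where T': "(snd c' \<circ> chart_inv c has_derivative blinfun_apply (T' (snd c x))) (at (snd c x))"
    "frechet_derivative (snd c' \<circ> chart_inv c) (at (snd c x)) = blinfun_apply (T' (snd c x))"
    using transition_C1[OF c] x by metis
  have comp: "((F \<circ> chart_inv c') \<circ> (snd c' \<circ> chart_inv c) has_derivative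
     blinfun_apply (F2 (snd c' x)) \<circ> blinfun_apply (T' (snd c x))) (at (snd c x))"
    by (rule diff_chain_at[OF T'(1)]) (use F2(1)[of "snd c' x"] x c in \<open>simp add: o_def\<close>)
  have "(F \<circ> chart_inv c has_derivative
     blinfun_apply (F2 (snd c' x)) \<circ> blinfun_apply (T' (snd c x))) (at (snd c x))"
  proof (rule has_derivative_transform_within_open[OF comp])
    show "open (snd c ` (fst c \<inter> fst c'))"
      by (rule open_chart_image[OF c(1) open_Int[OF open_chart_dom[OF c(1)] open_chart_dom[OF c(2)]]]) simp
    show "((F \<circ> chart_inv c') \<circ> (snd c' \<circ> chart_inv c)) z = (F \<circ> chart_inv c) z"
      if "z \<in> snd c ` (fst c \<inter> fst c')" for z
      using that c by auto
    show "snd c x \<in> snd c ` (fst c \<inter> fst c')" using x by simp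
  qed
  moreover have "(F \<circ> chart_inv c has_derivative blinfun_apply (F1 (snd c x))) (at (snd c x))"
    by (rule F1(1)) (use x in simp)
  ultimately have "blinfun_apply (F1 (snd c x)) = blinfun_apply (F2 (snd c' x)) \<circ> blinfun_apply (T' (snd c x))"
    by (metis has_derivative_unique)
  then show ?thesis using F1(2) F2(2) T'(2) x by simp
qed

lemma bdd_above_chart_differential:
  assumes "c \<in> A" "x \<in> fst c"
  shows "bdd_above ((\<lambda>v. \<bar>chart_differential c F x v\<bar>) ` {v. nrm c x v \<le> 1})"
proof -
  obtain F' where F': "chart_differential c F x = blinfun_apply (F' (snd c x))"
    using functional_C1[OF assms(1)] assms(2) by metis
  obtain m where m: "m > 0" "\<And>v. m * norm v \<le> nrm c x v" using nrm_equiv[OF assms] by blast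
  show ?thesis
  proof (rule bdd_aboveI2[where M = "norm (F' (snd c x)) * (1 / m)"])
    fix v assume "v \<in> {v. nrm c x v \<le> 1}"
    then have "m * norm v \<le> 1" using m(2)[of v] by simp
    then have "norm v \<le> 1 / m" using m(1) by (simp add: field_simps)
    then have "norm (F' (snd c x)) * norm v \<le> norm (F' (snd c x)) * (1 / m)"
      by (intro mult_left_mono) auto
    then show "\<bar>chart_differential c F x v\<bar> \<le> norm (F' (snd c x)) * (1 / m)"
      using norm_blinfun[of "F' (snd c x)" v] by (simp add: F')
  qed
qed

lemma differential_norm_nonneg: "0 \<le> differential_norm A nrm F x"
  unfolding differential_norm_def Let_def
  by (rule order_trans[OF abs_ge_zero cSUP_upper[OF _ bdd_above_chart_differential[OF chart_at], where x = 0]])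
    (simp add: chart_at)

text \<open>\<open>differential_norm\<close> is computed in the chart selected by
  \<open>chart_at\<close>. Differential and norm transform by the same change of chart, so the
  estimate is available in every chart.\<close>

lemma chart_differential_le:
  assumes c: "c \<in> A" "x \<in> fst c"
  shows "\<bar>chart_differential c F x v\<bar> \<le> differential_norm A nrm F x * nrm c x v"
proof -
  let ?c = "chart_at A x"
  obtain F' where F': "chart_differential ?c F x = blinfun_apply (F' (snd ?c x))"
    using functional_C1[OF chart_at(1)] chart_at(2) by metis
  have le: "\<bar>chart_differential ?c F x u\<bar> \<le> differential_norm A nrm F x * nrm ?c x u" for u
  proof (cases "u = 0")
    case True
    then show ?thesis by (simp add: F' chart_at blinfun.zero_right)
  next
    case False
    obtain m where m: "m > 0" "\<And>v. m * norm v \<le> nrm ?c x v" using nrm_equiv[OF chart_at] by blast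
    have pos: "0 < nrm ?c x u" using m(1) m(2)[of u] False by (meson less_le_trans mult_pos_pos zero_less_norm_iff)
    let ?u = "(1 / nrm ?c x u) *\<^sub>R u"
    have "nrm ?c x ?u \<le> 1" using pos nrm_scaleR[OF chart_at, where r = "1 / nrm ?c x u" and v = u] by simp
    then have "\<bar>chart_differential ?c F x ?u\<bar> \<le> differential_norm A nrm F x"
      unfolding differential_norm_def Let_def
      by (intro cSUP_upper bdd_above_chart_differential chart_at) simp
    then show ?thesis using pos by (simp add: F' blinfun.scaleR_right abs_mult field_simps)
  qed
  have "\<bar>chart_differential c F x v\<bar>
     = \<bar>chart_differential ?c F x (frechet_derivative (snd ?c \<circ> chart_inv c) (at (snd c x)) v)\<bar>"
    using chart_differential_transition[OF c(1) chart_at(1) c(2) chart_at(2)] by simp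
  also have "\<dots> \<le> differential_norm A nrm F x * nrm ?c x (frechet_derivative (snd ?c \<circ> chart_inv c) (at (snd c x)) v)"
    by (rule le)
  also have "\<dots> = differential_norm A nrm F x * nrm c x v"
    using nrm_transition[OF c(1) chart_at(1) c(2) chart_at(2)] by simp
  finally show ?thesis .
qed

text \<open>The norms of the differentials at the points \<open>u k\<close> refer to charts varying
  with \<open>k\<close>. They are moved to the fixed chart at \<open>x\<close>, where the derivative
  is continuous and the norms of a fixed vector converge.\<close>

lemma critical_point_limit:
  assumes u: "u \<longlonglongrightarrow> x" and dn: "(\<lambda>k. differential_norm A nrm F (u k)) \<longlonglongrightarrow> 0"
  shows "critical_point A F x"
  unfolding critical_point_def
proof
  fix v
  let ?c = "chart_at A x"
  obtain F' where F': "continuous_on (snd ?c ` fst ?c) F'"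
    "\<And>x. x \<in> fst ?c \<Longrightarrow> chart_differential ?c F x = blinfun_apply (F' (snd ?c x))"
    using functional_C1[OF chart_at(1)] by metis
  have ev: "\<forall>\<^sub>F k in sequentially. u k \<in> fst ?c"
    by (rule topological_tendstoD[OF u open_chart_dom[OF chart_at(1)] chart_at(2)])
  have "continuous_on (fst ?c) (\<lambda>y. \<bar>blinfun_apply (F' (snd ?c y)) v\<bar>)"
    by (intro continuous_intros continuous_on_compose2[OF F'(1)] continuous_on_chart chart_at) auto
  then have "isCont (\<lambda>y. \<bar>blinfun_apply (F' (snd ?c y)) v\<bar>) x"
    using chart_at(2) open_chart_dom[OF chart_at(1)] by (auto simp: continuous_on_eq_continuous_at)
  then have "(\<lambda>k. \<bar>blinfun_apply (F' (snd ?c (u k))) v\<bar>) \<longlonglongrightarrow> \<bar>blinfun_apply (F' (snd ?c x)) v\<bar>"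
    by (rule isCont_tendsto_compose[OF _ u])
  moreover have "(\<lambda>k. differential_norm A nrm F (u k) * nrm ?c (u k) v) \<longlonglongrightarrow> 0 * nrm ?c x v"
    by (intro tendsto_mult dn tendsto_nrm[OF chart_at u] tendsto_const)
  moreover have "\<forall>\<^sub>F k in sequentially. \<bar>blinfun_apply (F' (snd ?c (u k))) v\<bar> \<le> differential_norm A nrm F (u k) * nrm ?c (u k) v"
    using ev by eventually_elim (metis F'(2) chart_differential_le chart_at(1))
  ultimately have "\<bar>blinfun_apply (F' (snd ?c x)) v\<bar> \<le> 0 * nrm ?c x v"
    by (intro tendsto_le[OF trivial_limit_sequentially])
  then show "chart_differential ?c F x v = 0" by (simp add: F'(2) chart_at)
qed

text \<open>This replaces a pseudo-gradient flow: all points near \<open>y\<close> are moved in one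
  chart with the same coordinate velocity \<open>w\<close>, which has norm below 1 and slope below
  \<open>- \<sigma>\<close> at \<open>y\<close>, hence norm at most 1 and slope below
  \<open>- \<sigma>\<close> nearby. Time then bounds distance. Starting points are allowed within
  \<open>2 * r\<close> although times stop at \<open>r\<close>, because a point may already have
  been moved before.\<close>

lemma local_deformation:
  assumes "0 \<le> \<sigma>" "\<sigma> < differential_norm A nrm F y"
  obtains r H where "r > 0" "continuous_on ({v. fdist y v < 2 * r} \<times> {0..r}) (\<lambda>(v, s). H v s)"
    "\<And>v. fdist y v < 2 * r \<Longrightarrow> H v 0 = v"
    "\<And>v s. fdist y v < 2 * r \<Longrightarrow> s \<in> {0..r} \<Longrightarrow> fdist v (H v s) \<le> s"
    "\<And>v s. fdist y v < 2 * r \<Longrightarrow> s \<in> {0..r} \<Longrightarrow> F (H v s) \<le> F v - \<sigma> * s"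
proof -
  define c where "c = chart_at A y"
  have c: "c \<in> A" "y \<in> fst c" by (simp_all add: c_def chart_at)
  obtain F' where F': "\<And>y. y \<in> snd c ` fst c \<Longrightarrow> (F \<circ> chart_inv c has_derivative blinfun_apply (F' y)) (at y)"
    "continuous_on (snd c ` fst c) F'"
    "\<And>x. x \<in> fst c \<Longrightarrow> chart_differential c F x = blinfun_apply (F' (snd c x))"
    using functional_C1[OF c(1)] by metis
  define p where "p = snd c y"
  obtain w where w: "nrm c y w < 1" "blinfun_apply (F' p) w < - \<sigma>"
  proof -
    have "\<exists>v. nrm c y v \<le> 1 \<and> \<sigma> < \<bar>chart_differential c F y v\<bar>"
    proof (rule ccontr)
      assume "\<not> ?thesis"
      then have "differential_norm A nrm F y \<le> \<sigma>"
        unfolding differential_norm_def Let_def c_def[symmetric]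
        by (intro cSUP_least) (use c nrm_zero[OF c] in \<open>auto intro!: exI[of _ 0] simp: not_less\<close>)
      then show False using assms by simp
    qed
    then obtain v where v: "nrm c y v \<le> 1" "\<sigma> < \<bar>blinfun_apply (F' p) v\<bar>"
      using F'(3)[OF c(2)] by (auto simp: p_def)
    \<comment> \<open>Shrinking \<open>v\<close> by some \<open>\<theta> < 1\<close> makes its norm
      strictly less than 1 while the slope \<open>\<theta> * a\<close> still exceeds
      \<open>\<sigma>\<close>. The strict inequality leaves room for the factor \<open>k\<close> by
      which norms vary near \<open>y\<close>.\<close>
    define a where "a = \<bar>blinfun_apply (F' p) v\<bar>"
    have a: "0 < a" "\<sigma> < a" using v assms by (auto simp: a_def)
    then obtain \<theta> where \<theta>: "\<sigma> / a < \<theta>" "\<theta> < 1" using dense[of "\<sigma> / a" 1] by auto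
    have \<theta>0: "0 < \<theta>" using \<theta>(1) a assms(1) by (meson divide_nonneg_pos le_less_trans)
    define w where "w = (- \<theta> * sgn (blinfun_apply (F' p) v)) *\<^sub>R v"
    have abs: "\<bar>- \<theta> * sgn (blinfun_apply (F' p) v)\<bar> = \<theta>" using \<theta>0 a by (auto simp: abs_mult a_def sgn_if)
    then have "nrm c y w = \<theta> * nrm c y v" 
      unfolding w_def by (simp only: nrm_scaleR[OF c] abs)
    also have "\<dots> \<le> \<theta> * 1" using v(1) \<theta>0 by (intro mult_left_mono) auto
    finally have "nrm c y w < 1" using \<theta>(2) by simp
    moreover have "blinfun_apply (F' p) w = - (\<theta> * a)"
      unfolding w_def a_def by (simp add: blinfun.scaleR_right blinfun.minus_right abs_sgn mult_ac)
    moreover have "\<sigma> < \<theta> * a" using \<theta>(1) a by (simp add: field_simps)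
    ultimately show thesis using that by simp
  qed
  obtain k where k: "k > 1" "k * nrm c y w \<le> 1"
  proof (cases "nrm c y w = 0")
    case True
    then show ?thesis using that[of 2] by simp
  next
    case False
    then have "0 < nrm c y w" using nrm_nonneg[OF c] by (metis less_eq_real_def)
    then show ?thesis using that[of "1 / nrm c y w"] w(1) by (simp add: field_simps)
  qed
  obtain V where V: "open V" "y \<in> V" "V \<subseteq> fst c" "\<And>x v. x \<in> V \<Longrightarrow> nrm c x v \<le> k * nrm c y v"
    using nrm_local[OF c k(1)] by metis
  have cF: "continuous_on (snd c ` fst c) (\<lambda>z. blinfun_apply (F' z) w)"
    by (rule bounded_bilinear.continuous_on[OF bounded_bilinear_blinfun_apply F'(2) continuous_on_const])
  define O' where "O' = snd c ` V \<inter> (snd c ` fst c \<inter> (\<lambda>z. blinfun_apply (F' z) w) -` {..<- \<sigma>})"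
  have "open O'" unfolding O'_def
    by (intro open_Int open_chart_image[OF c(1) V(1,3)] continuous_open_preimage[OF cF] open_chart_img[OF c(1)]
        open_lessThan)
  moreover have "p \<in> O'" using V c w by (auto simp: O'_def p_def)
  ultimately obtain \<delta> where \<delta>: "\<delta> > 0" "ball p \<delta> \<subseteq> O'" by (meson open_contains_ball)
  have bi: "ball p \<delta> \<subseteq> snd c ` fst c" using \<delta>(2) by (auto simp: O'_def)
  have bn: "nrm c (chart_inv c z) w \<le> 1" if zb: "z \<in> ball p \<delta>" for z
  proof -
    have "z \<in> snd c ` V" using zb \<delta>(2) by (auto simp: O'_def)
    then obtain x where "x \<in> V" "z = snd c x" by blast
    then show ?thesis using V(3) V(4)[of x w] k(2) c(1) by auto
  qed
  have bF: "blinfun_apply (F' z) w < - \<sigma>" if "z \<in> ball p \<delta>" for z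
    using that \<delta>(2) by (auto simp: O'_def)
  have sub: "ball p (\<delta> / 2) \<subseteq> ball p \<delta>" using \<delta>(1) by auto
  have "open (chart_inv c ` ball p (\<delta> / 2))"
    by (rule open_chart_inv_image[OF c(1) open_ball]) (use sub bi in blast)
  moreover have "y \<in> chart_inv c ` ball p (\<delta> / 2)"
    by (rule image_eqI[of _ _ p]) (use c \<delta>(1) in \<open>auto simp: p_def\<close>)
  ultimately obtain r1 where r1: "r1 > 0" "\<And>v. fdist y v < r1 \<Longrightarrow> v \<in> chart_inv c ` ball p (\<delta> / 2)"
    using fdist_controls_topology by metis
  \<comment> \<open>\<open>2 * r \<le> r1\<close> puts the starting points into the half ball, and a
    motion during time \<open>r\<close> is shorter than \<open>\<delta> / 2\<close>; so all segments
    stay in the ball. Adding 1 keeps the denominator positive and that bound strict.\<close>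
  define r where "r = min (r1 / 2) (\<delta> / (2 * (norm w + 1)))"
  have nw: "0 < norm w + 1" by (simp add: add_nonneg_pos)
  have r: "r > 0" using r1(1) \<delta>(1) nw by (simp add: r_def)
  have rw: "r * norm w < \<delta> / 2"
  proof -
    have "r * norm w < r * (norm w + 1)" using r by simp
    also have "\<dots> \<le> \<delta> / (2 * (norm w + 1)) * (norm w + 1)" using nw by (intro mult_right_mono) (auto simp: r_def)
    also have "\<dots> = \<delta> / 2" using nw by (simp add: field_simps)
    finally show ?thesis .
  qed
  have vq: "v = chart_inv c (snd c v) \<and> snd c v \<in> ball p (\<delta> / 2)" if v: "fdist y v < 2 * r" for v
  proof -
    have "2 * r \<le> r1" by (simp add: r_def)
    then have "v \<in> chart_inv c ` ball p (\<delta> / 2)" using v by (intro r1(2)) simp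
    then obtain q where "q \<in> ball p (\<delta> / 2)" "v = chart_inv c q" by blast
    moreover from this have "snd c v = q" using sub bi c(1) by (metis chart_chart_inv subsetD)
    ultimately show ?thesis by simp
  qed
  have mv: "snd c v + s *\<^sub>R w \<in> ball p \<delta>" if "fdist y v < 2 * r" "s \<in> {0..r}" for v s
  proof -
    have "s * norm w \<le> r * norm w" using that by (intro mult_right_mono) auto
    then have "norm (s *\<^sub>R w) < \<delta> / 2" using rw that(2) by simp
    moreover have "norm (p - snd c v) < \<delta> / 2" using vq[OF that(1)] by (simp add: dist_norm)
    ultimately have "norm ((p - snd c v) - s *\<^sub>R w) < \<delta>"
      using norm_triangle_ineq4[of "p - snd c v" "s *\<^sub>R w"] by linarith
    then show ?thesis by (simp add: dist_norm algebra_simps)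
  qed
  define H where "H = (\<lambda>v s. chart_inv c (snd c v + s *\<^sub>R w))"
  show thesis
  proof (rule that[OF r, of H])
    have dom: "v \<in> fst c" if "fdist y v < 2 * r" for v
      using vq[OF that] sub bi c(1) by (metis chart_inv_in_dom subsetD)
    have "continuous_on ({v. fdist y v < 2 * r} \<times> {0..r}) (\<lambda>z. snd c (fst z))"
      by (rule continuous_on_compose2[OF continuous_on_chart[OF c(1)]]) (auto intro: continuous_intros dom)
    then have "continuous_on ({v. fdist y v < 2 * r} \<times> {0..r}) (\<lambda>z. chart_inv c (snd c (fst z) + snd z *\<^sub>R w))"
      by (intro continuous_on_compose2[OF continuous_on_chart_inv[OF c(1)]] continuous_intros)
        (use mv bi in auto)
    then show "continuous_on ({v. fdist y v < 2 * r} \<times> {0..r}) (\<lambda>(v, s). H v s)"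
      by (simp add: H_def case_prod_unfold)
    fix v assume v: "fdist y v < 2 * r"
    show "H v 0 = v" using vq[OF v] by (simp add: H_def)
    fix s assume s: "s \<in> {0..r}"
    have s': "t * s \<in> {0..r}" if "t \<in> {0..1}" for t
      using s that mult_mono[of t 1 s r] by auto
    have "finsler_dist A nrm (chart_inv c (snd c v)) (chart_inv c (snd c v + s *\<^sub>R w)) \<le> ereal s"
    proof (rule chart_segment_dist[OF c(1)])
      fix t :: real assume t: "t \<in> {0..1}"
      have b: "snd c v + t *\<^sub>R s *\<^sub>R w \<in> ball p \<delta>" using mv[OF v s'[OF t]] by simp
      then show i: "snd c v + t *\<^sub>R s *\<^sub>R w \<in> snd c ` fst c" using bi by blast
      have "nrm c (chart_inv c (snd c v + t *\<^sub>R s *\<^sub>R w)) (s *\<^sub>R w)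
         = s * nrm c (chart_inv c (snd c v + t *\<^sub>R s *\<^sub>R w)) w"
        using nrm_scaleR[OF c(1) chart_inv_in_dom[OF c(1) i]] s by simp
      also have "\<dots> \<le> s * 1" using bn[OF b] s by (intro mult_left_mono) auto
      finally show "nrm c (chart_inv c (snd c v + t *\<^sub>R s *\<^sub>R w)) (s *\<^sub>R w) \<le> s" by simp
    qed
    then show "fdist v (H v s) \<le> s" using vq[OF v] by (intro fdist_le) (simp add: H_def)
    have "(F \<circ> chart_inv c) (snd c v + s *\<^sub>R w) + \<sigma> * s \<le> (F \<circ> chart_inv c) (snd c v + 0 *\<^sub>R w) + \<sigma> * 0"
    proof (rule DERIV_nonpos_imp_nonincreasing[where a = 0 and b = s
          and f = "\<lambda>t. (F \<circ> chart_inv c) (snd c v + t *\<^sub>R w) + \<sigma> * t"])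
      show "0 \<le> s" using s by simp
      fix t assume t: "0 \<le> t" "t \<le> s"
      then have b: "snd c v + t *\<^sub>R w \<in> ball p \<delta>" using s by (intro mv[OF v]) auto
      have "((\<lambda>t. snd c v + t *\<^sub>R w) has_vector_derivative w) (at t)"
        by (auto intro!: derivative_eq_intros)
      from vector_derivative_diff_chain_within[OF this has_derivative_at_withinI[OF F'(1)]]
      have "((\<lambda>t. (F \<circ> chart_inv c) (snd c v + t *\<^sub>R w)) has_real_derivative blinfun_apply (F' (snd c v + t *\<^sub>R w)) w) (at t)"
        using b bi by (auto simp: has_real_derivative_iff_has_vector_derivative o_def)
      then have "((\<lambda>t. (F \<circ> chart_inv c) (snd c v + t *\<^sub>R w) + \<sigma> * t) has_real_derivative
          blinfun_apply (F' (snd c v + t *\<^sub>R w)) w + \<sigma> * 1) (at t)"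
        by (intro DERIV_add DERIV_cmult DERIV_ident)
      moreover have "blinfun_apply (F' (snd c v + t *\<^sub>R w)) w + \<sigma> * 1 \<le> 0" using bF[OF b] by simp
      ultimately show "\<exists>D. ((\<lambda>t. (F \<circ> chart_inv c) (snd c v + t *\<^sub>R w) + \<sigma> * t) has_real_derivative D) (at t) \<and> D \<le> 0"
        by blast
    qed
    then show "F (H v s) \<le> F v - \<sigma> * s" using vq[OF v] by (simp add: H_def)
  qed
qed

text \<open>The motions are performed successively, the \<open>i\<close>-th one for time
  \<open>a i p\<close> starting from the point reached so far. If \<open>a i p > 0\<close>, then
  \<open>h p\<close> is within \<open>r i\<close> of \<open>y i\<close>, and the earlier motions
  have moved it by less than \<open>r i\<close>, so the current point is in the domain of
  \<open>H i\<close>. Distances and decreases then add up along the induction.\<close>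

lemma glued_deformation:
  fixes h :: "'p::topological_space \<Rightarrow> 'm" and a :: "'i \<Rightarrow> 'p \<Rightarrow> real"
  assumes "finite I" and h: "continuous_on P h"
    and H: "\<And>i. i \<in> I \<Longrightarrow> continuous_on ({v. fdist (y i) v < 2 * r i} \<times> {0..r i}) (\<lambda>(v, s). H i v s)"
      "\<And>i v. i \<in> I \<Longrightarrow> fdist (y i) v < 2 * r i \<Longrightarrow> H i v 0 = v"
      "\<And>i v s. i \<in> I \<Longrightarrow> fdist (y i) v < 2 * r i \<Longrightarrow> s \<in> {0..r i} \<Longrightarrow> fdist v (H i v s) \<le> s"
      "\<And>i v s. i \<in> I \<Longrightarrow> fdist (y i) v < 2 * r i \<Longrightarrow> s \<in> {0..r i} \<Longrightarrow> F (H i v s) \<le> F v - \<sigma> * s"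
    and a: "\<And>i. i \<in> I \<Longrightarrow> continuous_on P (a i)" "\<And>i p. i \<in> I \<Longrightarrow> p \<in> P \<Longrightarrow> 0 \<le> a i p"
      "\<And>i p. i \<in> I \<Longrightarrow> p \<in> P \<Longrightarrow> a i p > 0 \<Longrightarrow> fdist (y i) (h p) \<le> r i"
    and T: "\<And>i p. i \<in> I \<Longrightarrow> p \<in> P \<Longrightarrow> (\<Sum>j\<in>I. a j p) < r i"
  shows "\<exists>g. continuous_on P g \<and> (\<forall>p\<in>P. fdist (h p) (g p) \<le> (\<Sum>i\<in>I. a i p) \<and>
      F (g p) \<le> F (h p) - \<sigma> * (\<Sum>i\<in>I. a i p))"
  using assms(1) H a T
proof (induction I rule: finite_induct)
  case empty
  show ?case by (intro exI[of _ h]) (simp add: h)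
next
  case (insert i I)
  have IT: "(\<Sum>j\<in>I. a j p) < r k" if "k \<in> I" "p \<in> P" for k p
    using insert.prems(8)[of k p] insert.prems(6)[of i p] insert.hyps that by simp
  have "\<exists>g. continuous_on P g \<and> (\<forall>p\<in>P. fdist (h p) (g p) \<le> (\<Sum>i\<in>I. a i p) \<and>
      F (g p) \<le> F (h p) - \<sigma> * (\<Sum>i\<in>I. a i p))"
    by (rule insert.IH) (use insert.prems IT in auto)
  then obtain g where g: "continuous_on P g" "\<And>p. p \<in> P \<Longrightarrow> fdist (h p) (g p) \<le> (\<Sum>i\<in>I. a i p)"
    "\<And>p. p \<in> P \<Longrightarrow> F (g p) \<le> F (h p) - \<sigma> * (\<Sum>i\<in>I. a i p)" by blast
  have sums: "(\<Sum>j\<in>insert i I. a j p) = a i p + (\<Sum>j\<in>I. a j p)" for p using insert.hyps by simp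
  have a0: "0 \<le> a i p" and sI: "0 \<le> (\<Sum>j\<in>I. a j p)" and Ti: "a i p + (\<Sum>j\<in>I. a j p) < r i" if "p \<in> P" for p
    using insert.prems(6) insert.prems(8)[of i p] that by (auto simp: sums intro!: sum_nonneg)
  have near: "fdist (y i) (g p) < 2 * r i" if "p \<in> P" "fdist (y i) (h p) \<le> r i" for p
    using fdist_triangle[of "y i" "g p" "h p"] g(2)[OF that(1)] Ti[OF that(1)] a0[OF that(1)] that(2) by linarith
  have air: "a i p \<in> {0..r i}" if "p \<in> P" for p using a0[OF that] Ti[OF that] sI[OF that] by simp
  define G where "G p = (if fdist (y i) (g p) < 2 * r i then H i (g p) (a i p) else g p)" for p
  \<comment> \<open>On the relatively open set \<open>?O1\<close> the motion \<open>H i\<close> is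
    defined; on \<open>?O2\<close> the time \<open>a i p\<close> is 0, so \<open>G\<close> coincides
    with \<open>g\<close>. Both cover \<open>P\<close>, which gives continuity of
    \<open>G\<close>.\<close>
  let ?O1 = "{p \<in> P. fdist (y i) (g p) < 2 * r i}" and ?O2 = "{p \<in> P. r i < fdist (y i) (h p)}"
  have P: "P = ?O1 \<union> ?O2" using near by force
  have o1: "openin (top_of_set P) ?O1"
    using continuous_openin_preimage_gen[OF continuous_on_fdist[OF continuous_on_const g(1)] open_lessThan, of "y i" "2 * r i"]
    by (auto simp: vimage_def Int_def)
  have o2: "openin (top_of_set P) ?O2"
    using continuous_openin_preimage_gen[OF continuous_on_fdist[OF continuous_on_const h] open_greaterThan, of "y i" "r i"]
    by (auto simp: vimage_def Int_def)
  have c1: "continuous_on ?O1 G"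
  proof -
    have "continuous_on ?O1 (\<lambda>p. (\<lambda>(v, s). H i v s) (g p, a i p))"
    proof (rule continuous_on_compose2[OF insert.prems(1)])
      show "continuous_on ?O1 (\<lambda>p. (g p, a i p))"
        by (intro continuous_on_Pair continuous_on_subset[OF g(1)] continuous_on_subset[OF insert.prems(5)]) auto
      show "(\<lambda>p. (g p, a i p)) ` ?O1 \<subseteq> {v. fdist (y i) v < 2 * r i} \<times> {0..r i}"
        using air by (auto simp del: atLeastAtMost_iff)
    qed simp
    then show ?thesis by (rule continuous_on_eq) (simp add: G_def)
  qed
  have c2: "continuous_on ?O2 G"
  proof -
    have "continuous_on ?O2 g" by (rule continuous_on_subset[OF g(1)]) auto
    moreover have "g p = G p" if "p \<in> ?O2" for p
    proof -
      have p: "p \<in> P" "r i < fdist (y i) (h p)" using that by auto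
      have "a i p = 0" using insert.prems(7)[of i p] a0[OF p(1)] p by force
      then show ?thesis using insert.prems(2)[of i "g p"] by (simp add: G_def)
    qed
    ultimately show ?thesis by (rule continuous_on_eq)
  qed
  have "continuous_on (?O1 \<union> ?O2) G"
    by (rule continuous_on_Un_local_open) (use o1 o2 c1 c2 P in auto)
  then have "continuous_on P G" using P by simp
  moreover have "fdist (h p) (G p) \<le> a i p + (\<Sum>j\<in>I. a j p) \<and> F (G p) \<le> F (h p) - \<sigma> * (a i p + (\<Sum>j\<in>I. a j p))"
    if p: "p \<in> P" for p
  proof (cases "fdist (y i) (g p) < 2 * r i")
    case True
    have "fdist (g p) (G p) \<le> a i p" "F (G p) \<le> F (g p) - \<sigma> * a i p"
      using insert.prems(3)[of i "g p" "a i p"] insert.prems(4)[of i "g p" "a i p"] True air[OF p] by (auto simp: G_def)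
    then show ?thesis
      using fdist_triangle[of "h p" "G p" "g p"] g(2,3)[OF p] by (simp add: distrib_left)
  next
    case False
    then have "a i p = 0" using near[OF p] insert.prems(7)[of i p] a0[OF p] p by force
    then show ?thesis using g(2,3)[OF p] False by (simp add: G_def)
  qed
  ultimately show ?case unfolding sums by blast
qed

text \<open>Finitely many local motions cover the compact set of maximum points. Where their
  normalized weights add up to more than 1/2, \<open>F\<close> drops by at least
  \<open>\<sigma> * t / 2\<close>; elsewhere \<open>F \<circ> h\<close> is already below
  \<open>b\<close> by a fixed amount, and \<open>t\<close> is chosen so small that this is enough.
  Multiplying the times by a parameter in \<open>{0..1}\<close> yields a homotopy starting at
  \<open>h\<close>.\<close>

lemma deformation_below_maximum:
  fixes h :: "'q::t2_space \<Rightarrow> 'm"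
  assumes Q: "compact Q" and h: "continuous_on Q h"
    and b: "\<And>x. x \<in> Q \<Longrightarrow> F (h x) \<le> b" "\<exists>x\<in>Q. F (h x) = b" and m: "m < b" and \<sigma>: "0 < \<sigma>"
    and slope: "\<And>x. x \<in> Q \<Longrightarrow> F (h x) = b \<Longrightarrow> \<sigma> < differential_norm A nrm F (h x)"
  obtains t G where "t > 0" "continuous_on ({0..1} \<times> Q) G" "\<And>x. x \<in> Q \<Longrightarrow> G (0::real, x) = h x"
    "\<And>s x. s \<in> {0..1} \<Longrightarrow> x \<in> Q \<Longrightarrow> F (G (s, x)) \<le> F (h x)"
    "\<And>s x. s \<in> {0..1} \<Longrightarrow> x \<in> Q \<Longrightarrow> F (h x) \<le> m \<Longrightarrow> G (s, x) = h x"
    "\<And>x. x \<in> Q \<Longrightarrow> fdist (h x) (G (1, x)) \<le> t" "\<And>x. x \<in> Q \<Longrightarrow> F (G (1, x)) \<le> b - \<sigma> * t / 2"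
proof -
  have Fh: "continuous_on Q (\<lambda>x. F (h x))"
    by (rule continuous_on_compose2[OF continuous_on_functional[of UNIV] h]) simp
  define B where "B = Q \<inter> (\<lambda>x. F (h x)) -` {b}"
  have clQ: "closed Q" using Q by (rule compact_imp_closed)
  have "closed B" unfolding B_def by (rule continuous_closed_preimage[OF Fh clQ closed_singleton])
  then have B: "compact B" using compact_Int_closed[OF Q, of B] by (simp add: B_def Int_absorb1)
  have Bne: "B \<noteq> {}" using b(2) by (auto simp: B_def)
  define LD where "LD y r H \<longleftrightarrow> r > 0 \<and> continuous_on ({v. fdist y v < 2 * r} \<times> {0..r}) (\<lambda>(v, s). H v s) \<and>
    (\<forall>v. fdist y v < 2 * r \<longrightarrow> H v 0 = v) \<and>
    (\<forall>v s. fdist y v < 2 * r \<longrightarrow> s \<in> {0..r} \<longrightarrow> fdist v (H v s) \<le> s) \<and>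
    (\<forall>v s. fdist y v < 2 * r \<longrightarrow> s \<in> {0..r} \<longrightarrow> F (H v s) \<le> F v - \<sigma> * s)" for y r H
  have "\<exists>z. LD (h x) (fst z) (snd z)" if "x \<in> B" for x
  proof -
    have "\<sigma> < differential_norm A nrm F (h x)" using slope that by (simp add: B_def)
    from local_deformation[OF less_imp_le[OF \<sigma>] this] obtain r H where "LD (h x) r H"
      unfolding LD_def by metis
    then show ?thesis by (intro exI[of _ "(r, H)"]) simp
  qed
  then obtain z where "\<And>x. x \<in> B \<Longrightarrow> LD (h x) (fst (z x)) (snd (z x))" by metis
  then obtain r H where LD: "\<And>x. x \<in> B \<Longrightarrow> LD (h x) (r x) (H x)"
    by (metis comp_apply)
  have rpos: "r x > 0" if "x \<in> B" for x using LD[OF that] by (simp add: LD_def)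
  have fc: "continuous_on Q (\<lambda>x'. fdist (h x) (h x'))" for x
    by (intro continuous_on_fdist continuous_on_const h)
  have "\<exists>W. open W \<and> W \<inter> Q = (\<lambda>x'. fdist (h x) (h x')) -` {..<r x} \<inter> Q" for x
    using fc[of x] unfolding continuous_on_open_invariant by (metis open_lessThan)
  then obtain W where W: "\<And>x. open (W x)" "\<And>x. W x \<inter> Q = (\<lambda>x'. fdist (h x) (h x')) -` {..<r x} \<inter> Q"
    by metis
  have "B \<subseteq> (\<Union>x\<in>B. W x)"
  proof
    fix x assume x: "x \<in> B"
    then have "x \<in> W x \<inter> Q" unfolding W(2) using rpos[OF x] by (simp add: B_def)
    then show "x \<in> (\<Union>x\<in>B. W x)" using x by blast
  qed
  from compactE_image[OF B W(1) this] obtain I where I: "I \<subseteq> B" "finite I" "B \<subseteq> (\<Union>x\<in>I. W x)" by metis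
  have Ine: "I \<noteq> {}" using I(3) Bne by auto
  \<comment> \<open>The first factor switches a motion off outside its ball of radius
    \<open>r i\<close>, the second one wherever \<open>F (h x) \<le> m\<close>.\<close>
  define \<psi> where "\<psi> i x = max 0 (r i - fdist (h i) (h x)) * max 0 (F (h x) - m)" for i x
  define S where "S x = (\<Sum>i\<in>I. \<psi> i x)" for x
  have \<psi>c: "continuous_on Q (\<psi> i)" for i unfolding \<psi>_def by (intro continuous_intros fc Fh)
  have \<psi>0: "0 \<le> \<psi> i x" for i x by (simp add: \<psi>_def)
  have Sc: "continuous_on Q S" unfolding S_def by (intro continuous_intros \<psi>c)
  have S0: "0 \<le> S x" for x unfolding S_def by (intro sum_nonneg \<psi>0)
  have Spos: "0 < S x" if x: "x \<in> B" for x
  proof -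
    obtain i where i: "i \<in> I" "x \<in> W i" using I(3) x by blast
    have "x \<in> W i \<inter> Q" using i x by (simp add: B_def)
    then have "fdist (h i) (h x) < r i" unfolding W(2) by simp
    then have "0 < \<psi> i x" using x m by (simp add: \<psi>_def B_def)
    then show ?thesis unfolding S_def using I(2) i(1) \<psi>0 by (meson sum_pos2)
  qed
  have "continuous_on B S" by (rule continuous_on_subset[OF Sc]) (simp add: B_def)
  from continuous_attains_inf[OF B Bne this] obtain x0 where x0: "x0 \<in> B" "\<And>x. x \<in> B \<Longrightarrow> S x0 \<le> S x" by blast
  define s0 where "s0 = S x0"
  have s0: "s0 > 0" "\<And>x. x \<in> B \<Longrightarrow> s0 \<le> S x" using x0 Spos by (auto simp: s0_def)
  \<comment> \<open>Dividing by \<open>S\<close> alone would fail where all weights vanish. The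
    lower bound \<open>s0\<close>, the minimum of \<open>S\<close> on the set of maximum points,
    keeps the total weight at most 1 and equal to 1 on that set.\<close>
  define den where "den x = max (S x) s0" for x
  have den: "den x > 0" "S x \<le> den x" for x using s0(1) by (auto simp: den_def)
  have denc: "continuous_on Q den" unfolding den_def by (intro continuous_intros Sc)
  obtain \<eta> where \<eta>: "\<eta> > 0" "\<And>x. x \<in> Q \<Longrightarrow> S x \<le> s0 / 2 \<Longrightarrow> F (h x) \<le> b - \<eta>"
  proof -
    define Z where "Z = Q \<inter> S -` {..s0 / 2}"
    have "closed Z" unfolding Z_def by (rule continuous_closed_preimage[OF Sc clQ closed_atMost])
    then have Z: "compact Z" using compact_Int_closed[OF Q, of Z] by (simp add: Z_def Int_absorb1)
    show thesis
    proof (cases "Z = {}")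
      case True
      then show ?thesis by (intro that[of 1]) (auto simp: Z_def)
    next
      case False
      have "continuous_on Z (\<lambda>x. F (h x))" by (rule continuous_on_subset[OF Fh]) (simp add: Z_def)
      from continuous_attains_sup[OF Z False this]
      obtain z where z: "z \<in> Z" "\<And>x. x \<in> Z \<Longrightarrow> F (h x) \<le> F (h z)" by blast
      have "z \<notin> B" using z(1) s0(2)[of z] s0(1) by (auto simp: Z_def)
      then have "F (h z) < b" using z(1) b(1)[of z] by (force simp: Z_def B_def)
      then show ?thesis using z(2) by (intro that[of "b - F (h z)"]) (auto simp: Z_def)
    qed
  qed
  \<comment> \<open>\<open>t = \<rho> / 2\<close> is less than every \<open>r i\<close>, so all
    motions remain defined, and \<open>\<sigma> * t / 2 \<le> \<eta>\<close>, so that points with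
    small weight need no decrease at all.\<close>
  define \<rho> where "\<rho> = Min (insert (2 * \<eta> / \<sigma>) (r ` I))"
  have "\<rho> > 0" unfolding \<rho>_def using I \<eta> \<sigma> rpos by (subst Min_gr_iff) auto
  define t where "t = \<rho> / 2"
  have t: "t > 0" using \<open>\<rho> > 0\<close> by (simp add: t_def)
  have tr: "t < r i" if "i \<in> I" for i
  proof -
    have "\<rho> \<le> r i" unfolding \<rho>_def using I(2) that by (intro Min_le) auto
    then show ?thesis using \<open>\<rho> > 0\<close> by (simp add: t_def)
  qed
  have t\<eta>: "\<sigma> * t / 2 \<le> \<eta>"
  proof -
    have "\<rho> \<le> 2 * \<eta> / \<sigma>" unfolding \<rho>_def using I(2) by (intro Min_le) auto
    then have "\<rho> * \<sigma> \<le> 2 * \<eta>" using \<sigma> by (simp add: pos_le_divide_eq)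
    moreover have "0 < \<rho> * \<sigma>" using \<open>\<rho> > 0\<close> \<sigma> by simp
    ultimately have "\<sigma> * \<rho> \<le> 4 * \<eta>" by (simp add: mult.commute)
    then show ?thesis by (simp add: t_def)
  qed
  define a where "a i p = fst p * t * (\<psi> i (snd p) / den (snd p))" for i and p :: "real \<times> 'q"
  have suma: "(\<Sum>i\<in>I. a i p) = fst p * t * (S (snd p) / den (snd p))" for p
    by (simp add: a_def S_def sum_distrib_left sum_divide_distrib)
  have q01: "0 \<le> S x / den x" "S x / den x \<le> 1" for x using den[of x] S0[of x] by simp_all
  have sle: "fst p * t * (S (snd p) / den (snd p)) \<le> t" if "p \<in> {0..1} \<times> Q" for p
  proof -
    have "fst p * t * (S (snd p) / den (snd p)) \<le> 1 * t * 1"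
      using that q01[of "snd p"] t by (intro mult_mono) auto
    then show ?thesis by simp
  qed
  have "\<exists>g. continuous_on ({0..1} \<times> Q) g \<and> (\<forall>p\<in>{0..1} \<times> Q. fdist (h (snd p)) (g p) \<le> (\<Sum>i\<in>I. a i p) \<and>
      F (g p) \<le> F (h (snd p)) - \<sigma> * (\<Sum>i\<in>I. a i p))"
  proof (rule glued_deformation[OF I(2), where y = h and r = r and H = H])
    have sndc: "continuous_on ({0..1::real} \<times> Q) (\<lambda>p. f (snd p))" if "continuous_on Q f" for f :: "'q \<Rightarrow> 'z::topological_space"
      by (rule continuous_on_compose2[OF that]) (auto intro: continuous_intros)
    show "continuous_on ({0..1::real} \<times> Q) (\<lambda>p. h (snd p))" by (rule sndc[OF h])
    fix i assume i: "i \<in> I"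
    then have iB: "i \<in> B" using I(1) by blast
    show "continuous_on ({v. fdist (h i) v < 2 * r i} \<times> {0..r i}) (\<lambda>(v, s). H i v s)"
      using LD[OF iB] by (simp add: LD_def)
    show "H i v 0 = v" if "fdist (h i) v < 2 * r i" for v
      using LD[OF iB] that by (simp add: LD_def)
    show "fdist v (H i v s) \<le> s" "F (H i v s) \<le> F v - \<sigma> * s" if "fdist (h i) v < 2 * r i" "s \<in> {0..r i}" for v s
      using LD[OF iB] that by (simp_all add: LD_def)
    show "continuous_on ({0..1::real} \<times> Q) (a i)"
      unfolding a_def using den(1)
      by (intro continuous_intros sndc[OF \<psi>c] sndc[OF denc]) (metis less_irrefl)
    fix p assume p: "p \<in> {0..1::real} \<times> Q"
    show "0 \<le> a i p" unfolding a_def using p t \<psi>0 den(1)[of "snd p"] by (intro mult_nonneg_nonneg divide_nonneg_nonneg) auto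
    show "(\<Sum>j\<in>I. a j p) < r i" using sle[OF p] tr[OF i] suma[of p] by linarith
    assume "0 < a i p"
    then have "\<psi> i (snd p) \<noteq> 0" by (auto simp: a_def)
    then show "fdist (h i) (h (snd p)) \<le> r i" by (auto simp: \<psi>_def max_def split: if_splits)
  qed
  then obtain G where G: "continuous_on ({0..1} \<times> Q) G"
    "\<And>p. p \<in> {0..1} \<times> Q \<Longrightarrow> fdist (h (snd p)) (G p) \<le> fst p * t * (S (snd p) / den (snd p))"
    "\<And>p. p \<in> {0..1} \<times> Q \<Longrightarrow> F (G p) \<le> F (h (snd p)) - \<sigma> * (fst p * t * (S (snd p) / den (snd p)))"
    unfolding suma by blast
  show thesis
  proof (rule that[OF t G(1)])
    fix x assume x: "x \<in> Q"
    show "G (0, x) = h x" using G(2)[of "(0, x)"] x fdist_eq_0_imp_eq[of "h x" "G (0, x)"] by simp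
    show "fdist (h x) (G (1, x)) \<le> t" using G(2)[of "(1, x)"] sle[of "(1, x)"] x by simp
    show "F (G (1, x)) \<le> b - \<sigma> * t / 2"
    proof (cases "S x \<le> s0 / 2")
      case True
      have "0 \<le> \<sigma> * (t * (S x / den x))" using \<sigma> t q01[of x] by (intro mult_nonneg_nonneg) auto
      then have "F (G (1, x)) \<le> F (h x)" using G(3)[of "(1, x)"] x by simp
      then show ?thesis using \<eta>(2)[OF x True] t\<eta> by linarith
    next
      case False
      \<comment> \<open>Either \<open>den x = S x\<close> and the quotient is 1, or
        \<open>den x = s0\<close> and \<open>S x\<close> exceeds its half.\<close>
      then have "1 / 2 \<le> S x / den x" using s0(1) by (auto simp: den_def max_def field_simps)
      then have "\<sigma> * (t * (1 / 2)) \<le> \<sigma> * (t * (S x / den x))"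
        using \<sigma> t by (intro mult_left_mono) auto
      then show ?thesis using G(3)[of "(1, x)"] x b(1)[OF x] by simp
    qed
  next
    fix s :: real and x assume s: "s \<in> {0..1}" and x: "x \<in> Q"
    have "0 \<le> \<sigma> * (s * t * (S x / den x))" using \<sigma> t q01[of x] s by (intro mult_nonneg_nonneg) auto
    then show "F (G (s, x)) \<le> F (h x)" using G(3)[of "(s, x)"] s x by simp
    assume "F (h x) \<le> m"
    then have "S x = 0" by (simp add: S_def \<psi>_def)
    then show "G (s, x) = h x" using G(2)[of "(s, x)"] s x fdist_eq_0_imp_eq[of "h x" "G (s, x)"] by simp
  qed
qed

end

section \<open>The minimax principle\<close>

text \<open>Near-minimal choices in the nested sets \<open>S x\<close> produce a Cauchy sequence
  whose limit belongs to all of them. \<open>D\<close> need not separate points, as maps will be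
  compared on \<open>Q\<close> only; hence the conclusion compares values of \<open>\<Phi>\<close>
  instead of asserting \<open>y = x\<close>. Semicontinuity is asked only along sequences with
  nonincreasing values.\<close>

lemma ekeland_principle:
  fixes X :: "'x set" and D :: "'x \<Rightarrow> 'x \<Rightarrow> real" and \<Phi> :: "'x \<Rightarrow> real"
  assumes x0: "x0 \<in> X" and \<epsilon>: "\<epsilon> > 0"
    and D0: "\<And>x. x \<in> X \<Longrightarrow> D x x = 0" and Dpos: "\<And>x y. x \<in> X \<Longrightarrow> y \<in> X \<Longrightarrow> 0 \<le> D x y"
    and tri: "\<And>x y z. x \<in> X \<Longrightarrow> y \<in> X \<Longrightarrow> z \<in> X \<Longrightarrow> D x z \<le> D x y + D y z"
    and lower: "\<And>x. x \<in> X \<Longrightarrow> c \<le> \<Phi> x"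
    and complete: "\<And>u::nat \<Rightarrow> 'x. \<lbrakk>\<And>k. u k \<in> X; \<And>e. e > 0 \<Longrightarrow> \<exists>k0. \<forall>k\<ge>k0. \<forall>l\<ge>k. D (u k) (u l) < e\<rbrakk>
        \<Longrightarrow> \<exists>x\<in>X. (\<lambda>k. D (u k) x) \<longlonglongrightarrow> 0"
    and lsc: "\<And>(u::nat \<Rightarrow> 'x) x k. \<lbrakk>\<And>k. u k \<in> X; x \<in> X; (\<lambda>k. D (u k) x) \<longlonglongrightarrow> 0;
        \<And>k l. k \<le> l \<Longrightarrow> \<Phi> (u l) \<le> \<Phi> (u k)\<rbrakk> \<Longrightarrow> \<Phi> x \<le> \<Phi> (u k)"
  obtains x where "x \<in> X" "\<Phi> x \<le> \<Phi> x0" "\<And>y. y \<in> X \<Longrightarrow> \<Phi> y + \<epsilon> * D x y \<le> \<Phi> x \<Longrightarrow> \<Phi> x \<le> \<Phi> y"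
proof -
  define S where "S x = {y \<in> X. \<Phi> y + \<epsilon> * D x y \<le> \<Phi> x}" for x
  have Strans: "z \<in> S x" if "y \<in> S x" "z \<in> S y" "x \<in> X" for x y z
  proof -
    have "D x z \<le> D x y + D y z" using that by (intro tri) (auto simp: S_def)
    then have "\<epsilon> * D x z \<le> \<epsilon> * D x y + \<epsilon> * D y z" using \<epsilon> by (metis distrib_left less_imp_le mult_left_mono)
    then show ?thesis using that by (auto simp: S_def)
  qed
  have near: "\<exists>y. y \<in> S x \<and> (\<forall>z\<in>S x. \<Phi> y \<le> \<Phi> z + e)" if x: "x \<in> X" and e: "e > 0" for x and e :: real
  proof -
    have ne: "x \<in> S x" using x D0[OF x] by (simp add: S_def)
    have bb: "bdd_below (\<Phi> ` S x)" by (rule bdd_belowI2[where m = c]) (auto simp: S_def lower)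
    have "Inf (\<Phi> ` S x) < Inf (\<Phi> ` S x) + e" using e by simp
    then obtain y where y: "y \<in> S x" "\<Phi> y < Inf (\<Phi> ` S x) + e"
      using cINF_less_iff[OF _ bb] ne by (metis empty_iff)
    then have "\<Phi> y \<le> \<Phi> z + e" if "z \<in> S x" for z using cINF_lower[OF bb that] by linarith
    then show ?thesis using y by blast
  qed
  \<comment> \<open>The tolerance \<open>1 / real (Suc k)\<close> tends to 0, which makes the limit
    point minimal in its own set \<open>S x\<close>.\<close>
  have "\<exists>u. (u 0 = x0 \<and> (\<forall>k::nat. u k \<in> X)) \<and> (\<forall>k. u (Suc k) \<in> S (u k) \<and> (\<forall>z\<in>S (u k). \<Phi> (u (Suc k)) \<le> \<Phi> z + 1 / real (Suc k)))"
  proof -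
    have "\<exists>u. \<forall>k. (u k \<in> X \<and> (k = 0 \<longrightarrow> u k = x0)) \<and> (u (Suc k) \<in> S (u k) \<and> (\<forall>z\<in>S (u k). \<Phi> (u (Suc k)) \<le> \<Phi> z + 1 / real (Suc k)))"
    proof (rule dependent_nat_choice)
      show "\<exists>x. x \<in> X \<and> ((0::nat) = 0 \<longrightarrow> x = x0)" using x0 by blast
      fix x and k :: nat assume "x \<in> X \<and> (k = 0 \<longrightarrow> x = x0)"
      then obtain y where "y \<in> S x" "\<forall>z\<in>S x. \<Phi> y \<le> \<Phi> z + 1 / real (Suc k)"
        using near[of x "1 / real (Suc k)"] by auto
      then show "\<exists>y. (y \<in> X \<and> (Suc k = 0 \<longrightarrow> y = x0)) \<and> y \<in> S x \<and> (\<forall>z\<in>S x. \<Phi> y \<le> \<Phi> z + 1 / real (Suc k))"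
        by (auto simp: S_def)
    qed
    then show ?thesis by blast
  qed
  then obtain u where u0: "u 0 = x0" and uX: "\<And>k. u k \<in> X" and uS: "\<And>k. u (Suc k) \<in> S (u k)"
    and umin: "\<And>k z. z \<in> S (u k) \<Longrightarrow> \<Phi> (u (Suc k)) \<le> \<Phi> z + 1 / real (Suc k)" by blast
  have ukl: "u l \<in> S (u k)" if "k \<le> l" for k l
    using that
  proof (induction rule: dec_induct)
    case base
    then show ?case using uX D0 by (simp add: S_def)
  next
    case (step l)
    then show ?case using Strans uS uX by blast
  qed
  have dec: "\<Phi> (u l) \<le> \<Phi> (u k)" if "k \<le> l" for k l
  proof -
    have "0 \<le> \<epsilon> * D (u k) (u l)" using Dpos[OF uX uX, of k l] \<epsilon> by simp
    moreover have "\<Phi> (u l) + \<epsilon> * D (u k) (u l) \<le> \<Phi> (u k)" using ukl[OF that] by (simp add: S_def)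
    ultimately show ?thesis by linarith
  qed
  have "\<exists>L. (\<lambda>k. \<Phi> (u k)) \<longlonglongrightarrow> L \<and> (\<forall>k. L \<le> \<Phi> (u k))"
    using decseq_convergent[of "\<lambda>k. \<Phi> (u k)" c] lower uX dec unfolding decseq_def by metis
  then obtain L where L: "(\<lambda>k. \<Phi> (u k)) \<longlonglongrightarrow> L" "\<And>k. L \<le> \<Phi> (u k)" by blast
  \<comment> \<open>The values decrease to \<open>L\<close>, and
    \<open>\<epsilon> * D (u k) (u l)\<close> is at most \<open>\<Phi> (u k) - L\<close>.\<close>
  have "\<exists>x\<in>X. (\<lambda>k. D (u k) x) \<longlonglongrightarrow> 0"
  proof (rule complete[OF uX])
    fix e :: real assume e: "e > 0"
    have "L < L + \<epsilon> * e" using e \<epsilon> by simp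
    then have "\<forall>\<^sub>F k in sequentially. \<Phi> (u k) < L + \<epsilon> * e" by (rule order_tendstoD(2)[OF L(1)])
    then obtain k0 where k0: "\<And>k. k \<ge> k0 \<Longrightarrow> \<Phi> (u k) < L + \<epsilon> * e" unfolding eventually_sequentially by blast
    have "D (u k) (u l) < e" if "k0 \<le> k" "k \<le> l" for k l
    proof -
      have "\<Phi> (u l) + \<epsilon> * D (u k) (u l) \<le> \<Phi> (u k)" using ukl[OF that(2)] by (simp add: S_def)
      then have "\<epsilon> * D (u k) (u l) < \<epsilon> * e" using k0[OF that(1)] L(2)[of l] by linarith
      then show ?thesis using \<epsilon> by simp
    qed
    then show "\<exists>k0. \<forall>k\<ge>k0. \<forall>l\<ge>k. D (u k) (u l) < e" by blast
  qed
  then obtain x where x: "x \<in> X" "(\<lambda>k. D (u k) x) \<longlonglongrightarrow> 0" by blast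
  have \<Phi>x: "\<Phi> x \<le> \<Phi> (u k)" for k by (rule lsc[OF uX x dec])
  have xS: "x \<in> S (u k)" for k
  proof -
    have "\<forall>\<^sub>F l in sequentially. \<Phi> x + \<epsilon> * D (u k) x \<le> \<Phi> (u k) + \<epsilon> * D (u l) x"
      using eventually_ge_at_top[of k]
    proof eventually_elim
      case (elim l)
      have "D (u k) x \<le> D (u k) (u l) + D (u l) x" by (intro tri uX x)
      then have "\<epsilon> * D (u k) x \<le> \<epsilon> * D (u k) (u l) + \<epsilon> * D (u l) x"
        using \<epsilon> by (metis distrib_left less_imp_le mult_left_mono)
      moreover have "\<Phi> (u l) + \<epsilon> * D (u k) (u l) \<le> \<Phi> (u k)" using ukl[OF elim] by (simp add: S_def)
      ultimately show ?case using \<Phi>x[of l] by linarith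
    qed
    moreover have "(\<lambda>l. \<Phi> (u k) + \<epsilon> * D (u l) x) \<longlonglongrightarrow> \<Phi> (u k) + \<epsilon> * 0"
      by (intro tendsto_intros x)
    ultimately have "\<Phi> x + \<epsilon> * D (u k) x \<le> \<Phi> (u k) + \<epsilon> * 0"
      by (intro tendsto_lowerbound[OF _ _ trivial_limit_sequentially])
    then show ?thesis using x by (simp add: S_def)
  qed
  show thesis
  proof (rule that[OF x(1)])
    show "\<Phi> x \<le> \<Phi> x0" using \<Phi>x[of 0] u0 by simp
    fix y assume "y \<in> X" "\<Phi> y + \<epsilon> * D x y \<le> \<Phi> x"
    then have "y \<in> S x" by (simp add: S_def)
    then have "y \<in> S (u k)" for k using Strans[OF xS _ uX] by blast
    \<comment> \<open>\<open>y\<close> competes in every \<open>S (u k)\<close>, so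
      \<open>u (Suc k)\<close> is within the tolerance of it.\<close>
    then have le: "\<Phi> x \<le> \<Phi> y + 1 / real (Suc k)" for k using umin[of y k] \<Phi>x[of "Suc k"] by force
    have "(\<lambda>k. \<Phi> y + 1 / real (Suc k)) \<longlonglongrightarrow> \<Phi> y + 0"
      by (intro tendsto_intros LIMSEQ_inverse_real_of_nat[unfolded inverse_eq_divide])
    then have "\<Phi> x \<le> \<Phi> y + 0" by (rule LIMSEQ_le_const) (use le in blast)
    then show "\<Phi> x \<le> \<Phi> y" by simp
  qed
qed

locale complete_finsler_functional = finsler_functional A nrm F
  for A :: "('m::t3_space, 'e::banach) chart set"
    and nrm :: "('m, 'e) chart \<Rightarrow> 'm \<Rightarrow> 'e \<Rightarrow> real" and F :: "'m \<Rightarrow> real" +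
  assumes complete: "finsler_complete A nrm"
begin

lemma fdist_complete:
  fixes u :: "nat \<Rightarrow> 'm"
  assumes "\<And>e. e > 0 \<Longrightarrow> \<exists>k0. \<forall>k\<ge>k0. \<forall>l\<ge>k0. fdist (u k) (u l) < e"
  obtains x where "u \<longlonglongrightarrow> x"
proof -
  have "\<exists>k0. \<forall>k\<ge>k0. \<forall>l\<ge>k0. finsler_dist A nrm (u k) (u l) < ereal e" if e: "e > 0" for e
  proof -
    obtain k0 where k0: "\<And>k l. k \<ge> k0 \<Longrightarrow> l \<ge> k0 \<Longrightarrow> fdist (u k) (u l) < min e 1"
      using assms[of "min e 1"] e by auto
    have "finsler_dist A nrm (u k) (u l) < ereal e" if "k \<ge> k0" "l \<ge> k0" for k l
    proof -
      have "finsler_dist A nrm (u k) (u l) < ereal (min e 1)"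
        using k0[OF that] fdist_less_iff[of "min e 1"] by simp
      also have "\<dots> \<le> ereal e" by simp
      finally show ?thesis .
    qed
    then show ?thesis by blast
  qed
  then obtain x where x: "(\<lambda>k. finsler_dist A nrm (u k) x) \<longlonglongrightarrow> 0"
    using complete unfolding finsler_complete_def by blast
  have "(\<lambda>k. fdist x (u k)) \<longlonglongrightarrow> 0"
  proof (rule order_tendstoI)
    show "\<forall>\<^sub>F k in sequentially. a < fdist x (u k)" if "a < 0" for a
      using that by (intro always_eventually) (meson fdist_nonneg less_le_trans)
    fix a :: real assume a: "0 < a"
    then have "0 < ereal (min a 1)" by simp
    from order_tendstoD(2)[OF x this] show "\<forall>\<^sub>F k in sequentially. fdist x (u k) < a"
    proof eventually_elim
      case (elim k)
      then have "fdist (u k) x < min a 1" using fdist_less_iff[of "min a 1"] by simp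
      then show ?case by (simp add: fdist_sym)
    qed
  qed
  then show thesis using that tendsto_iff_fdist by blast
qed

text \<open>This is the completeness of the space of maps on which Ekeland's principle is
  run.\<close>

lemma uniformly_Cauchy_limit:
  fixes u :: "nat \<Rightarrow> 'q::topological_space \<Rightarrow> 'm"
  assumes u: "\<And>k. continuous_on Q (u k)"
    and cauchy: "\<And>e. e > 0 \<Longrightarrow> \<exists>k0. \<forall>k\<ge>k0. \<forall>l\<ge>k0. \<forall>x\<in>Q. fdist (u k x) (u l x) < e"
  obtains g where "continuous_on Q g" "\<And>e. e > 0 \<Longrightarrow> \<exists>k0. \<forall>k\<ge>k0. \<forall>x\<in>Q. fdist (u k x) (g x) < e"
proof -
  have "\<exists>y. (\<lambda>k. u k x) \<longlonglongrightarrow> y" if x: "x \<in> Q" for x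
  proof -
    have "\<exists>k0. \<forall>k\<ge>k0. \<forall>l\<ge>k0. fdist (u k x) (u l x) < e" if "e > 0" for e
      using cauchy[OF that] x by blast
    then show ?thesis using fdist_complete[of "\<lambda>k. u k x"] by metis
  qed
  then obtain g where g: "\<And>x. x \<in> Q \<Longrightarrow> (\<lambda>k. u k x) \<longlonglongrightarrow> g x" by metis
  have unif: "\<exists>k0. \<forall>k\<ge>k0. \<forall>x\<in>Q. fdist (u k x) (g x) < e" if e: "e > 0" for e
  proof -
    obtain k0 where k0: "\<And>k l x. k \<ge> k0 \<Longrightarrow> l \<ge> k0 \<Longrightarrow> x \<in> Q \<Longrightarrow> fdist (u k x) (u l x) < e / 2"
      using cauchy[of "e / 2"] e by auto
    have "fdist (u k x) (g x) \<le> e / 2" if "k \<ge> k0" "x \<in> Q" for k x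
    proof (rule tendsto_upperbound[OF _ _ trivial_limit_sequentially])
      show "(\<lambda>l. fdist (u k x) (u l x)) \<longlonglongrightarrow> fdist (u k x) (g x)"
        by (intro tendsto_fdist tendsto_const g that)
      show "\<forall>\<^sub>F l in sequentially. fdist (u k x) (u l x) \<le> e / 2"
        using eventually_ge_at_top[of k0] by eventually_elim (use k0 that in \<open>auto intro: less_imp_le\<close>)
    qed
    then show ?thesis using e by (intro exI[of _ k0]) force
  qed
  have "continuous_on Q g"
    unfolding continuous_on_def
  proof
    fix x assume x: "x \<in> Q"
    show "(g \<longlongrightarrow> g x) (at x within Q)"
      unfolding tendsto_iff_fdist[of g]
    proof (rule order_tendstoI)
      show "\<forall>\<^sub>F z in at x within Q. a < fdist (g x) (g z)" if "a < 0" for a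
        using that by (intro always_eventually) (meson fdist_nonneg less_le_trans)
      fix e :: real assume e: "0 < e"
      obtain k where k: "\<And>z. z \<in> Q \<Longrightarrow> fdist (u k z) (g z) < e / 3"
        using unif[of "e / 3"] e by auto
      have "((\<lambda>z. fdist (u k x) (u k z)) \<longlongrightarrow> 0) (at x within Q)"
        using u[of k] x by (simp add: continuous_on_def flip: tendsto_iff_fdist)
      then have "\<forall>\<^sub>F z in at x within Q. fdist (u k x) (u k z) < e / 3"
        by (rule order_tendstoD) (use e in simp)
      moreover have "\<forall>\<^sub>F z in at x within Q. z \<in> Q" by (simp add: eventually_at_filter)
      ultimately show "\<forall>\<^sub>F z in at x within Q. fdist (g x) (g z) < e"
      proof eventually_elim
        case (elim z)
        then show ?case
          using fdist_triangle[of "g x" "g z" "u k x"] fdist_triangle[of "u k x" "g z" "u k z"]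
            k[OF x] k[OF elim(2)] fdist_sym[of "g x" "u k x"] by linarith
      qed
    qed
  qed
  then show thesis using unif that by blast
qed

text \<open>\<open>Xlim\<close> makes the class complete for the uniform distance and
  \<open>Xdef\<close> lets it absorb the deformations, which rest on the set
  \<open>F \<le> m\<close>. Ekeland's principle starts at \<open>g0\<close>, whose maximum is below
  \<open>c + \<epsilon>\<close>; the point found is a maximum point of the resulting map.\<close>

lemma minimax_almost_critical:
  fixes Q :: "'q::t2_space set"
  assumes Q: "compact Q" "Q \<noteq> {}"
    and X: "\<And>g. g \<in> X \<Longrightarrow> continuous_on Q g"
    and Xlim: "\<And>(u::nat \<Rightarrow> 'q \<Rightarrow> 'm) g. \<lbrakk>\<And>k. u k \<in> X; continuous_on Q g;
        \<And>e. e > 0 \<Longrightarrow> \<exists>k0. \<forall>k\<ge>k0. \<forall>x\<in>Q. fdist (u k x) (g x) < e\<rbrakk> \<Longrightarrow> g \<in> X"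
    and Xdef: "\<And>g G. \<lbrakk>g \<in> X; continuous_on ({0..1::real} \<times> Q) G; \<And>x. x \<in> Q \<Longrightarrow> G (0, x) = g x;
        \<And>s x. s \<in> {0..1} \<Longrightarrow> x \<in> Q \<Longrightarrow> F (G (s, x)) \<le> F (g x);
        \<And>s x. s \<in> {0..1} \<Longrightarrow> x \<in> Q \<Longrightarrow> F (g x) \<le> m \<Longrightarrow> G (s, x) = g x\<rbrakk> \<Longrightarrow> (\<lambda>x. G (1, x)) \<in> X"
    and m: "m < c"
    and low: "\<And>g. g \<in> X \<Longrightarrow> \<exists>x\<in>Q. c \<le> F (g x)"
    and g0: "g0 \<in> X" "\<And>x. x \<in> Q \<Longrightarrow> F (g0 x) < c + \<epsilon>" and \<epsilon>: "\<epsilon> > 0"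
  obtains y where "c \<le> F y" "F y < c + \<epsilon>" "differential_norm A nrm F y \<le> 2 * \<epsilon>"
proof -
  define \<Phi> where "\<Phi> g = (SUP x\<in>Q. F (g x))" for g
  define D where "D g g' = (SUP x\<in>Q. fdist (g x) (g' x))" for g g' :: "'q \<Rightarrow> 'm"
  have att: "(\<forall>x\<in>Q. F (g x) \<le> \<Phi> g) \<and> (\<exists>x\<in>Q. F (g x) = \<Phi> g)" if "g \<in> X" for g
  proof -
    have "continuous_on Q (\<lambda>x. F (g x))"
      by (rule continuous_on_compose2[OF continuous_on_functional[of UNIV] X[OF that]]) simp
    from continuous_attains_sup[OF Q this] obtain x where x: "x \<in> Q" "\<And>z. z \<in> Q \<Longrightarrow> F (g z) \<le> F (g x)" by blast
    then have "\<Phi> g = F (g x)" unfolding \<Phi>_def by (intro cSup_eq_maximum) auto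
    then show ?thesis using x by auto
  qed
  then have le\<Phi>: "F (g x) \<le> \<Phi> g" if "g \<in> X" "x \<in> Q" for g x using that by blast
  have \<Phi>c: "c \<le> \<Phi> g" if "g \<in> X" for g using low[OF that] le\<Phi>[OF that] order_trans by blast
  have leD: "fdist (g x) (g' x) \<le> D g g'" if "x \<in> Q" for g g' x
    unfolding D_def by (rule cSUP_upper[OF that]) (auto intro!: bdd_aboveI2 fdist_le_1)
  have Dle: "D g g' \<le> t" if "\<And>x. x \<in> Q \<Longrightarrow> fdist (g x) (g' x) \<le> t" for g g' t
    unfolding D_def by (rule cSUP_least[OF Q(2) that])
  obtain q where q: "q \<in> Q" using Q(2) by blast
  have D0: "0 \<le> D g g'" for g g' using leD[OF q, of g g'] fdist_nonneg order_trans by blast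
  have unifD: "\<exists>k0. \<forall>k\<ge>k0. D (u k) g < e"
    if u: "\<And>e. e > 0 \<Longrightarrow> \<exists>k0. \<forall>k\<ge>k0. \<forall>x\<in>Q. fdist (u k x) (g x) < e" and e: "e > 0" for u :: "nat \<Rightarrow> 'q \<Rightarrow> 'm" and g e
  proof -
    obtain k0 where k0: "\<And>k x. k \<ge> k0 \<Longrightarrow> x \<in> Q \<Longrightarrow> fdist (u k x) (g x) < e / 2"
      using u[of "e / 2"] e by auto
    have "D (u k) g \<le> e / 2" if k: "k \<ge> k0" for k by (rule Dle) (use k0[OF k] in \<open>auto intro: less_imp_le\<close>)
    then show ?thesis using e by (intro exI[of _ k0]) force
  qed
  obtain g where g: "g \<in> X" "\<Phi> g \<le> \<Phi> g0" "\<And>h. h \<in> X \<Longrightarrow> \<Phi> h + \<epsilon> * D g h \<le> \<Phi> g \<Longrightarrow> \<Phi> g \<le> \<Phi> h"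
  proof (rule ekeland_principle[OF g0(1) \<epsilon>, where D = D and \<Phi> = \<Phi> and c = c])
    show "D g g = 0" for g using D0[of g g] Dle[of g g 0] by simp
    show "0 \<le> D g g'" for g g' by (rule D0)
    show "D g k \<le> D g h + D h k" for g h k
    proof (rule Dle)
      fix x assume x: "x \<in> Q"
      show "fdist (g x) (k x) \<le> D g h + D h k"
        using fdist_triangle[of "g x" "k x" "h x"] leD[OF x, of g h] leD[OF x, of h k] by linarith
    qed
    show "c \<le> \<Phi> g" if "g \<in> X" for g by (rule \<Phi>c[OF that])
  next
    fix u :: "nat \<Rightarrow> 'q \<Rightarrow> 'm"
    assume u: "\<And>k. u k \<in> X" and cau: "\<And>e. e > 0 \<Longrightarrow> \<exists>k0. \<forall>k\<ge>k0. \<forall>l\<ge>k. D (u k) (u l) < e"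
    have "\<exists>k0. \<forall>k\<ge>k0. \<forall>l\<ge>k0. \<forall>x\<in>Q. fdist (u k x) (u l x) < e" if e: "e > 0" for e
    proof -
      obtain k0 where k0: "\<And>k l. k0 \<le> k \<Longrightarrow> k \<le> l \<Longrightarrow> D (u k) (u l) < e" using cau[OF e] by blast
      have "fdist (u k x) (u l x) < e" if "k0 \<le> k" "k0 \<le> l" "x \<in> Q" for k l x
      proof (cases "k \<le> l")
        case True
        then show ?thesis using k0[OF that(1) True] leD[OF that(3), of "u k" "u l"] by linarith
      next
        case False
        then show ?thesis using k0[OF that(2), of k] leD[OF that(3), of "u l" "u k"] fdist_sym[of "u k x"] by simp
      qed
      then show ?thesis by blast
    qed
    from uniformly_Cauchy_limit[OF X[OF u] this] obtain g where g: "continuous_on Q g"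
      "\<And>e. e > 0 \<Longrightarrow> \<exists>k0. \<forall>k\<ge>k0. \<forall>x\<in>Q. fdist (u k x) (g x) < e" by metis
    have "(\<lambda>k. D (u k) g) \<longlonglongrightarrow> 0"
    proof (rule LIMSEQ_I)
      fix e :: real assume "0 < e"
      then show "\<exists>k0. \<forall>k\<ge>k0. norm (D (u k) g - 0) < e"
        using unifD[OF g(2)] D0 by (simp add: abs_of_nonneg)
    qed
    then show "\<exists>x\<in>X. (\<lambda>k. D (u k) x) \<longlonglongrightarrow> 0" using Xlim[OF u g] by blast
  next
    fix u :: "nat \<Rightarrow> 'q \<Rightarrow> 'm" and g k
    assume u: "\<And>k. u k \<in> X" and g: "g \<in> X" and lim: "(\<lambda>k. D (u k) g) \<longlonglongrightarrow> 0"
      and dec: "\<And>k l. k \<le> l \<Longrightarrow> \<Phi> (u l) \<le> \<Phi> (u k)"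
    \<comment> \<open>Convergence at one maximum point of the limit map suffices for the
      semicontinuity of the maximum.\<close>
    obtain x where x: "x \<in> Q" "F (g x) = \<Phi> g" using att[OF g] by blast
    have "(\<lambda>l. fdist (g x) (u l x)) \<longlonglongrightarrow> 0"
      by (rule tendsto_sandwich[OF _ _ tendsto_const lim])
        (use leD[OF x(1), of _ g] in \<open>auto simp: fdist_sym[of "g x"]\<close>)
    then have "(\<lambda>l. u l x) \<longlonglongrightarrow> g x" by (simp flip: tendsto_iff_fdist)
    moreover have "isCont F (g x)" using continuous_on_functional[of UNIV] by (simp add: continuous_on_eq_continuous_at)
    ultimately have "(\<lambda>l. F (u l x)) \<longlonglongrightarrow> F (g x)" by (rule isCont_tendsto_compose[rotated])
    moreover have "\<forall>\<^sub>F l in sequentially. F (u l x) \<le> \<Phi> (u k)"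
      using eventually_ge_at_top[of k] by eventually_elim (use le\<Phi>[OF u x(1)] dec order_trans in blast)
    ultimately show "\<Phi> g \<le> \<Phi> (u k)"
      unfolding x(2)[symmetric] by (rule tendsto_upperbound) simp
  qed (rule that)
  obtain x0 where x0: "x0 \<in> Q" "F (g0 x0) = \<Phi> g0" using att[OF g0(1)] by blast
  have \<Phi>g: "\<Phi> g < c + \<epsilon>" using g(2) g0(2)[OF x0(1)] x0(2) by simp
  \<comment> \<open>Otherwise a deformation would lower the maximum by at least
    \<open>\<epsilon> * t\<close> while moving \<open>g\<close> by at most \<open>t\<close>, an
    improvement which the choice of \<open>g\<close> excludes.\<close>
  have "\<exists>x\<in>Q. F (g x) = \<Phi> g \<and> differential_norm A nrm F (g x) \<le> 2 * \<epsilon>"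
  proof (rule ccontr)
    assume "\<not> ?thesis"
    then have slope: "2 * \<epsilon> < differential_norm A nrm F (g x)" if "x \<in> Q" "F (g x) = \<Phi> g" for x
      using that by force
    have m': "m < \<Phi> g" using m \<Phi>c[OF g(1)] by linarith
    have e2: "0 < 2 * \<epsilon>" using \<epsilon> by simp
    have att': "\<exists>x\<in>Q. F (g x) = \<Phi> g" using att[OF g(1)] by blast
    obtain t G where G: "t > 0" "continuous_on ({0..1} \<times> Q) G" "\<And>x. x \<in> Q \<Longrightarrow> G (0::real, x) = g x"
      "\<And>s x. s \<in> {0..1} \<Longrightarrow> x \<in> Q \<Longrightarrow> F (G (s, x)) \<le> F (g x)"
      "\<And>s x. s \<in> {0..1} \<Longrightarrow> x \<in> Q \<Longrightarrow> F (g x) \<le> m \<Longrightarrow> G (s, x) = g x"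
      "\<And>x. x \<in> Q \<Longrightarrow> fdist (g x) (G (1, x)) \<le> t" "\<And>x. x \<in> Q \<Longrightarrow> F (G (1, x)) \<le> \<Phi> g - 2 * \<epsilon> * t / 2"
    proof (rule deformation_below_maximum[OF Q(1) X[OF g(1)] _ att' m' e2])
      show "F (g x) \<le> \<Phi> g" if "x \<in> Q" for x by (rule le\<Phi>[OF g(1) that])
      show "2 * \<epsilon> < differential_norm A nrm F (g x)" if "x \<in> Q" "F (g x) = \<Phi> g" for x
        by (rule slope[OF that])
    qed (rule that)
    define h where "h = (\<lambda>x. G (1, x))"
    have hX: "h \<in> X" unfolding h_def by (rule Xdef[OF g(1) G(2-5)])
    obtain x where x: "x \<in> Q" "F (h x) = \<Phi> h" using att[OF hX] by blast
    have "\<Phi> h \<le> \<Phi> g - \<epsilon> * t" using G(7)[OF x(1)] x(2) by (simp add: h_def)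
    moreover have "D g h \<le> t" by (rule Dle) (simp add: h_def G(6))
    then have "\<epsilon> * D g h \<le> \<epsilon> * t" using \<epsilon> by simp
    ultimately have "\<Phi> g \<le> \<Phi> h" by (intro g(3)[OF hX]) linarith
    moreover have "0 < \<epsilon> * t" using \<epsilon> G(1) by simp
    ultimately show False using \<open>\<Phi> h \<le> \<Phi> g - \<epsilon> * t\<close> by linarith
  qed
  then obtain x where "x \<in> Q" "F (g x) = \<Phi> g" "differential_norm A nrm F (g x) \<le> 2 * \<epsilon>" by blast
  then show thesis using that[of "g x"] \<Phi>c[OF g(1)] \<Phi>g by simp
qed

lemma palais_smale_critical_point:
  assumes PS: "palais_smale A nrm F c"
    and almost: "\<And>\<epsilon>. \<epsilon> > 0 \<Longrightarrow> \<exists>y. c \<le> F y \<and> F y < c + \<epsilon> \<and> differential_norm A nrm F y \<le> 2 * \<epsilon>"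
  obtains v where "critical_point A F v" "F v = c"
proof -
  have "\<exists>y. \<forall>k::nat. c \<le> F (y k) \<and> F (y k) < c + 1 / real (Suc k) \<and> differential_norm A nrm F (y k) \<le> 2 * (1 / real (Suc k))"
    by (intro choice allI almost) simp
  then obtain y where y: "\<And>k. c \<le> F (y k)" "\<And>k. F (y k) < c + 1 / real (Suc k)"
    "\<And>k. differential_norm A nrm F (y k) \<le> 2 * (1 / real (Suc k))" by blast
  have lim: "(\<lambda>k. 1 / real (Suc k)) \<longlonglongrightarrow> 0"
    using LIMSEQ_inverse_real_of_nat by (simp add: inverse_eq_divide)
  have "(\<lambda>k. c + 1 / real (Suc k)) \<longlonglongrightarrow> c + 0" by (intro tendsto_add tendsto_const lim)
  then have lim': "(\<lambda>k. c + 1 / real (Suc k)) \<longlonglongrightarrow> c" by simp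
  have Fy: "(\<lambda>k. F (y k)) \<longlonglongrightarrow> c"
    by (rule tendsto_sandwich[OF always_eventually always_eventually tendsto_const lim'])
      (use y(1) less_imp_le[OF y(2)] in blast)+
  have "(\<lambda>k. 2 * (1 / real (Suc k))) \<longlonglongrightarrow> 2 * 0" by (intro tendsto_mult tendsto_const lim)
  then have lim'': "(\<lambda>k. 2 * (1 / real (Suc k))) \<longlonglongrightarrow> 0" by simp
  have dn: "(\<lambda>k. differential_norm A nrm F (y k)) \<longlonglongrightarrow> 0"
    by (rule tendsto_sandwich[OF always_eventually always_eventually tendsto_const lim''])
      (use y(3) differential_norm_nonneg in blast)+
  obtain v r where r: "strict_mono r" "(y \<circ> r) \<longlonglongrightarrow> v"
    using PS Fy dn unfolding palais_smale_def by blast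
  have "(\<lambda>k. differential_norm A nrm F ((y \<circ> r) k)) \<longlonglongrightarrow> 0"
    using LIMSEQ_subseq_LIMSEQ[OF dn r(1)] by (simp add: o_def)
  then have crit: "critical_point A F v" by (rule critical_point_limit[OF r(2)])
  have "isCont F v" using continuous_on_functional[of UNIV] by (simp add: continuous_on_eq_continuous_at)
  then have "(\<lambda>k. F ((y \<circ> r) k)) \<longlonglongrightarrow> F v" using r(2) by (rule isCont_tendsto_compose)
  moreover have "(\<lambda>k. F ((y \<circ> r) k)) \<longlonglongrightarrow> c"
    using LIMSEQ_subseq_LIMSEQ[OF Fy r(1)] by (simp add: o_def)
  ultimately show thesis using that[OF crit] LIMSEQ_unique by blast
qed

text \<open>The minimax value \<open>c\<close> is only known to lie between \<open>a\<close> and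
  \<open>b\<close>, so the Palais-Smale condition is demanded on that whole interval. The previous
  lemmas are applied at \<open>c\<close> itself, which also bounds every maximum over the class from
  below.\<close>

lemma minimax_critical_point:
  fixes Q :: "'q::t2_space set"
  assumes Q: "compact Q" "Q \<noteq> {}"
    and X: "\<And>g. g \<in> X \<Longrightarrow> continuous_on Q g"
    and Xlim: "\<And>(u::nat \<Rightarrow> 'q \<Rightarrow> 'm) g. \<lbrakk>\<And>k. u k \<in> X; continuous_on Q g;
        \<And>e. e > 0 \<Longrightarrow> \<exists>k0. \<forall>k\<ge>k0. \<forall>x\<in>Q. fdist (u k x) (g x) < e\<rbrakk> \<Longrightarrow> g \<in> X"
    and Xdef: "\<And>g G. \<lbrakk>g \<in> X; continuous_on ({0..1::real} \<times> Q) G; \<And>x. x \<in> Q \<Longrightarrow> G (0, x) = g x;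
        \<And>s x. s \<in> {0..1} \<Longrightarrow> x \<in> Q \<Longrightarrow> F (G (s, x)) \<le> F (g x);
        \<And>s x. s \<in> {0..1} \<Longrightarrow> x \<in> Q \<Longrightarrow> F (g x) \<le> m \<Longrightarrow> G (s, x) = g x\<rbrakk> \<Longrightarrow> (\<lambda>x. G (1, x)) \<in> X"
    and m: "m < a"
    and low: "\<And>g. g \<in> X \<Longrightarrow> \<exists>x\<in>Q. a \<le> F (g x)"
    and g0: "g0 \<in> X" "\<And>x. x \<in> Q \<Longrightarrow> F (g0 x) \<le> b"
    and PS: "\<And>l. a \<le> l \<Longrightarrow> l \<le> b \<Longrightarrow> palais_smale A nrm F l"
  obtains v where "critical_point A F v" "a \<le> F v" "F v \<le> b"
proof -
  define \<Phi> where "\<Phi> g = (SUP x\<in>Q. F (g x))" for g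
  have att: "(\<forall>x\<in>Q. F (g x) \<le> \<Phi> g) \<and> (\<exists>x\<in>Q. F (g x) = \<Phi> g)" if "g \<in> X" for g
  proof -
    have "continuous_on Q (\<lambda>x. F (g x))"
      by (rule continuous_on_compose2[OF continuous_on_functional[of UNIV] X[OF that]]) simp
    from continuous_attains_sup[OF Q this] obtain x where x: "x \<in> Q" "\<And>z. z \<in> Q \<Longrightarrow> F (g z) \<le> F (g x)" by blast
    then have "\<Phi> g = F (g x)" unfolding \<Phi>_def by (intro cSup_eq_maximum) auto
    then show ?thesis using x by auto
  qed
  have \<Phi>a: "a \<le> \<Phi> g" if "g \<in> X" for g using low[OF that] att[OF that] order_trans by blast
  define c where "c = (INF g\<in>X. \<Phi> g)"
  have bb: "bdd_below (\<Phi> ` X)" by (rule bdd_belowI2[OF \<Phi>a])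
  have ac: "a \<le> c" unfolding c_def by (rule cINF_greatest) (use g0(1) \<Phi>a in auto)
  have c\<Phi>: "c \<le> \<Phi> g" if "g \<in> X" for g unfolding c_def by (rule cINF_lower[OF bb that])
  have "\<Phi> g0 \<le> b" using att[OF g0(1)] g0(2) by metis
  then have cb: "c \<le> b" using c\<Phi>[OF g0(1)] by linarith
  have "\<exists>y. c \<le> F y \<and> F y < c + \<epsilon> \<and> differential_norm A nrm F y \<le> 2 * \<epsilon>" if \<epsilon>: "\<epsilon> > 0" for \<epsilon>
  proof -
    have "c < c + \<epsilon>" using \<epsilon> by simp
    then obtain g where g: "g \<in> X" "\<Phi> g < c + \<epsilon>"
      unfolding c_def using cINF_less_iff[OF _ bb] g0(1) by (metis empty_iff)
    have lowc: "\<exists>x\<in>Q. c \<le> F (g x)" if "g \<in> X" for g using att[OF that] c\<Phi>[OF that] by metis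
    have lt: "F (g x) < c + \<epsilon>" if "x \<in> Q" for x using att[OF g(1)] g(2) that by force
    have mc: "m < c" using m ac by linarith
    show ?thesis
      by (rule minimax_almost_critical[where Q = Q and X = X and m = m and c = c and \<epsilon> = \<epsilon> and ?g0.0 = g])
        (fact Q | fact X | fact Xlim | fact Xdef | fact mc | fact lowc | fact g | fact lt | fact \<epsilon> | blast)+
  qed
  from palais_smale_critical_point[OF PS[OF ac cb] this] show thesis using that ac cb by metis
qed

end

section \<open>Linking and the two critical points\<close>

text \<open>A map with the same boundary values that omitted \<open>z\<close> would make the degree
  vanish by \<open>brouwer_degree_eq_0_if_extension\<close>.\<close>

lemma degree_nonzero_imp_hits:
  fixes f g :: "'a::euclidean_space \<Rightarrow> 'a"
  assumes K: "K = closure U" "open U" "bounded U"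
    and deg: "brouwer_degree f (interior K) z \<noteq> 0"
    and f: "continuous_on K f" and g: "continuous_on K g"
    and fg: "\<And>x. x \<in> frontier K \<Longrightarrow> g x = f x"
  obtains x where "x \<in> K" "g x = z"
proof -
  have "closed K" using K by simp
  \<comment> \<open>The interior of \<open>K\<close> may be larger than \<open>U\<close>, but it has
    the same closure, so its frontier is that of \<open>K\<close>.\<close>
  have "U \<subseteq> interior K" using K by (simp add: closure_subset interior_maximal)
  then have cl: "closure (interior K) = K"
    using K \<open>closed K\<close> by (metis closure_minimal closure_mono interior_subset subset_antisym)
  have fr: "frontier (interior K) = frontier K"
    by (simp add: frontier_def cl closure_closed[OF \<open>closed K\<close>])
  have "bounded (interior K)" using K by (meson bounded_closure bounded_interior)
  then have "z \<in> g ` K"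
    using brouwer_degree_eq_0_if_extension[of "interior K" f g z] deg f g fg by (auto simp: cl fr)
  then show thesis using that by blast
qed

text \<open>If \<open>g\<close> avoided the upward ray from \<open>(0, r)\<close>, segments to a
  point straight below would contract it without meeting \<open>(0, r)\<close>. Then
  \<open>f\<close> is null homotopic on the frontier in the punctured space, so its boundary values
  extend over \<open>K\<close> with values there, against the nonzero degree.\<close>

lemma degree_nonzero_imp_meets_ray:
  fixes f g :: "'a::euclidean_space \<times> real \<Rightarrow> 'a \<times> real"
  assumes K: "K = closure U" "open U" "bounded U"
    and deg: "brouwer_degree f (interior K) (0, r) \<noteq> 0"
    and f: "continuous_on K f"
    and fg: "homotopic_with_canon (\<lambda>_. True) (frontier K) (- {(0, r)}) f g"
  obtains x where "x \<in> frontier K" "g x \<in> {0} \<times> {r..}"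
proof (rule ccontr)
  assume nt: "\<not> thesis"
  note meets = that
  have avoid: "g x \<notin> {0} \<times> {r..}" if x: "x \<in> frontier K" for x
  proof
    assume "g x \<in> {0} \<times> {r..}"
    with x have thesis by (rule meets)
    with nt show False by simp
  qed
  have g: "continuous_on (frontier K) g" using homotopic_with_imp_continuous[OF fg] by simp
  \<comment> \<open>A segment ending at \<open>p\<close> can pass through \<open>(0, r)\<close> only
    if it starts on the ray opposite to \<open>p\<close>, which is the avoided one.\<close>
  define p where "p = ((0::'a), r - 1)"
  have "homotopic_with_canon (\<lambda>_. True) (frontier K) (- {(0, r)}) g (\<lambda>_. p)"
  proof (rule homotopic_with_linear[OF g continuous_on_const])
    fix x assume x: "x \<in> frontier K"
    show "closed_segment (g x) p \<subseteq> - {(0, r)}"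
    proof
      fix w assume "w \<in> closed_segment (g x) p"
      then obtain u where u: "0 \<le> u" "u \<le> 1" "w = (1 - u) *\<^sub>R g x + u *\<^sub>R p"
        by (auto simp: in_segment)
      show "w \<in> - {(0, r)}"
      proof
        assume "w \<in> {(0, r)}"
        then have w1: "(1 - u) *\<^sub>R fst (g x) = 0" and w2: "(1 - u) * snd (g x) + u * (r - 1) = r"
          using u(3) by (auto simp: p_def prod_eq_iff)
        have "u \<noteq> 1" using w2 by auto
        then have u1: "1 - u > 0" using u(2) by simp
        then have "fst (g x) = 0" using w1 by simp
        moreover have "(1 - u) * (snd (g x) - r) = u" using w2 by (simp add: algebra_simps)
        then have "0 \<le> snd (g x) - r" using u(1) u1 by (metis zero_le_mult_iff not_less less_le)
        ultimately show False using avoid[OF x] by (simp add: mem_Times_iff)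
      qed
    qed
  qed
  \<comment> \<open>The constant map extends over \<open>K\<close>; by Borsuk's homotopy extension
    so does \<open>f\<close>, the punctured space being open and thus an ANR.\<close>
  from homotopic_with_trans[OF fg this]
  have "homotopic_with_canon (\<lambda>_. True) (frontier K) (- {(0, r)}) (\<lambda>_. p) f"
    by (rule homotopic_with_symD)
  then obtain f' where f': "continuous_on K f'" "f' ` K \<subseteq> - {(0, r)}" "\<And>x. x \<in> frontier K \<Longrightarrow> f' x = f x"
  proof (rule Borsuk_homotopy_extension_homotopic[rotated 4])
    show "closedin (top_of_set K) (frontier K)"
      using K by (simp add: closed_subset frontier_subset_closed)
    show "ANR (frontier K) \<and> ANR K \<or> ANR (- {(0::'a, r)})" by (simp add: open_imp_ANR open_Compl)
    show "(\<lambda>_. p) \<in> K \<rightarrow> - {(0, r)}" by (simp add: p_def)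
  qed auto
  from degree_nonzero_imp_hits[OF K deg f f'(1,3)] obtain x where x: "x \<in> K" "f' x = (0, r)" by metis
  from imageI[OF x(1), of f'] x(2) have "(0, r) \<in> f' ` K" by simp
  then show False using f'(2) by blast
qed

text \<open>The infima \<open>a\<close> and \<open>d\<close> are extended reals, so that empty sets
  and values unbounded below are covered; the maxima \<open>b\<close> and \<open>e\<close> are given
  as attained upper bounds. Since \<open>b < d\<close> separates the values, the two critical points
  differ.\<close>

theorem theorem6p1:
  fixes A :: "('m::t3_space, 'e::banach) chart set"
    and nrm :: "('m, 'e) chart \<Rightarrow> 'm \<Rightarrow> 'e \<Rightarrow> real"
    and F :: "'m \<Rightarrow> real"
    and \<beta> :: "'m \<Rightarrow> real ^ 'n"
    and \<gamma> :: "'m \<Rightarrow> real"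
    and \<Psi> :: "'m \<Rightarrow> (real ^ 'n) \<times> real"
    and \<gamma>s :: real
    and zs :: "(real ^ 'n) \<times> real"
    and As Zs :: "'m set"
    and U K :: "((real ^ 'n) \<times> real) set"
    and Pi :: "(real ^ 'n) \<times> real \<Rightarrow> 'm"
    and a d :: ereal
    and b e S0 \<kappa> :: real
  assumes M: "complete_C1_finsler_manifold A nrm"
    and F: "C1_functional A F"
    and Psi: "\<Psi> = (\<lambda>u. (\<beta> u, \<gamma> u))" "continuous_on UNIV \<Psi>"
    and gs: "\<gamma>s > 0"
    and zs: "zs = (0, \<gamma>s)"
    and As: "As = \<Psi> -` ({0} \<times> {\<gamma>s..})"
    and Zs: "Zs = \<Psi> -` {zs}"
    and U: "open U" "bounded U" "U homeomorphic ball (0 :: (real ^ 'n) \<times> real) 1"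
    and K: "K = closure U"
    and Pi: "continuous_on K Pi"
    and bd: "zs \<notin> (\<Psi> \<circ> Pi) ` frontier K"
    and deg: "brouwer_degree (\<Psi> \<circ> Pi) (interior K) zs \<noteq> 0"
    and a: "a = (INF u\<in>As. ereal (F u))"
    and b: "b \<in> (F \<circ> Pi) ` frontier K" "\<forall>x\<in>frontier K. (F \<circ> Pi) x \<le> b"
    and d: "d = (INF u\<in>Zs. ereal (F u))"
    and e: "e \<in> (F \<circ> Pi) ` K" "\<forall>x\<in>K. (F \<circ> Pi) x \<le> e"
    and S0: "S0 < \<kappa>"
    and PS: "\<forall>l\<in>{S0<..<\<kappa>}. palais_smale A nrm F l"
  shows "(ereal S0 < a \<and> a \<le> ereal b \<and> ereal b < min d (ereal \<kappa>) \<longrightarrow>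
            (\<exists>v1. critical_point A F v1 \<and> a \<le> ereal (F v1) \<and> F v1 \<le> b)) \<and>
         (ereal S0 < a \<and> a \<le> ereal b \<and> ereal b < min d (ereal \<kappa>) \<and>
          ereal b < d \<and> d \<le> ereal e \<and> e < \<kappa> \<longrightarrow>
            (\<exists>v1 v2. critical_point A F v1 \<and> a \<le> ereal (F v1) \<and> F v1 \<le> b \<and>
                     critical_point A F v2 \<and> d \<le> ereal (F v2) \<and> F v2 \<le> e \<and>
                     v1 \<noteq> v2 \<and> F v1 < F v2))"
proof -
  interpret finsler_manifold A nrm
    using M by unfold_locales (simp_all add: complete_C1_finsler_manifold_def)
  interpret complete_finsler_functional A nrm F
    using M F by unfold_locales (simp_all add: complete_C1_finsler_manifold_def)
  let ?f = "\<Psi> \<circ> Pi"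
  have cK: "compact K" using U(2) K by (simp add: compact_closure)
  have clK: "closed K" using cK by (rule compact_imp_closed)
  have frK: "frontier K \<subseteq> K" using clK by (rule frontier_subset_closed)
  have cfr: "compact (frontier K)" using cK by (rule compact_frontier)
  have frne: "frontier K \<noteq> {}" using b(1) by auto
  have f: "continuous_on K ?f"
    by (rule continuous_on_compose[OF Pi continuous_on_subset[OF Psi(2)]]) simp
  have Zs_d: "d \<le> ereal (F u)" if "\<Psi> u = zs" for u
    unfolding d by (rule INF_lower) (simp add: Zs that)
  have part1: "\<exists>v1. critical_point A F v1 \<and> a \<le> ereal (F v1) \<and> F v1 \<le> b"
    if hyp: "ereal S0 < a" "a \<le> ereal b" "ereal b < min d (ereal \<kappa>)"
  proof -
    \<comment> \<open>Lying between \<open>S0\<close> and \<open>b\<close>, the infimum is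
      finite.\<close>
    obtain a' where a': "a = ereal a'" using hyp(1,2) by (cases a) auto
    have bd': "ereal b < d" "b < \<kappa>" using hyp(3) by auto
    \<comment> \<open>This is where \<open>b < d\<close> enters: maps in the sublevel set of
      \<open>b\<close> cannot meet \<open>Zs\<close>, so every deformation within it gives a
      homotopy off \<open>zs\<close>.\<close>
    have off: "\<Psi> u \<noteq> zs" if "F u \<le> b" for u
      using Zs_d[of u] bd'(1) that by (metis ereal_less_eq(3) not_less order_trans)
    define X where "X = {g. continuous_on (frontier K) g \<and> (\<forall>x\<in>frontier K. F (g x) \<le> b) \<and>
      homotopic_with_canon (\<lambda>_. True) (frontier K) (- {zs}) ?f (\<Psi> \<circ> g)}"
    obtain v where "critical_point A F v" "a' \<le> F v" "F v \<le> b"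
    \<comment> \<open>No set has to be held fixed here, so \<open>m\<close> may be any number below
      \<open>a'\<close>.\<close>
    proof (rule minimax_critical_point[OF cfr frne, where X = X and m = "a' - 1" and a = a' and b = b and ?g0.0 = Pi])
      show "continuous_on (frontier K) g" if "g \<in> X" for g using that by (simp add: X_def)
    next
      fix u :: "nat \<Rightarrow> (real ^ 'n) \<times> real \<Rightarrow> 'm" and g
      assume u: "\<And>k. u k \<in> X" and g: "continuous_on (frontier K) g"
        and unif: "\<And>e. e > 0 \<Longrightarrow> \<exists>k0. \<forall>k\<ge>k0. \<forall>x\<in>frontier K. fdist (u k x) (g x) < e"
      have Fg: "F (g x) \<le> b" if x: "x \<in> frontier K" for x
      proof -
        have "(\<lambda>k. fdist (g x) (u k x)) \<longlonglongrightarrow> 0"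
        proof (rule LIMSEQ_I)
          fix e :: real assume "e > 0"
          then obtain k0 where "\<forall>k\<ge>k0. \<forall>x\<in>frontier K. fdist (u k x) (g x) < e" using unif by blast
          then show "\<exists>k0. \<forall>k\<ge>k0. norm (fdist (g x) (u k x) - 0) < e"
            using x by (intro exI[of _ k0]) (simp add: fdist_sym[of "g x"])
        qed
        then have "(\<lambda>k. u k x) \<longlonglongrightarrow> g x" by (simp add: tendsto_iff_fdist)
        moreover have "isCont F (g x)" using continuous_on_functional[of UNIV] by (simp add: continuous_on_eq_continuous_at)
        ultimately have "(\<lambda>k. F (u k x)) \<longlonglongrightarrow> F (g x)" by (rule isCont_tendsto_compose[rotated])
        moreover have "F (u k x) \<le> b" for k using u[of k] x by (simp add: X_def)
        ultimately show ?thesis by (intro tendsto_upperbound[of "\<lambda>k. F (u k x)" _ sequentially]) auto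
      qed
      have offg: "\<Psi> (g x) \<noteq> zs" if "x \<in> frontier K" for x using off Fg that by blast
      obtain k where k: "\<And>x. x \<in> frontier K \<Longrightarrow> norm (\<Psi> (u k x) - \<Psi> (g x)) < norm (\<Psi> (g x) - zs)"
        using uniform_limit_compose[OF cfr Psi(2) g unif offg] by metis
      have \<Psi>c: "continuous_on (frontier K) (\<Psi> \<circ> h)" if "continuous_on (frontier K) h" for h
        by (rule continuous_on_compose[OF that continuous_on_subset[OF Psi(2)]]) simp
      \<comment> \<open>For a good \<open>k\<close>, every point of the segment is closer to
        \<open>\<Psi> (g x)\<close> than \<open>zs\<close> is, so the limit stays in the homotopy
        class.\<close>
      have "homotopic_with_canon (\<lambda>_. True) (frontier K) (- {zs}) (\<Psi> \<circ> u k) (\<Psi> \<circ> g)"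
      proof (rule homotopic_with_linear)
        show "continuous_on (frontier K) (\<Psi> \<circ> u k)" using u[of k] by (intro \<Psi>c) (simp add: X_def)
        show "continuous_on (frontier K) (\<Psi> \<circ> g)" by (rule \<Psi>c[OF g])
        fix x assume x: "x \<in> frontier K"
        show "closed_segment ((\<Psi> \<circ> u k) x) ((\<Psi> \<circ> g) x) \<subseteq> - {zs}"
        proof
          fix w assume "w \<in> closed_segment ((\<Psi> \<circ> u k) x) ((\<Psi> \<circ> g) x)"
          from segment_bound(2)[OF this] have "norm (\<Psi> (g x) - w) \<le> norm (\<Psi> (g x) - \<Psi> (u k x))"
            by (simp add: norm_minus_commute)
          also have "\<dots> < norm (\<Psi> (g x) - zs)" using k[OF x] by (simp add: norm_minus_commute)
          finally show "w \<in> - {zs}" by auto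
        qed
      qed
      moreover have "homotopic_with_canon (\<lambda>_. True) (frontier K) (- {zs}) ?f (\<Psi> \<circ> u k)"
        using u[of k] by (simp add: X_def)
      ultimately show "g \<in> X" using g Fg homotopic_with_trans by (auto simp: X_def)
    next
      fix g and G :: "real \<times> ((real ^ 'n) \<times> real) \<Rightarrow> 'm"
      assume g: "g \<in> X" and G: "continuous_on ({0..1} \<times> frontier K) G"
        and G0: "\<And>x. x \<in> frontier K \<Longrightarrow> G (0, x) = g x"
        and GF: "\<And>s x. s \<in> {0..1} \<Longrightarrow> x \<in> frontier K \<Longrightarrow> F (G (s, x)) \<le> F (g x)"
      have GFb: "F (G (s, x)) \<le> b" if "s \<in> {0..1}" "x \<in> frontier K" for s x
        using GF[OF that] g that(2) by (force simp: X_def)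
      have "homotopic_with_canon (\<lambda>_. True) (frontier K) (- {zs}) (\<Psi> \<circ> g) (\<Psi> \<circ> (\<lambda>x. G (1, x)))"
      proof (subst homotopic_with, simp, intro exI conjI ballI)
        have "continuous_on ({0..1} \<times> frontier K) (\<lambda>p. \<Psi> (G p))"
          by (rule continuous_on_compose2[OF Psi(2) G]) simp
        moreover have "\<Psi> (G p) \<noteq> zs" if "p \<in> {0..1} \<times> frontier K" for p
          using that by (cases p) (simp only: mem_Times_iff fst_conv snd_conv off[OF GFb] not_False_eq_True)
        ultimately show "continuous_map (prod_topology (top_of_set {0..1}) (top_of_set (frontier K))) (top_of_set (- {zs})) (\<lambda>p. \<Psi> (G p))"
          by (auto simp: prod_topology_subtopology_eu continuous_map_in_subtopology simp del: mem_Times_iff)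
      qed (simp_all add: G0)
      moreover have "homotopic_with_canon (\<lambda>_. True) (frontier K) (- {zs}) ?f (\<Psi> \<circ> g)"
        using g by (simp add: X_def)
      moreover have "continuous_on (frontier K) (\<lambda>x. G (1, x))"
        by (rule continuous_on_compose2[OF G]) (auto intro!: continuous_intros)
      ultimately show "(\<lambda>x. G (1, x)) \<in> X"
        using GFb homotopic_with_trans by (auto simp: X_def)
    next
      fix g assume g: "g \<in> X"
      then have "homotopic_with_canon (\<lambda>_. True) (frontier K) (- {(0, \<gamma>s)}) ?f (\<Psi> \<circ> g)" by (simp add: X_def zs)
      then obtain x where x: "x \<in> frontier K" "(\<Psi> \<circ> g) x \<in> {0} \<times> {\<gamma>s..}"
        using degree_nonzero_imp_meets_ray[OF K U(1,2) deg[unfolded zs] f] by metis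
      then have "a \<le> ereal (F (g x))" unfolding a by (intro INF_lower) (simp add: As)
      then show "\<exists>x\<in>frontier K. a' \<le> F (g x)" using x(1) a' by auto
    next
      have "continuous_on (frontier K) ?f" by (rule continuous_on_subset[OF f frK])
      then have "homotopic_with_canon (\<lambda>_. True) (frontier K) (- {zs}) ?f ?f"
        using bd by (auto simp: continuous_map_in_subtopology)
      then show "Pi \<in> X" using b(2) continuous_on_subset[OF Pi frK] by (simp add: X_def)
    next
      show "F (Pi x) \<le> b" if "x \<in> frontier K" for x using b(2) that by simp
      show "palais_smale A nrm F l" if "a' \<le> l" "l \<le> b" for l
        using PS hyp(1) a' bd'(2) that by auto
    qed (simp_all add: that)
    then show ?thesis using a' by auto
  qed
  have part2: "\<exists>v2. critical_point A F v2 \<and> d \<le> ereal (F v2) \<and> F v2 \<le> e"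
    if hyp: "ereal S0 < a" "a \<le> ereal b" "ereal b < d" "d \<le> ereal e" "e < \<kappa>"
  proof -
    obtain d' where d': "d = ereal d'" using hyp(3,4) by (cases d) auto
    \<comment> \<open>All levels from \<open>d'\<close> to \<open>e\<close> lie in the Palais-Smale
      range, as \<open>S0 < a \<le> b < d\<close>.\<close>
    have S0b: "S0 < b" using hyp(1,2) by (meson ereal_less_eq(3) le_less_trans less_ereal.simps(1) less_le_trans)
    define X where "X = {g. continuous_on K g \<and> (\<forall>x\<in>frontier K. g x = Pi x)}"
    obtain v where "critical_point A F v" "d' \<le> F v" "F v \<le> e"
    \<comment> \<open>With \<open>m = b\<close> the deformations rest on the frontier, where maps of
      the class equal \<open>Pi\<close> and \<open>F \<circ> Pi \<le> b\<close>; the requirement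
      \<open>m < d'\<close> is the hypothesis \<open>b < d\<close>.\<close>
    proof (rule minimax_critical_point[OF cK, where X = X and m = b and a = d' and b = e and ?g0.0 = Pi])
      show "K \<noteq> {}" using frK frne by auto
      show "continuous_on K g" if "g \<in> X" for g using that by (simp add: X_def)
    next
      fix u :: "nat \<Rightarrow> (real ^ 'n) \<times> real \<Rightarrow> 'm" and g
      assume u: "\<And>k. u k \<in> X" and g: "continuous_on K g"
        and unif: "\<And>e. e > 0 \<Longrightarrow> \<exists>k0. \<forall>k\<ge>k0. \<forall>x\<in>K. fdist (u k x) (g x) < e"
      have "g x = Pi x" if x: "x \<in> frontier K" for x
      proof -
        have "fdist (Pi x) (g x) < e" if e: "e > 0" for e
        proof -
          obtain k where "fdist (u k x) (g x) < e" using unif[OF e] x frK by blast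
          then show ?thesis using u[of k] x by (simp add: X_def)
        qed
        then have "fdist (Pi x) (g x) \<le> 0" by (meson not_less less_irrefl)
        then show ?thesis by (metis fdist_eq_0_imp_eq)
      qed
      then show "g \<in> X" using g by (simp add: X_def)
    next
      fix g and G :: "real \<times> ((real ^ 'n) \<times> real) \<Rightarrow> 'm"
      assume g: "g \<in> X" and G: "continuous_on ({0..1} \<times> K) G"
        and Gm: "\<And>s x. s \<in> {0..1} \<Longrightarrow> x \<in> K \<Longrightarrow> F (g x) \<le> b \<Longrightarrow> G (s, x) = g x"
      have "G (1, x) = Pi x" if x: "x \<in> frontier K" for x
        using Gm[of 1 x] g b(2) x frK by (auto simp: X_def)
      moreover have "continuous_on K (\<lambda>x. G (1, x))"
        by (rule continuous_on_compose2[OF G]) (auto intro!: continuous_intros)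
      ultimately show "(\<lambda>x. G (1, x)) \<in> X" by (simp add: X_def)
    next
      fix g assume g: "g \<in> X"
      have "continuous_on K (\<Psi> \<circ> g)"
        by (rule continuous_on_compose[OF _ continuous_on_subset[OF Psi(2)]]) (use g in \<open>simp_all add: X_def\<close>)
      then obtain x where x: "x \<in> K" "(\<Psi> \<circ> g) x = zs"
        by (rule degree_nonzero_imp_hits[OF K U(1,2) deg f]) (use g in \<open>simp add: X_def\<close>)
      then show "\<exists>x\<in>K. d' \<le> F (g x)" using Zs_d[of "g x"] d' by auto
    next
      show "Pi \<in> X" using Pi by (simp add: X_def)
      show "F (Pi x) \<le> e" if "x \<in> K" for x using e(2) that by simp
      show "b < d'" using hyp(3) d' by simp
      show "palais_smale A nrm F l" if "d' \<le> l" "l \<le> e" for l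
        using PS S0b hyp(3,5) d' that by auto
    qed (rule that)
    then show ?thesis using d' by auto
  qed
  show ?thesis
  proof (intro conjI impI; elim conjE)
    assume "ereal S0 < a" "a \<le> ereal b" "ereal b < min d (ereal \<kappa>)"
    then show "\<exists>v1. critical_point A F v1 \<and> a \<le> ereal (F v1) \<and> F v1 \<le> b" by (rule part1)
  next
    assume hyp: "ereal S0 < a" "a \<le> ereal b" "ereal b < min d (ereal \<kappa>)" "ereal b < d" "d \<le> ereal e" "e < \<kappa>"
    obtain v1 where v1: "critical_point A F v1" "a \<le> ereal (F v1)" "F v1 \<le> b" using part1[OF hyp(1-3)] by blast
    obtain v2 where v2: "critical_point A F v2" "d \<le> ereal (F v2)" "F v2 \<le> e" using part2[OF hyp(1,2,4-6)] by blast
    have "ereal b < ereal (F v2)" using hyp(4) v2(2) by (rule less_le_trans)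
    then have "F v1 < F v2" using v1(3) by simp
    then show "\<exists>v1 v2. critical_point A F v1 \<and> a \<le> ereal (F v1) \<and> F v1 \<le> b \<and>
                     critical_point A F v2 \<and> d \<le> ereal (F v2) \<and> F v2 \<le> e \<and>
                     v1 \<noteq> v2 \<and> F v1 < F v2"
      using v1 v2 by (intro exI[of _ v1] exI[of _ v2]) auto
  qed
qed

end
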